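(* Let $n\geqslant 2$, let $D\subset\mathbb{R}^n$ be a domain with a weakly flat boundary, and let $D'\subset\mathbb{R}^n$ be a domain that is finitely connected at its boundary. Let $Q:\mathbb{R}^n\to[0,\infty]$ be a Lebesgue measurable function, and let $f$ be an open, discrete and closed mapping of $D$ onto $D'$ satisfying the inverse Poletsky inequality relative to $n$-modulus (that is, $p=n$) with this $Q$ at every point $y_0\in\partial D'$. Assume that one of the following conditions holds: 1) $Q\in FMO(\partial D')$; 2) for any $y_0\in\partial D'$ there is $\delta(y_0)>0$ such that for any $0<b_0<\delta(y_0)$ there is $0<a<b_0$ such that $$\int_a^{b_0}\frac{dt}{t\,q_{y_0}^{1/(n-1)}(t)}>0;$$ 3) for any point $y_0\in\partial D'$ and any $0<r_1<r_2<r_0:=\sup_{y\in D'}|y-y_0|$ there is a set $E\subset[r_1,r_2]$ of positive linear Lebesgue measure such that $Q$ is integrable on $S(y_0,r)$ (with respect to $\mathcal{H}^{n-1}$) for every $r\in E$; 4) $Q\in L^1(D')$. Then $f$ has a continuous extension $\overline{f}:\overline{D}\to\overline{D'}$, and $\overline{f}(\overline{D})=\overline{D'}$.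
   Context: All closures and boundaries are taken in $\overline{\mathbb{R}^n}=\mathbb{R}^n\cup\{\infty\}$, which carries the chordal metric $h(x,\infty)=\frac{1}{\sqrt{1+|x|^2}}$, $h(x,y)=\frac{|x-y|}{\sqrt{1+|x|^2}\sqrt{1+|y|^2}}$ for $x\ne\infty\ne y$; continuity of extensions is with respect to $h$, and neighborhoods are in $\overline{\mathbb{R}^n}$. $S(y_0,r)=\{y:|y-y_0|=r\}$, $B(y_0,r)=\{y:|y-y_0|<r\}$, $A(y_0,r_1,r_2)=\{y\in\mathbb{R}^n: r_1<|y-y_0|<r_2\}$. $M_p(\Gamma)$ is the $p$-modulus of a path family $\Gamma$: the infimum of $\int_{\mathbb{R}^n}\rho^p\,dm$ over Borel $\rho:\mathbb{R}^n\to[0,\infty]$ with $\int_\gamma\rho\,ds\geqslant1$ for every locally rectifiable $\gamma\in\Gamma$; $M=M_n$. For $E,F\subset\overline{\mathbb{R}^n}$ and a domain $D\subset\mathbb{R}^n$, $\Gamma(E,F,D)$ is the family of all paths $\gamma:[a,b]\to\overline{\mathbb{R}^n}$ with $\gamma(a)\in E$, $\gamma(b)\in F$, $\gamma(t)\in D$ for $t\in(a,b)$ (same notation with an annulus in place of $D$). Inverse Poletsky inequality: for $f:D\to\mathbb{R}^n$, $y_0\in\overline{f(D)}\setminus\{\infty\}$ and $0<r_1<r_2<r_0=\sup_{y\in f(D)}|y-y_0|$, let $\Gamma_f(y_0,r_1,r_2)$ be the family of all paths $\gamma$ in $D$ such that $f(\gamma)\in\Gamma(S(y_0,r_1),S(y_0,r_2),A(y_0,r_1,r_2))$.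 $f$ satisfies the inverse Poletsky inequality at $y_0$ relative to $p$-modulus with $Q$ if for all such $r_1,r_2$ $$M_p(\Gamma_f(y_0,r_1,r_2))\leqslant\int_{A(y_0,r_1,r_2)\cap f(D)}Q(y)\,\eta^p(|y-y_0|)\,dm(y)$$ for every Lebesgue measurable $\eta:(r_1,r_2)\to[0,\infty]$ with $\int_{r_1}^{r_2}\eta(r)\,dr\geqslant1$. Conditions at $y_0=\infty$ are understood via the inversion $\iota(y)=y/|y|^2$: they are imposed at the point $0$ for the mapping $\iota\circ f$, the image $\iota(D')$ and the function $Q\circ\iota$. $f:D\to\mathbb{R}^n$ is discrete if every $f^{-1}(y)$ consists of isolated points, open if images of open sets are open; a mapping $f$ of $D$ onto $D'$ is closed if $f(E)$ is closed in $D'$ for every $E$ closed in $D$. $D$ is finitely connected at its boundary if for every $x_0\in\partial D$ and every neighborhood $U$ of $x_0$ there is a neighborhood $V\subset U$ of $x_0$ such that $V\cap D$ has finitely many components. $\partial D$ is weakly flat if for every $x_0\in\partial D$, every $P>0$ and every neighborhood $U$ of $x_0$ there is a neighborhood $V\subset U$ of $x_0$ such that $M(\Gamma(E,F,D))>P$ for all continua $E,F\subset D$ that intersect both $\partial U$ and $\partial V$. $q_{y_0}(r)=\frac{1}{\omega_{n-1}r^{n-1}}\int_{S(y_0,r)}Q\,d\mathcal{H}^{n-1}$, where $\omega_{n-1}$ is the area of the unit sphere in $\mathbb{R}^n$. $Q\in FMO(x_0)$ (finite mean oscillation) means $\limsup_{\varepsilon\to0}\frac{1}{\Omega_n\varepsilon^n}\int_{B(x_0,\varepsilon)}|Q(x)-\overline{Q}_\varepsilon|\,dm(x)<\infty$,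 where $\overline{Q}_\varepsilon=\frac{1}{\Omega_n\varepsilon^n}\int_{B(x_0,\varepsilon)}Q\,dm$ and $\Omega_n$ is the volume of the unit ball; $Q\in FMO(A)$ means $Q\in FMO(x_0)$ for every $x_0\in A$. Conventions: $a/\infty=0$ for finite $a$, $a/0=\infty$ for $a>0$, $0\cdot\infty=0$. *)

theory Defs
  imports "HOL-Analysis.Analysis"
begin

section \<open>The extended space with the chordal metric\<close>

datatype 'a ext = Fin 'a | Infty

fun chordal :: "'a::real_inner ext \<Rightarrow> 'a ext \<Rightarrow> real" where
  "chordal (Fin x) (Fin y) = norm (x - y) / (sqrt (1 + (norm x)\<^sup>2) * sqrt (1 + (norm y)\<^sup>2))"
| "chordal (Fin x) Infty = 1 / sqrt (1 + (norm x)\<^sup>2)"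
| "chordal Infty (Fin y) = 1 / sqrt (1 + (norm y)\<^sup>2)"
| "chordal Infty Infty = 0"

text \<open>Stereographic projection onto the sphere of radius 1/2 centred at (0, 1/2): the chordal
  metric is the distance between the images. It serves only to prove the triangle inequality.\<close>

fun stereographic :: "'a::real_inner ext \<Rightarrow> 'a \<times> real" where
  "stereographic (Fin x) = (x /\<^sub>R (1 + (norm x)\<^sup>2), (norm x)\<^sup>2 / (1 + (norm x)\<^sup>2))"
| "stereographic Infty = (0, 1)"

lemma chordal_eq_dist_stereographic:
  fixes p q :: "'a::real_inner ext"
  shows "chordal p q = dist (stereographic p) (stereographic q)"
proof -
  have fin: "chordal (Fin x) (Fin y) = dist (stereographic (Fin x)) (stereographic (Fin y))"
    for x y :: 'a
  proof -
    define X where "X = x \<bullet> x"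
    define Y where "Y = y \<bullet> y"
    define c where "c = x \<bullet> y"
    have pos: "1 + X > 0" "1 + Y > 0"
      unfolding X_def Y_def by (simp_all add: add_pos_nonneg)
    have "(dist (stereographic (Fin x)) (stereographic (Fin y)))\<^sup>2
        = (norm (x /\<^sub>R (1 + X) - y /\<^sub>R (1 + Y)))\<^sup>2 + (X / (1 + X) - Y / (1 + Y))\<^sup>2"
      by (simp add: dist_Pair_Pair dist_norm X_def Y_def power2_norm_eq_inner)
        (simp add: power2_eq_square)
    also have "(norm (x /\<^sub>R (1 + X) - y /\<^sub>R (1 + Y)))\<^sup>2
        = X / (1 + X)\<^sup>2 - 2 * c / ((1 + X) * (1 + Y)) + Y / (1 + Y)\<^sup>2"
      unfolding power2_norm_eq_inner
      by (simp add: inner_diff X_def Y_def c_def inner_commute divide_inverse power2_eq_square)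
    also have "X / (1 + X)\<^sup>2 - 2 * c / ((1 + X) * (1 + Y)) + Y / (1 + Y)\<^sup>2
          + (X / (1 + X) - Y / (1 + Y))\<^sup>2 = (X - 2 * c + Y) / ((1 + X) * (1 + Y))"
    proof -
      have "1 + X \<noteq> 0" "1 + Y \<noteq> 0" using pos by auto
      then show ?thesis by (simp add: divide_simps power2_eq_square) algebra
    qed
    also have "\<dots> = (chordal (Fin x) (Fin y))\<^sup>2"
    proof -
      have "(norm (x - y))\<^sup>2 = X - 2 * c + Y"
        by (simp add: power2_norm_eq_inner inner_diff X_def Y_def c_def inner_commute)
      then show ?thesis
        using pos
        by (simp add: power_divide power_mult_distrib)
          (simp add: X_def Y_def power2_norm_eq_inner)
    qed
    finally have "(chordal (Fin x) (Fin y))\<^sup>2 = (dist (stereographic (Fin x)) (stereographic (Fin y)))\<^sup>2"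
      by (rule sym)
    then show ?thesis
      by (rule power2_eq_imp_eq) simp_all
  qed
  have inf: "chordal (Fin x) Infty = dist (stereographic (Fin x)) (stereographic Infty)" for x :: 'a
  proof -
    define X where "X = (norm x)\<^sup>2"
    have pos: "1 + X > 0"
      unfolding X_def by (simp add: add_pos_nonneg)
    have "(dist (stereographic (Fin x)) (stereographic Infty))\<^sup>2
        = X / (1 + X)\<^sup>2 + (X / (1 + X) - 1)\<^sup>2"
      unfolding stereographic.simps dist_Pair_Pair
      by (simp add: dist_norm X_def power_mult_distrib divide_inverse power_inverse mult.commute)
    also have "\<dots> = 1 / (1 + X)"
    proof -
      have "1 + X \<noteq> 0" using pos by auto
      then show ?thesis by (simp add: divide_simps power2_eq_square)
    qed
    also have "\<dots> = (chordal (Fin x) Infty)\<^sup>2"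
      using pos by (simp add: power_divide X_def)
    finally have "(chordal (Fin x) Infty)\<^sup>2 = (dist (stereographic (Fin x)) (stereographic Infty))\<^sup>2"
      by (rule sym)
    then show ?thesis
      by (rule power2_eq_imp_eq) simp_all
  qed
  have sym: "chordal Infty (Fin y) = dist (stereographic Infty) (stereographic (Fin y))" for y :: 'a
    using inf[of y] by (simp add: dist_commute del: stereographic.simps)
  show ?thesis
    by (cases p; cases q) (simp_all only: fin inf sym chordal.simps stereographic.simps dist_self)
qed

lemma chordal_eq_0_iff: "chordal p q = 0 \<longleftrightarrow> p = q"
proof -
  have "sqrt (1 + (norm x)\<^sup>2) \<noteq> 0" for x :: 'a
    using add_pos_nonneg[of 1 "(norm x)\<^sup>2"] by simp
  then show ?thesis
    by (cases p; cases q) auto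
qed

instantiation ext :: (real_inner) metric_space
begin

definition dist_ext :: "'a ext \<Rightarrow> 'a ext \<Rightarrow> real" where
  "dist_ext = chordal"

definition uniformity_ext :: "('a ext \<times> 'a ext) filter" where
  "uniformity_ext = (INF e\<in>{0<..}. principal {(x, y). dist x y < e})"

definition open_ext :: "'a ext set \<Rightarrow> bool" where
  "open_ext U \<longleftrightarrow> (\<forall>x\<in>U. \<forall>\<^sub>F (x', y) in uniformity. x' = x \<longrightarrow> y \<in> U)"

instance
proof
  fix x y z :: "'a ext"
  show "dist x y = 0 \<longleftrightarrow> x = y"
    by (simp add: dist_ext_def chordal_eq_0_iff)
  show "dist x y \<le> dist x z + dist y z"
    unfolding dist_ext_def chordal_eq_dist_stereographic by (rule dist_triangle2)
qed (simp_all add: uniformity_ext_def open_ext_def)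

end

text \<open>The inversion. Here the origin is sent to 0 instead of \<open>\<infinity>\<close>; this value is never used below,
  since the spheres and annuli around 0 in question have positive radii, a single point is a null
  set, and \<open>inversion ` D'\<close> is unbounded when \<open>0\<close> lies in the open set \<open>D'\<close>.\<close>

definition inversion :: "'a::real_normed_vector \<Rightarrow> 'a" where
  "inversion y = y /\<^sub>R (norm y)\<^sup>2"

section \<open>Path families and their modulus\<close>

text \<open>Powers with a positive real exponent on \<open>[0, \<infinity>]\<close>.\<close>

definition ennreal_powr :: "ennreal \<Rightarrow> real \<Rightarrow> ennreal" where
  "ennreal_powr x a = (if x = top then top else ennreal (enn2real x powr a))"

definition path_length :: "(real \<Rightarrow> 'a::metric_space) \<Rightarrow> real \<Rightarrow> real \<Rightarrow> ennreal" where
  "path_length \<gamma> a b =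
     (SUP ts \<in> {ts. sorted ts \<and> set ts \<subseteq> {a..b}}.
        \<Sum>i<length ts - 1. ennreal (dist (\<gamma> (ts ! i)) (\<gamma> (ts ! Suc i))))"

text \<open>Paths are parametrized by \<open>[0, 1]\<close>, as in the library; the integral with respect to arc length
  does not depend on the parametrization.\<close>

definition locally_rectifiable :: "(real \<Rightarrow> 'a::metric_space) \<Rightarrow> bool" where
  "locally_rectifiable \<gamma> \<longleftrightarrow> (\<forall>a b. 0 \<le> a \<longrightarrow> a \<le> b \<longrightarrow> b \<le> 1 \<longrightarrow> path_length \<gamma> a b < top)"

text \<open>The arc length parametrization: its value at \<open>s\<close> is \<open>\<gamma> t\<close> for any \<open>t\<close> at which the length of
  \<open>\<gamma>\<close> restricted to \<open>[0, t]\<close> is \<open>s\<close>; all such \<open>t\<close> give the same point.\<close>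

definition arc_length_param :: "(real \<Rightarrow> 'a::metric_space) \<Rightarrow> real \<Rightarrow> 'a" where
  "arc_length_param \<gamma> s = \<gamma> (inv_into {0..1} (\<lambda>t. path_length \<gamma> 0 t) (ennreal s))"

definition line_integral :: "('a::metric_space \<Rightarrow> ennreal) \<Rightarrow> (real \<Rightarrow> 'a) \<Rightarrow> ennreal" where
  "line_integral \<rho> \<gamma> =
     (\<integral>\<^sup>+ s \<in> {0..enn2real (path_length \<gamma> 0 1)}. \<rho> (arc_length_param \<gamma> s) \<partial>lborel)"

definition admissible :: "(real \<Rightarrow> 'a::euclidean_space) set \<Rightarrow> ('a \<Rightarrow> ennreal) set" where
  "admissible \<Gamma> = {\<rho> \<in> borel_measurable borel.
     \<forall>\<gamma>\<in>\<Gamma>. locally_rectifiable \<gamma> \<longrightarrow> 1 \<le> line_integral \<rho> \<gamma>}"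

definition modulus :: "real \<Rightarrow> (real \<Rightarrow> 'a::euclidean_space) set \<Rightarrow> ennreal" where
  "modulus p \<Gamma> = (INF \<rho> \<in> admissible \<Gamma>. \<integral>\<^sup>+ x. ennreal_powr (\<rho> x) p \<partial>lborel)"

text \<open>Only endpoint sets in the finite part of the extended space occur, so these paths stay in it.\<close>

definition joining_paths ::
    "'a::topological_space set \<Rightarrow> 'a set \<Rightarrow> 'a set \<Rightarrow> (real \<Rightarrow> 'a) set" where
  "joining_paths E F D =
     {\<gamma>. path \<gamma> \<and> pathstart \<gamma> \<in> E \<and> pathfinish \<gamma> \<in> F \<and> (\<forall>t\<in>{0<..<1}. \<gamma> t \<in> D)}"

definition annulus :: "'a::metric_space \<Rightarrow> real \<Rightarrow> real \<Rightarrow> 'a set" where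
  "annulus y\<^sub>0 r\<^sub>1 r\<^sub>2 = {y. r\<^sub>1 < dist y y\<^sub>0 \<and> dist y y\<^sub>0 < r\<^sub>2}"

section \<open>Boundary conditions on domains\<close>

definition is_domain :: "'a::topological_space set \<Rightarrow> bool" where
  "is_domain D \<longleftrightarrow> open D \<and> connected D \<and> D \<noteq> {}"

definition ext_boundary :: "'a::real_inner set \<Rightarrow> 'a ext set" where
  "ext_boundary D = frontier (Fin ` D)"

definition ext_closure :: "'a::real_inner set \<Rightarrow> 'a ext set" where
  "ext_closure D = closure (Fin ` D)"

definition finitely_connected_at_boundary :: "'a::real_inner set \<Rightarrow> bool" where
  "finitely_connected_at_boundary D \<longleftrightarrow>
     (\<forall>x\<^sub>0 \<in> ext_boundary D. \<forall>U. open U \<and> x\<^sub>0 \<in> U \<longrightarrow>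
        (\<exists>V. open V \<and> x\<^sub>0 \<in> V \<and> V \<subseteq> U \<and> finite (components (V \<inter> Fin ` D))))"

definition weakly_flat_boundary :: "'a::euclidean_space set \<Rightarrow> bool" where
  "weakly_flat_boundary D \<longleftrightarrow>
     (\<forall>x\<^sub>0 \<in> ext_boundary D. \<forall>P>0. \<forall>U. open U \<and> x\<^sub>0 \<in> U \<longrightarrow>
        (\<exists>V. open V \<and> x\<^sub>0 \<in> V \<and> V \<subseteq> U \<and>
           (\<forall>E F. compact E \<and> connected E \<and> E \<subseteq> D \<and> compact F \<and> connected F \<and> F \<subseteq> D \<and>
              Fin ` E \<inter> frontier U \<noteq> {} \<and> Fin ` E \<inter> frontier V \<noteq> {} \<and>
              Fin ` F \<inter> frontier U \<noteq> {} \<and> Fin ` F \<inter> frontier V \<noteq> {} \<longrightarrow>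
              ennreal P < modulus (real DIM('a)) (joining_paths E F D))))"

section \<open>The inverse Poletsky inequality\<close>

definition poletsky_paths ::
    "'a::euclidean_space set \<Rightarrow> ('a \<Rightarrow> 'a) \<Rightarrow> 'a \<Rightarrow> real \<Rightarrow> real \<Rightarrow> (real \<Rightarrow> 'a) set" where
  "poletsky_paths D f y\<^sub>0 r\<^sub>1 r\<^sub>2 =
     {\<gamma>. path \<gamma> \<and> path_image \<gamma> \<subseteq> D \<and>
         f \<circ> \<gamma> \<in> joining_paths (sphere y\<^sub>0 r\<^sub>1) (sphere y\<^sub>0 r\<^sub>2) (annulus y\<^sub>0 r\<^sub>1 r\<^sub>2)}"

text \<open>The supremum of the distances from a point, which may be infinite.\<close>

definition outer_radius :: "'a::metric_space set \<Rightarrow> 'a \<Rightarrow> ereal" where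
  "outer_radius A y\<^sub>0 = (SUP y\<in>A. ereal (dist y y\<^sub>0))"

definition inverse_poletsky_at ::
    "real \<Rightarrow> 'a::euclidean_space set \<Rightarrow> ('a \<Rightarrow> 'a) \<Rightarrow> ('a \<Rightarrow> ennreal) \<Rightarrow> 'a \<Rightarrow> bool" where
  "inverse_poletsky_at p D f Q y\<^sub>0 \<longleftrightarrow>
     (\<forall>r\<^sub>1 r\<^sub>2. 0 < r\<^sub>1 \<and> r\<^sub>1 < r\<^sub>2 \<and> ereal r\<^sub>2 < outer_radius (f ` D) y\<^sub>0 \<longrightarrow>
       (\<forall>\<eta> \<in> borel_measurable (lebesgue_on {r\<^sub>1<..<r\<^sub>2}).
          1 \<le> (\<integral>\<^sup>+ r \<in> {r\<^sub>1<..<r\<^sub>2}. \<eta> r \<partial>lebesgue) \<longrightarrow>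
          modulus p (poletsky_paths D f y\<^sub>0 r\<^sub>1 r\<^sub>2)
            \<le> (\<integral>\<^sup>+ y \<in> annulus y\<^sub>0 r\<^sub>1 r\<^sub>2 \<inter> f ` D. Q y * ennreal_powr (\<eta> (dist y y\<^sub>0)) p \<partial>lebesgue)))"

fun inverse_poletsky ::
    "real \<Rightarrow> 'a::euclidean_space set \<Rightarrow> ('a \<Rightarrow> 'a) \<Rightarrow> ('a \<Rightarrow> ennreal) \<Rightarrow> 'a ext \<Rightarrow> bool" where
  "inverse_poletsky p D f Q (Fin y\<^sub>0) \<longleftrightarrow> inverse_poletsky_at p D f Q y\<^sub>0"
| "inverse_poletsky p D f Q Infty \<longleftrightarrow> inverse_poletsky_at p D (inversion \<circ> f) (Q \<circ> inversion) 0"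

section \<open>Hausdorff measure and spherical means\<close>

text \<open>The normalization makes the \<open>k\<close>-dimensional Hausdorff measure agree with Lebesgue measure on
  \<open>k\<close>-dimensional Euclidean space. Covering sets are required to be bounded because \<open>diameter\<close> is
  unspecified on unbounded sets.\<close>

definition hausdorff_gauge :: "nat \<Rightarrow> 'a::metric_space set \<Rightarrow> ennreal" where
  "hausdorff_gauge k U =
     (if U = {} then 0 else ennreal (unit_ball_vol (real k) * (diameter U / 2) ^ k))"

definition hausdorff_covers :: "real \<Rightarrow> 'a::metric_space set \<Rightarrow> (nat \<Rightarrow> 'a set) set" where
  "hausdorff_covers \<delta> A = {U. (\<forall>i. bounded (U i) \<and> diameter (U i) \<le> \<delta>) \<and> A \<subseteq> (\<Union>i. U i)}"

definition hausdorff_content :: "nat \<Rightarrow> real \<Rightarrow> 'a::metric_space set \<Rightarrow> ennreal" where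
  "hausdorff_content k \<delta> A = (INF U \<in> hausdorff_covers \<delta> A. \<Sum>i. hausdorff_gauge k (U i))"

definition hausdorff_outer :: "nat \<Rightarrow> 'a::metric_space set \<Rightarrow> ennreal" where
  "hausdorff_outer k A = (SUP \<delta> \<in> {0<..}. hausdorff_content k \<delta> A)"

definition hausdorff_measure :: "nat \<Rightarrow> 'a::metric_space measure" where
  "hausdorff_measure k =
     measure_of UNIV (lambda_system UNIV UNIV (hausdorff_outer k)) (hausdorff_outer k)"

lemma hausdorff_content_countably_subadditive:
  fixes A :: "nat \<Rightarrow> 'a::metric_space set"
  shows "hausdorff_content k \<delta> (\<Union>n. A n) \<le> (\<Sum>n. hausdorff_content k \<delta> (A n))"
proof (rule ennreal_le_epsilon)
  fix e :: real
  assume e: "0 < e" and fin: "(\<Sum>n. hausdorff_content k \<delta> (A n)) < top"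
  have lt: "hausdorff_content k \<delta> (A n) < hausdorff_content k \<delta> (A n) + e * (1/2)^Suc n" for n
    using e fin by (auto simp add: less_top dest!: ennreal_suminf_lessD)
  have "\<exists>U \<in> hausdorff_covers \<delta> (A n).
      (\<Sum>i. hausdorff_gauge k (U i)) < hausdorff_content k \<delta> (A n) + e * (1/2)^Suc n" for n
  proof -
    have "(INF U \<in> hausdorff_covers \<delta> (A n). \<Sum>i. hausdorff_gauge k (U i))
        < hausdorff_content k \<delta> (A n) + e * (1/2)^Suc n"
      using lt[of n] by (subst hausdorff_content_def[symmetric])
    then show ?thesis
      by (rule INF_less_iff[THEN iffD1])
  qed
  then obtain B where B: "\<And>n. B n \<in> hausdorff_covers \<delta> (A n)"
    and less: "\<And>n. (\<Sum>i. hausdorff_gauge k (B n i))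
                 < hausdorff_content k \<delta> (A n) + e * (1/2)^Suc n"
    by metis
  define C where "C = case_prod B \<circ> prod_decode"
  have "(\<Union>n. A n) \<subseteq> (\<Union>i. C i)"
  proof
    fix x assume "x \<in> (\<Union>n. A n)"
    then obtain n i where "x \<in> B n i"
      using B unfolding hausdorff_covers_def by blast
    then have "x \<in> C (prod_encode (n, i))"
      by (simp add: C_def)
    then show "x \<in> (\<Union>i. C i)" by blast
  qed
  then have "C \<in> hausdorff_covers \<delta> (\<Union>n. A n)"
    using B by (auto simp: hausdorff_covers_def C_def split_def)
  then have "hausdorff_content k \<delta> (\<Union>n. A n) \<le> (\<Sum>i. hausdorff_gauge k (C i))"
    unfolding hausdorff_content_def by (rule INF_lower)
  also have "\<dots> = (\<Sum>n. \<Sum>i. hausdorff_gauge k (B n i))"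
    unfolding C_def comp_def by (intro suminf_ennreal_2dimen) auto
  also have "\<dots> \<le> (\<Sum>n. hausdorff_content k \<delta> (A n) + e * (1/2) ^ Suc n)"
    using less by (intro suminf_le) (auto intro: less_imp_le)
  also have "\<dots> = (\<Sum>n. hausdorff_content k \<delta> (A n)) + (\<Sum>n. ennreal e * ennreal ((1/2) ^ Suc n))"
    using e by (subst suminf_add[symmetric])
      (auto simp del: ennreal_suminf_cmult simp add: ennreal_mult[symmetric])
  also have "\<dots> = (\<Sum>n. hausdorff_content k \<delta> (A n)) + e"
    unfolding ennreal_suminf_cmult
    by (subst suminf_ennreal_eq[OF zero_le_power power_half_series]) auto
  finally show "hausdorff_content k \<delta> (\<Union>n. A n) \<le> (\<Sum>n. hausdorff_content k \<delta> (A n)) + e" .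
qed

lemma outer_measure_space_hausdorff:
  "outer_measure_space UNIV (hausdorff_outer k :: 'a::metric_space set \<Rightarrow> ennreal)"
  unfolding outer_measure_space_def
proof (intro conjI)
  have "hausdorff_content k \<delta> ({} :: 'a set) = 0" if "\<delta> > 0" for \<delta>
  proof -
    have "(\<lambda>_. {}) \<in> hausdorff_covers \<delta> ({} :: 'a set)"
      using that by (simp add: hausdorff_covers_def)
    then have "hausdorff_content k \<delta> ({} :: 'a set) \<le> (\<Sum>i::nat. hausdorff_gauge k ({} :: 'a set))"
      unfolding hausdorff_content_def by (rule INF_lower)
    then show ?thesis by (simp add: hausdorff_gauge_def)
  qed
  then have "hausdorff_outer k ({} :: 'a set) = 0"
    by (simp add: hausdorff_outer_def)
  then show "positive UNIV (hausdorff_outer k :: 'a set \<Rightarrow> ennreal)"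
    by (simp add: positive_def)
  show "increasing UNIV (hausdorff_outer k :: 'a set \<Rightarrow> ennreal)"
    unfolding increasing_def hausdorff_outer_def hausdorff_content_def
    by (auto intro!: SUP_mono' INF_superset_mono simp: hausdorff_covers_def)
  show "countably_subadditive UNIV (hausdorff_outer k :: 'a set \<Rightarrow> ennreal)"
    unfolding countably_subadditive_def
  proof (intro allI impI)
    fix A :: "nat \<Rightarrow> 'a set"
    have "hausdorff_content k \<delta> (\<Union>i. A i) \<le> (\<Sum>i. hausdorff_outer k (A i))" if "\<delta> > 0" for \<delta>
    proof -
      have "hausdorff_content k \<delta> (\<Union>i. A i) \<le> (\<Sum>i. hausdorff_content k \<delta> (A i))"
        by (rule hausdorff_content_countably_subadditive)
      also have "\<dots> \<le> (\<Sum>i. hausdorff_outer k (A i))"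
        using that unfolding hausdorff_outer_def by (intro suminf_le SUP_upper) auto
      finally show ?thesis .
    qed
    then show "hausdorff_outer k (\<Union>i. A i) \<le> (\<Sum>i. hausdorff_outer k (A i))"
      by (subst hausdorff_outer_def) (auto intro: SUP_least)
  qed
qed

lemma
  fixes A :: "'a::metric_space set"
  shows sets_hausdorff_measure:
    "sets (hausdorff_measure k :: 'a measure) = lambda_system UNIV UNIV (hausdorff_outer k)"
  and emeasure_hausdorff_measure:
    "A \<in> sets (hausdorff_measure k) \<Longrightarrow> emeasure (hausdorff_measure k) A = hausdorff_outer k A"
proof -
  interpret sigma_algebra UNIV "UNIV :: 'a set set"
    using sigma_algebra_Pow[of UNIV] by simp
  have ms: "measure_space UNIV (lambda_system UNIV UNIV (hausdorff_outer k :: 'a set \<Rightarrow> ennreal))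
      (hausdorff_outer k)"
    by (rule caratheodory_lemma[OF outer_measure_space_hausdorff])
  then interpret L: sigma_algebra UNIV
      "lambda_system UNIV UNIV (hausdorff_outer k :: 'a set \<Rightarrow> ennreal)"
    by (simp add: measure_space_def)
  show sets: "sets (hausdorff_measure k :: 'a measure)
      = lambda_system UNIV UNIV (hausdorff_outer k)"
    unfolding hausdorff_measure_def by (rule L.sets_measure_of_eq)
  show "emeasure (hausdorff_measure k) A = hausdorff_outer k A"
    if "A \<in> sets (hausdorff_measure k)"
    unfolding hausdorff_measure_def
    using ms that by (intro emeasure_measure_of_sigma) (simp_all add: sets measure_space_def)
qed

definition sphere_mean :: "('a::euclidean_space \<Rightarrow> ennreal) \<Rightarrow> 'a \<Rightarrow> real \<Rightarrow> ennreal" where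
  "sphere_mean Q y\<^sub>0 r =
     (\<integral>\<^sup>+ y \<in> sphere y\<^sub>0 r. Q y \<partial>hausdorff_measure (DIM('a) - 1)) /
     (emeasure (hausdorff_measure (DIM('a) - 1)) (sphere (0::'a) 1) * ennreal (r ^ (DIM('a) - 1)))"

definition sphere_integrable :: "('a::euclidean_space \<Rightarrow> ennreal) \<Rightarrow> 'a \<Rightarrow> real \<Rightarrow> bool" where
  "sphere_integrable Q y\<^sub>0 r \<longleftrightarrow>
     Q \<in> borel_measurable (restrict_space (hausdorff_measure (DIM('a) - 1)) (sphere y\<^sub>0 r)) \<and>
     (\<integral>\<^sup>+ y \<in> sphere y\<^sub>0 r. Q y \<partial>hausdorff_measure (DIM('a) - 1)) < top"

section \<open>Conditions on the majorant\<close>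

definition ball_mean :: "('a::euclidean_space \<Rightarrow> ennreal) \<Rightarrow> 'a \<Rightarrow> real \<Rightarrow> ennreal" where
  "ball_mean Q x\<^sub>0 \<epsilon> =
     (\<integral>\<^sup>+ x \<in> ball x\<^sub>0 \<epsilon>. Q x \<partial>lebesgue) / ennreal (unit_ball_vol (real DIM('a)) * \<epsilon> ^ DIM('a))"

text \<open>Subtraction on \<open>ennreal\<close> is truncated at 0, and \<open>top - top = top\<close>. Hence \<open>(a - b) + (b - a)\<close> is
  \<open>\<bar>a - b\<bar>\<close> when one of \<open>a\<close>, \<open>b\<close> is finite, and an infinite mean makes the oscillation infinite.\<close>

definition finite_mean_oscillation_at :: "('a::euclidean_space \<Rightarrow> ennreal) \<Rightarrow> 'a \<Rightarrow> bool" where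
  "finite_mean_oscillation_at Q x\<^sub>0 \<longleftrightarrow>
     Limsup (at_right 0) (\<lambda>\<epsilon>. ball_mean
       (\<lambda>x. (Q x - ball_mean Q x\<^sub>0 \<epsilon>) + (ball_mean Q x\<^sub>0 \<epsilon> - Q x)) x\<^sub>0 \<epsilon>) < top"

fun finite_mean_oscillation :: "('a::euclidean_space \<Rightarrow> ennreal) \<Rightarrow> 'a ext \<Rightarrow> bool" where
  "finite_mean_oscillation Q (Fin y\<^sub>0) \<longleftrightarrow> finite_mean_oscillation_at Q y\<^sub>0"
| "finite_mean_oscillation Q Infty \<longleftrightarrow> finite_mean_oscillation_at (Q \<circ> inversion) 0"

definition positive_mean_integral_at :: "('a::euclidean_space \<Rightarrow> ennreal) \<Rightarrow> 'a \<Rightarrow> bool" where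
  "positive_mean_integral_at Q y\<^sub>0 \<longleftrightarrow>
     (\<exists>\<delta>>0. \<forall>b. 0 < b \<and> b < \<delta> \<longrightarrow> (\<exists>a. 0 < a \<and> a < b \<and>
        0 < (\<integral>\<^sup>+ t \<in> {a..b}.
               1 / (ennreal t * ennreal_powr (sphere_mean Q y\<^sub>0 t) (1 / (real DIM('a) - 1)))
             \<partial>lebesgue)))"

fun positive_mean_integral :: "('a::euclidean_space \<Rightarrow> ennreal) \<Rightarrow> 'a ext \<Rightarrow> bool" where
  "positive_mean_integral Q (Fin y\<^sub>0) \<longleftrightarrow> positive_mean_integral_at Q y\<^sub>0"
| "positive_mean_integral Q Infty \<longleftrightarrow> positive_mean_integral_at (Q \<circ> inversion) 0"

definition integrable_on_spheres_at ::
    "'a::euclidean_space set \<Rightarrow> ('a \<Rightarrow> ennreal) \<Rightarrow> 'a \<Rightarrow> bool" where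
  "integrable_on_spheres_at D' Q y\<^sub>0 \<longleftrightarrow>
     (\<forall>r\<^sub>1 r\<^sub>2. 0 < r\<^sub>1 \<and> r\<^sub>1 < r\<^sub>2 \<and> ereal r\<^sub>2 < outer_radius D' y\<^sub>0 \<longrightarrow>
        (\<exists>E \<in> sets lebesgue. E \<subseteq> {r\<^sub>1..r\<^sub>2} \<and> 0 < emeasure lebesgue E \<and>
           (\<forall>r\<in>E. sphere_integrable Q y\<^sub>0 r)))"

fun integrable_on_spheres ::
    "'a::euclidean_space set \<Rightarrow> ('a \<Rightarrow> ennreal) \<Rightarrow> 'a ext \<Rightarrow> bool" where
  "integrable_on_spheres D' Q (Fin y\<^sub>0) \<longleftrightarrow> integrable_on_spheres_at D' Q y\<^sub>0"
| "integrable_on_spheres D' Q Infty \<longleftrightarrow>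
     integrable_on_spheres_at (inversion ` D') (Q \<circ> inversion) 0"

end

theory Submission
  imports Defs
begin

text \<open>Suppose \<open>f\<close> has two cluster values at a boundary point \<open>x\<^sub>0\<close> of \<open>D\<close>; one of them is a finite point
  \<open>b\<close> (so the conditions at infinity are never needed), the other one lies outside a ball around \<open>b\<close>.
  Since \<open>f\<close> is closed and discrete, it is proper, and so both values belong to the boundary of \<open>D'\<close>.
  As \<open>D'\<close> is finitely connected there, points of \<open>D\<close> arbitrarily close to \<open>x\<^sub>0\<close> can be joined to a fixed
  compact subset of \<open>D\<close> by continua \<open>E\<close>, \<open>F\<close> whose images lie in \<open>B(b, r\<^sub>1)\<close> and outside \<open>B(b, r\<^sub>2)\<close>.
  Weak flatness makes the modulus of the paths joining \<open>E\<close> and \<open>F\<close> arbitrarily large, but each such path has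
  a subpath mapped across the annulus, so the inverse Poletsky inequality bounds the modulus by a
  single number, finite for suitable \<open>r\<^sub>1 < r\<^sub>2\<close> and \<open>\<eta>\<close> under each of the four conditions.
  For the conditions involving spheres this rests on comparing Lebesgue integrals in polar coordinates
  with Hausdorff integrals over spheres, where one inequality is enough.\<close>

section \<open>The topology of the extended space\<close>

text \<open>The order of choices closes the argument: the radii \<open>r\<^sub>1\<close>,
  \<open>r\<^sub>2\<close>, and with them the finite bound for the modulus, are fixed first, and
  only then is weak flatness applied with a larger constant. Hence just the finiteness of the
  right-hand side of the inverse Poletsky inequality matters, and neither sharp constants nor an
  extremal weight are computed. Under conditions 2) and 3) it is enough that the integrals of
  \<open>Q\<close> over spheres are not infinite for almost every radius: the weight is then a
  multiple of the indicator of a set of radii of positive measure on which cone integrals of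
  \<open>Q\<close> are bounded. The obstacle is that \<open>Q\<close> is merely Lebesgue measurable,
  while spheres are null sets, so that a change on a null set may change integrals over spheres.
  This calls for a Borel function that is below \<open>Q\<close> everywhere, not just equal to it
  almost everywhere. The one inequality needed bounds the volume of a cone by a multiple of the
  Hausdorff measure of its base; it follows from covering arguments alone.\<close>

lemma dist_ext_eq: "dist p q = dist (stereographic p) (stereographic q)"
  by (simp add: dist_ext_def chordal_eq_dist_stereographic)

lemma one_plus_norm_power2_pos: "0 < 1 + (norm x)\<^sup>2"
  by (simp add: add_pos_nonneg)

lemma continuous_on_stereographic: "continuous_on S stereographic"
  by (auto simp: continuous_on_iff dist_ext_eq)

lemma continuous_on_Fin: "continuous_on S Fin"
proof -
  have "continuous_on S (\<lambda>x::'a. stereographic (Fin x))"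
    using one_plus_norm_power2_pos[THEN less_imp_neq, symmetric]
    by (auto intro!: continuous_intros)
  then show ?thesis
    by (auto simp: continuous_on_iff dist_ext_eq simp del: stereographic.simps)
qed

text \<open>The inverse of the stereographic projection, read off from the coordinates: continuity
  away from \<open>Infty\<close> becomes a matter of arithmetic.\<close>

definition unfin :: "'a::real_inner ext \<Rightarrow> 'a" where
  "unfin p = fst (stereographic p) /\<^sub>R (1 - snd (stereographic p))"

lemma unfin_Fin [simp]: "unfin (Fin x) = x"
proof -
  have p: "1 + (norm x)\<^sup>2 > 0" by (rule one_plus_norm_power2_pos)
  then have "1 - (norm x)\<^sup>2 / (1 + (norm x)\<^sup>2) = 1 / (1 + (norm x)\<^sup>2)"
    by (simp add: field_simps)
  then show ?thesis using p by (simp add: unfin_def)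
qed

lemma snd_stereographic_eq_1: "snd (stereographic p) = 1 \<longleftrightarrow> p = Infty"
proof (cases p)
  case (Fin x)
  have "1 + (norm x)\<^sup>2 > 0" by (rule one_plus_norm_power2_pos)
  then show ?thesis using Fin by (simp add: field_simps)
qed simp

lemma continuous_on_unfin: "continuous_on (- {Infty}) unfin"
  unfolding unfin_def
  by (intro continuous_intros continuous_on_compose2[OF continuous_on_fst[OF continuous_on_id]]
      continuous_on_compose2[OF continuous_on_snd[OF continuous_on_id]] continuous_on_stereographic)
    (auto simp: snd_stereographic_eq_1 dest: sym)

lemma open_Fin_image:
  assumes "open U"
  shows "open (Fin ` U)"
proof -
  \<comment> \<open>\<open>unfin Infty\<close> evaluates to 0, so \<open>Infty\<close> has to be cut
    out of the preimage.\<close>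
  have "open (unfin -` U \<inter> - {Infty})"
    using continuous_open_preimage[OF continuous_on_unfin _ assms]
    by (simp add: Int_commute open_delete[of UNIV, simplified Compl_eq_Diff_UNIV[symmetric]])
  moreover have "unfin -` U \<inter> - {Infty} = Fin ` U"
  proof (intro equalityI subsetI)
    fix p assume "p \<in> unfin -` U \<inter> - {Infty}"
    then show "p \<in> Fin ` U" by (cases p) auto
  qed auto
  ultimately show ?thesis by simp
qed

text \<open>Completing the square shows the equation of the sphere of radius 1/2 about
  \<open>(0, 1/2)\<close>. The point over \<open>(u, s)\<close> is \<open>u\<close> divided by
  \<open>1 - s\<close>, or \<open>Infty\<close> at the pole \<open>s = 1\<close>.\<close>

lemma stereographic_image:
  "stereographic ` (UNIV :: 'a::real_inner ext set) = {(u, s). (norm u)\<^sup>2 + s\<^sup>2 = s}"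
proof (intro equalityI subsetI)
  fix z assume "z \<in> stereographic ` (UNIV :: 'a ext set)"
  then obtain p where z: "z = stereographic p" by blast
  show "z \<in> {(u, s). (norm u)\<^sup>2 + s\<^sup>2 = s}"
  proof (cases p)
    case (Fin x)
    define X where "X = (norm x)\<^sup>2"
    have "1 + X > 0" unfolding X_def by (rule one_plus_norm_power2_pos)
    moreover from this have "(norm (x /\<^sub>R (1 + X)))\<^sup>2 = X / (1 + X)\<^sup>2"
      by (simp add: X_def power_mult_distrib divide_inverse power_inverse mult.commute)
    ultimately show ?thesis
      using z Fin by (simp add: X_def[symmetric] divide_simps power2_eq_square) (simp add: algebra_simps)
  qed (simp add: z)
next
  fix z :: "'a \<times> real" assume "z \<in> {(u, s). (norm u)\<^sup>2 + s\<^sup>2 = s}"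
  then obtain u s where z: "z = (u, s)" and us: "(norm u)\<^sup>2 + s\<^sup>2 = s" by blast
  show "z \<in> stereographic ` (UNIV :: 'a ext set)"
  proof (cases "s = 1")
    case True
    then have "z = stereographic Infty" using us z by simp
    then show ?thesis by blast
  next
    case False
    define x where "x = u /\<^sub>R (1 - s)"
    have "(norm u)\<^sup>2 = s * (1 - s)" using us by (simp add: algebra_simps power2_eq_square)
    then have "(norm x)\<^sup>2 = s / (1 - s)"
      using False by (simp add: x_def power_mult_distrib power2_eq_square[of "1 - s"] divide_simps)
    then have "1 + (norm x)\<^sup>2 = 1 / (1 - s)" and "(norm x)\<^sup>2 = s / (1 - s)"
      using False by (simp_all add: field_simps)
    then have "stereographic (Fin x) = z"
      using False unfolding z stereographic.simps by (simp only:) (simp add: x_def)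
    then show ?thesis by blast
  qed
qed

text \<open>The projection is an isometry onto a closed bounded set, and its inverse carries
  compactness back. Cluster values exist for this reason, and for the same reason the image of the
  extended map is closed.\<close>

lemma compact_ext_UNIV: "compact (UNIV :: 'a::euclidean_space ext set)"
proof -
  let ?T = "{(u::'a, s::real). (norm u)\<^sup>2 + s\<^sup>2 = s}"
  have "closed ?T"
    unfolding split_def by (intro closed_Collect_eq continuous_intros)
  moreover have "bounded ?T"
  proof (rule boundedI)
    fix z assume "z \<in> ?T"
    then obtain u s where z: "z = (u, s)" and us: "(norm u)\<^sup>2 + s\<^sup>2 = s" by blast
    have "s\<^sup>2 \<le> s" using us zero_le_power2[of "norm u"] by linarith
    then have "s \<le> 1"
      using mult_strict_left_mono[of 1 s s] unfolding power2_eq_square by linarith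
    then have "norm z \<le> 1" using us by (simp add: z norm_Pair)
    then show "norm z \<le> 1" .
  qed
  ultimately have "compact ?T" by (rule compact_eq_bounded_closed[THEN iffD2, OF conjI, rotated])
  moreover have "continuous_on ?T (inv stereographic)"
  proof -
    have "dist (inv stereographic z) (inv stereographic z') = dist z z'"
      if "z \<in> ?T" "z' \<in> ?T" for z z'
      using that unfolding dist_ext_eq stereographic_image[symmetric]
      by (simp add: f_inv_into_f del: stereographic.simps)
    then show ?thesis by (auto simp: continuous_on_iff simp del: stereographic.simps)
  qed
  ultimately have "compact (inv stereographic ` ?T)"
    by (rule compact_continuous_image[rotated])
  moreover have "inj stereographic"
    by (rule injI) (metis dist_ext_eq dist_self dist_eq_0_iff)
  then have "inv stereographic ` ?T = UNIV"
    unfolding stereographic_image[symmetric] by (rule image_inv_f_f)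
  ultimately show ?thesis by simp
qed

section \<open>Path length and the modulus of subpaths\<close>

definition polygon_length :: "(real \<Rightarrow> 'a::metric_space) \<Rightarrow> real list \<Rightarrow> ennreal" where
  "polygon_length \<gamma> ts = (\<Sum>i<length ts - 1. ennreal (dist (\<gamma> (ts ! i)) (\<gamma> (ts ! Suc i))))"

lemma sorted_map_mono:
  "sorted ts \<Longrightarrow> (\<And>x y. x \<le> y \<Longrightarrow> g x \<le> g y) \<Longrightarrow> sorted (map g ts)"
  by (induction ts) auto

lemma path_length_polygon:
  "path_length \<gamma> a b = (SUP ts \<in> {ts. sorted ts \<and> set ts \<subseteq> {a..b}}. polygon_length \<gamma> ts)"
  by (simp add: path_length_def polygon_length_def)

lemma polygon_length_le_path_length:
  "sorted ts \<Longrightarrow> set ts \<subseteq> {a..b} \<Longrightarrow> polygon_length \<gamma> ts \<le> path_length \<gamma> a b"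
  unfolding path_length_polygon by (rule SUP_upper) simp

lemma path_length_leI:
  "(\<And>ts. sorted ts \<Longrightarrow> set ts \<subseteq> {a..b} \<Longrightarrow> polygon_length \<gamma> ts \<le> l) \<Longrightarrow> path_length \<gamma> a b \<le> l"
  unfolding path_length_polygon by (rule SUP_least) simp

lemma dist_le_path_length:
  assumes "a \<le> b"
  shows "ennreal (dist (\<gamma> a) (\<gamma> b)) \<le> path_length \<gamma> a b"
  using polygon_length_le_path_length[of "[a, b]" a b \<gamma>] assms by (simp add: polygon_length_def)

text \<open>The segment from the last vertex of \<open>ts\<close> to the first one of
  \<open>us\<close> is dropped, hence only an inequality.\<close>

lemma polygon_length_append:
  "polygon_length \<gamma> ts + polygon_length \<gamma> us \<le> polygon_length \<gamma> (ts @ us)"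
proof -
  let ?m = "length ts" and ?k = "length us"
  let ?g = "\<lambda>i. ennreal (dist (\<gamma> ((ts @ us) ! i)) (\<gamma> ((ts @ us) ! Suc i)))"
  have 1: "polygon_length \<gamma> ts = sum ?g {..<?m - 1}"
    unfolding polygon_length_def by (rule sum.cong) (auto simp: nth_append)
  have 2: "polygon_length \<gamma> us = sum ?g ((+) ?m ` {..<?k - 1})"
    unfolding polygon_length_def
    by (subst sum.reindex) (auto simp: nth_append)
  have "polygon_length \<gamma> ts + polygon_length \<gamma> us = sum ?g ({..<?m - 1} \<union> (+) ?m ` {..<?k - 1})"
    unfolding 1 2 by (rule sum.union_disjoint[symmetric]) auto
  also have "\<dots> \<le> sum ?g {..<length (ts @ us) - 1}"
    by (rule sum_mono2) auto
  finally show ?thesis by (simp add: polygon_length_def)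
qed

lemma path_length_add:
  assumes "a \<le> b" "b \<le> c"
  shows "path_length \<gamma> a b + path_length \<gamma> b c = path_length \<gamma> a c"
proof (rule antisym)
  have nonempty: "{ts. sorted ts \<and> set ts \<subseteq> {u..v}} \<noteq> {}" for u v :: real
    by (auto intro: exI[of _ "[]"])
  have "polygon_length \<gamma> ts + polygon_length \<gamma> us \<le> path_length \<gamma> a c"
    if "sorted ts" "set ts \<subseteq> {a..b}" "sorted us" "set us \<subseteq> {b..c}" for ts us
  proof -
    have "\<forall>x\<in>set ts. \<forall>y\<in>set us. x \<le> y"
      using that by (meson atLeastAtMost_iff order_trans subsetD)
    then have "sorted (ts @ us)" using that by (simp add: sorted_append)
    moreover have "{a..b} \<subseteq> {a..c}" "{b..c} \<subseteq> {a..c}" using assms by auto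
    then have "set (ts @ us) \<subseteq> {a..c}" using that by auto
    ultimately show ?thesis
      using polygon_length_append polygon_length_le_path_length order_trans by blast
  qed
  then have "polygon_length \<gamma> ts + path_length \<gamma> b c \<le> path_length \<gamma> a c"
    if "sorted ts" "set ts \<subseteq> {a..b}" for ts
    unfolding path_length_polygon[of _ b c] using that
    by (subst ennreal_SUP_add_right[OF nonempty]) (auto intro!: SUP_least)
  then show "path_length \<gamma> a b + path_length \<gamma> b c \<le> path_length \<gamma> a c"
    unfolding path_length_polygon[of _ a b]
    by (subst ennreal_SUP_add_left[OF nonempty, symmetric]) (auto intro!: SUP_least)
next
  show "path_length \<gamma> a c \<le> path_length \<gamma> a b + path_length \<gamma> b c"
  proof (rule path_length_leI)
    fix ts assume ts: "sorted ts" "set ts \<subseteq> {a..c}"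
    \<comment> \<open>Instead of inserting \<open>b\<close> into the list, every vertex is clamped
      to each side of \<open>b\<close>. Only a segment across \<open>b\<close> is really split, by
      the triangle inequality through \<open>\<gamma> b\<close>; for any other segment one of the
      two terms vanishes.\<close>
    have split: "dist (\<gamma> t) (\<gamma> t') \<le> dist (\<gamma> (min b t)) (\<gamma> (min b t')) + dist (\<gamma> (max b t)) (\<gamma> (max b t'))"
      if "t \<le> t'" for t t'
      using that dist_triangle[of "\<gamma> t" "\<gamma> t'" "\<gamma> b"] by (auto simp: min_def max_def)
    have "polygon_length \<gamma> ts \<le> polygon_length \<gamma> (map (min b) ts) + polygon_length \<gamma> (map (max b) ts)"
      unfolding polygon_length_def length_map sum.distrib[symmetric]
    proof (rule sum_mono)
      fix i assume "i \<in> {..<length ts - 1}"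
      then have i: "i < length ts" "Suc i < length ts" by auto
      then have "ts ! i \<le> ts ! Suc i"
        using ts(1) by (simp add: sorted_iff_nth_Suc)
      from split[OF this] i
      show "ennreal (dist (\<gamma> (ts ! i)) (\<gamma> (ts ! Suc i)))
        \<le> ennreal (dist (\<gamma> (map (min b) ts ! i)) (\<gamma> (map (min b) ts ! Suc i)))
          + ennreal (dist (\<gamma> (map (max b) ts ! i)) (\<gamma> (map (max b) ts ! Suc i)))"
        by (simp add: ennreal_plus[symmetric] ennreal_leI del: ennreal_plus)
    qed
    also have "\<dots> \<le> path_length \<gamma> a b + path_length \<gamma> b c"
    proof (rule add_mono; rule polygon_length_le_path_length)
      show "sorted (map (min b) ts)" "sorted (map (max b) ts)"
        by (rule sorted_map_mono[OF ts(1)]; simp add: min_def max_def)+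
      show "set (map (min b) ts) \<subseteq> {a..b}" "set (map (max b) ts) \<subseteq> {b..c}"
        using ts(2) assms by auto
    qed
    finally show "polygon_length \<gamma> ts \<le> path_length \<gamma> a b + path_length \<gamma> b c" .
  qed
qed

lemma path_length_self [simp]: "path_length \<gamma> a a = 0"
proof -
  have "polygon_length \<gamma> ts = 0" if "set ts \<subseteq> {a..a}" for ts
  proof -
    have "ts ! i = a" if "i < length ts" for i
      using \<open>set ts \<subseteq> {a..a}\<close> nth_mem[OF that] by auto
    then show ?thesis
      unfolding polygon_length_def by (intro sum.neutral ballI) simp
  qed
  then have "path_length \<gamma> a a \<le> 0" by (intro path_length_leI) simp
  then show ?thesis by simp
qed

text \<open>A supremum of continuous functions is lower semicontinuous. To have the same family of
  lists for all \<open>t\<close>, lists in \<open>{0..1}\<close> are clamped to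
  \<open>{lo t..hi t}\<close>.\<close>

lemma path_length_lower_semicontinuous:
  fixes \<gamma> :: "real \<Rightarrow> 'a::metric_space"
  assumes \<gamma>: "continuous_on {0..1} \<gamma>"
    and lo: "continuous_on {0..1} lo" and hi: "continuous_on {0..1} hi"
    and bounds: "\<And>t. t \<in> {0..1} \<Longrightarrow> 0 \<le> lo t \<and> lo t \<le> hi t \<and> hi t \<le> (1::real)"
  shows "openin (top_of_set {0..1}) {t \<in> {0..1}. s < path_length \<gamma> (lo t) (hi t)}"
proof -
  define clamp where "clamp t x = max (lo t) (min (hi t) x)" for t x
  define T where "T = {ts :: real list. sorted ts \<and> set ts \<subseteq> {0..1}}"
  have eq: "path_length \<gamma> (lo t) (hi t) = (SUP ts\<in>T. polygon_length \<gamma> (map (clamp t) ts))"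
    if t: "t \<in> {0..1}" for t
  proof (rule antisym)
    show "path_length \<gamma> (lo t) (hi t) \<le> (SUP ts\<in>T. polygon_length \<gamma> (map (clamp t) ts))"
    proof (rule path_length_leI)
      fix ts assume ts: "sorted ts" "set ts \<subseteq> {lo t..hi t}"
      have "map (clamp t) ts = ts"
        using ts(2) by (intro map_idI) (auto simp: clamp_def min_def max_def)
      moreover have "ts \<in> T" using ts bounds[OF t] by (fastforce simp: T_def)
      ultimately show "polygon_length \<gamma> ts \<le> (SUP ts\<in>T. polygon_length \<gamma> (map (clamp t) ts))"
        by (metis SUP_upper)
    qed
    show "(SUP ts\<in>T. polygon_length \<gamma> (map (clamp t) ts)) \<le> path_length \<gamma> (lo t) (hi t)"
    proof (rule SUP_least, rule polygon_length_le_path_length)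
      fix ts assume ts: "ts \<in> T"
      show "sorted (map (clamp t) ts)"
        by (rule sorted_map_mono) (use ts in \<open>auto simp: T_def clamp_def min_def max_def\<close>)
      show "set (map (clamp t) ts) \<subseteq> {lo t..hi t}"
        using bounds[OF t] by (auto simp: clamp_def)
    qed
  qed
  have cont: "continuous_on {0..1} (\<lambda>t. polygon_length \<gamma> (map (clamp t) ts))" for ts
  proof -
    have "continuous_on {0..1} (\<lambda>t. \<gamma> (clamp t x))" for x
      unfolding clamp_def using bounds
      by (intro continuous_on_compose2[OF \<gamma>] continuous_intros lo hi) (force simp: min_def max_def)+
    then have "continuous_on {0..1} (\<lambda>t. ennreal (\<Sum>i<length ts - 1. dist (\<gamma> (clamp t (ts ! i))) (\<gamma> (clamp t (ts ! Suc i)))))"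
      by (intro continuous_on_ennreal continuous_intros)
    moreover have "polygon_length \<gamma> (map (clamp t) ts)
      = ennreal (\<Sum>i<length ts - 1. dist (\<gamma> (clamp t (ts ! i))) (\<gamma> (clamp t (ts ! Suc i))))" for t
      unfolding polygon_length_def by (subst sum_ennreal[symmetric]) (auto intro!: sum.cong)
    ultimately show ?thesis by simp
  qed
  have "{t \<in> {0..1}. s < path_length \<gamma> (lo t) (hi t)}
      = (\<Union>ts\<in>T. {0..1} \<inter> (\<lambda>t. polygon_length \<gamma> (map (clamp t) ts)) -` {s<..})"
    using eq by (auto simp: less_SUP_iff)
  also have "openin (top_of_set {0..1}) \<dots>"
  proof (rule openin_Union, elim imageE, hypsubst)
    show "openin (top_of_set {0..1}) ({0..1} \<inter> (\<lambda>t. polygon_length \<gamma> (map (clamp t) ts)) -` {s<..})" for ts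
      by (rule continuous_openin_preimage_gen[OF cont]) simp
  qed
  finally show ?thesis .
qed

text \<open>The lengths over \<open>{0..t}\<close> and \<open>{t..1}\<close> are both lower
  semicontinuous in \<open>t\<close> and add up to the finite total. So the sets \<open>A\<close>
  and \<open>B\<close>, where the length over \<open>{0..t}\<close> is above and below
  \<open>s\<close>, are both open and cannot cover the connected interval.\<close>

lemma path_length_value:
  fixes \<gamma> :: "real \<Rightarrow> 'a::metric_space"
  assumes \<gamma>: "continuous_on {0..1} \<gamma>" and fin: "path_length \<gamma> 0 1 < top"
    and s: "s \<le> path_length \<gamma> 0 1"
  obtains t where "t \<in> {0..1}" "path_length \<gamma> 0 t = s"
proof (cases "s = 0 \<or> s = path_length \<gamma> 0 1")
  case True
  then show ?thesis using that[of 0] that[of 1] by auto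
next
  case False
  define A where "A = {t \<in> {0..1}. s < path_length \<gamma> 0 t}"
  define B where "B = {t \<in> {0..1}. path_length \<gamma> 0 1 - s < path_length \<gamma> t 1}"
  have A: "openin (top_of_set {0..1}) A"
    unfolding A_def by (rule path_length_lower_semicontinuous[OF \<gamma>]) (auto intro!: continuous_intros)
  have B: "openin (top_of_set {0..1}) B"
    unfolding B_def by (rule path_length_lower_semicontinuous[OF \<gamma>]) (auto intro!: continuous_intros)
  have B_eq: "t \<in> B \<longleftrightarrow> path_length \<gamma> 0 t < s" if t: "t \<in> {0..1}" for t
  proof -
    have add: "path_length \<gamma> 0 t + path_length \<gamma> t 1 = path_length \<gamma> 0 1"
      using path_length_add[of 0 t 1 \<gamma>] t by simp
    obtain x y where xy: "path_length \<gamma> 0 t = ennreal x" "path_length \<gamma> t 1 = ennreal y" "0 \<le> x" "0 \<le> y"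
      using fin unfolding add[symmetric] ennreal_add_less_top by (metis ennreal_cases less_irrefl)
    obtain z where z: "s = ennreal z" "0 \<le> z"
      using s fin by (metis ennreal_cases less_irrefl neq_top_trans)
    have "path_length \<gamma> 0 1 = ennreal (x + y)" using add xy by simp
    moreover from this have "z \<le> x + y" using s z xy by (simp del: ennreal_plus)
    ultimately show ?thesis
      using t xy z by (auto simp: B_def ennreal_minus ennreal_less_iff simp del: ennreal_plus)
  qed
  have "1 \<in> A" using False s by (auto simp: A_def)
  have "0 \<in> B" using False B_eq[of 0] by (auto simp: zero_less_iff_neq_zero)
  have "A \<inter> B = {}"
    using B_eq by (auto simp: A_def dest: less_asym)
  show ?thesis
  proof (rule ccontr)
    assume "\<not> thesis"
    then have "{0..1} \<subseteq> A \<union> B"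
      using that B_eq by (force simp: A_def)
    moreover have "connected {0..1::real}" by simp
    ultimately show False
      using A B \<open>1 \<in> A\<close> \<open>0 \<in> B\<close> \<open>A \<inter> B = {}\<close> unfolding connected_openin by blast
  qed
qed

section \<open>The arc length parametrization\<close>

text \<open>\<open>inv_into\<close> may pick another parameter with the same length; the piece
  between the two then has length 0, so its endpoints coincide.\<close>

lemma arc_length_param_eq:
  fixes \<gamma> :: "real \<Rightarrow> 'a::metric_space"
  assumes fin: "path_length \<gamma> 0 1 < top" and t: "t \<in> {0..1}" and s: "path_length \<gamma> 0 t = ennreal s"
  shows "arc_length_param \<gamma> s = \<gamma> t"
proof -
  define u where "u = inv_into {0..1} (\<lambda>t. path_length \<gamma> 0 t) (ennreal s)"
  have u: "u \<in> {0..1}" "path_length \<gamma> 0 u = ennreal s"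
    using inv_into_into[of "ennreal s" "\<lambda>t. path_length \<gamma> 0 t" "{0..1}"]
      f_inv_into_f[of "ennreal s" "\<lambda>t. path_length \<gamma> 0 t" "{0..1}"] t s[symmetric]
    unfolding u_def by (simp_all add: rev_image_eqI)
  have eq: "\<gamma> v = \<gamma> w"
    if "v \<le> w" "v \<in> {0..1}" "w \<in> {0..1}" "path_length \<gamma> 0 v = ennreal s" "path_length \<gamma> 0 w = ennreal s" for v w
  proof -
    have "ennreal s + path_length \<gamma> v w = ennreal s"
      using path_length_add[of 0 v w \<gamma>] that by simp
    then have "path_length \<gamma> v w = 0"
      using ennreal_add_left_cancel[of "ennreal s" "path_length \<gamma> v w" 0] by simp
    then show ?thesis
      using dist_le_path_length[OF that(1), of \<gamma>] by simp
  qed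
  have "\<gamma> u = \<gamma> t"
  proof (cases "u \<le> t")
    case True
    then show ?thesis by (rule eq) (fact u t s)+
  next
    case False
    then have "t \<le> u" by simp
    then show ?thesis by (rule eq[symmetric]) (fact u t s)+
  qed
  then show ?thesis by (simp add: arc_length_param_def u_def)
qed

text \<open>Chords are no longer than arcs, so the parametrization is 1-Lipschitz. Continuity later
  makes the integrand of a line integral Borel.\<close>

lemma continuous_on_arc_length_param:
  fixes \<gamma> :: "real \<Rightarrow> 'a::metric_space"
  assumes \<gamma>: "continuous_on {0..1} \<gamma>" and fin: "path_length \<gamma> 0 1 < top"
  shows "continuous_on {0..enn2real (path_length \<gamma> 0 1)} (arc_length_param \<gamma>)"
proof -
  have Lip: "dist (arc_length_param \<gamma> s) (arc_length_param \<gamma> s') \<le> s' - s"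
    if ss: "0 \<le> s" "s \<le> s'" "s' \<le> enn2real (path_length \<gamma> 0 1)" for s s'
  proof (cases "s = s'")
    case False
    have le: "ennreal s \<le> path_length \<gamma> 0 1" "ennreal s' \<le> path_length \<gamma> 0 1"
      using ss fin by (metis ennreal_enn2real ennreal_leI order_trans)+
    obtain t where t: "t \<in> {0..1}" "path_length \<gamma> 0 t = ennreal s"
      using path_length_value[OF \<gamma> fin le(1)] .
    obtain t' where t': "t' \<in> {0..1}" "path_length \<gamma> 0 t' = ennreal s'"
      using path_length_value[OF \<gamma> fin le(2)] .
    have "t \<le> t'"
    proof (rule ccontr)
      assume "\<not> t \<le> t'"
      then have "ennreal s' \<le> ennreal s"
        using path_length_add[of 0 t' t \<gamma>] t t' add_increasing2[of "path_length \<gamma> t' t" "ennreal s'" "ennreal s'"]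
        by simp
      then show False using ss False by simp
    qed
    have "ennreal s + path_length \<gamma> t t' = ennreal s'"
      using path_length_add[of 0 t t' \<gamma>] t t' \<open>t \<le> t'\<close> by simp
    then have "path_length \<gamma> t t' = ennreal (s' - s)"
      using ss ennreal_add_left_cancel[of "ennreal s" "path_length \<gamma> t t'" "ennreal (s' - s)"]
      by (simp add: ennreal_plus[symmetric] del: ennreal_plus)
    then have "ennreal (dist (\<gamma> t) (\<gamma> t')) \<le> ennreal (s' - s)"
      using dist_le_path_length[OF \<open>t \<le> t'\<close>, of \<gamma>] by simp
    then have "dist (\<gamma> t) (\<gamma> t') \<le> s' - s" using ss by simp
    then show ?thesis
      using arc_length_param_eq[OF fin t] arc_length_param_eq[OF fin t'] by simp
  qed simp
  have "dist (arc_length_param \<gamma> s) (arc_length_param \<gamma> s') \<le> dist s s'"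
    if "s \<in> {0..enn2real (path_length \<gamma> 0 1)}" "s' \<in> {0..enn2real (path_length \<gamma> 0 1)}" for s s'
    using Lip[of s s'] Lip[of s' s] that by (cases "s \<le> s'") (auto simp: dist_real_def dist_commute)
  then show ?thesis
    unfolding continuous_on_iff by (meson order_le_less_trans)
qed

section \<open>Subpaths and the comparison of moduli\<close>

lemma path_length_subpath:
  fixes \<gamma> :: "real \<Rightarrow> 'a::real_normed_vector"
  assumes "a < b"
  shows "path_length (subpath a b \<gamma>) u v = path_length \<gamma> (a + (b - a) * u) (a + (b - a) * v)"
proof (rule antisym)
  define \<phi> where "\<phi> x = a + (b - a) * x" for x
  define \<psi> where "\<psi> x = (x - a) / (b - a)" for x
  have \<phi>: "\<phi> x \<le> \<phi> y \<longleftrightarrow> x \<le> y" and \<psi>: "\<psi> x \<le> \<psi> y \<longleftrightarrow> x \<le> y" and \<phi>\<psi>: "\<phi> (\<psi> x) = x"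
    and \<psi>\<phi>: "\<psi> (\<phi> x) = x" for x y
    using assms by (simp_all add: \<phi>_def \<psi>_def divide_le_cancel)
  have sorted: "sorted (map h ts)" if "sorted ts" "\<And>x y. h x \<le> h y \<longleftrightarrow> x \<le> y" for ts and h :: "real \<Rightarrow> real"
    using that by (simp add: sorted_map_mono)
  have poly: "polygon_length (subpath a b \<gamma>) ts = polygon_length \<gamma> (map \<phi> ts)" for ts
    unfolding polygon_length_def by (intro sum.cong) (simp_all add: subpath_def \<phi>_def add.commute)
  show "path_length (subpath a b \<gamma>) u v \<le> path_length \<gamma> (a + (b - a) * u) (a + (b - a) * v)"
  proof (rule path_length_leI)
    fix ts assume ts: "sorted ts" "set ts \<subseteq> {u..v}"
    show "polygon_length (subpath a b \<gamma>) ts \<le> path_length \<gamma> (a + (b - a) * u) (a + (b - a) * v)"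
      unfolding poly
    proof (rule polygon_length_le_path_length)
      show "sorted (map \<phi> ts)" by (rule sorted[OF ts(1) \<phi>])
      show "set (map \<phi> ts) \<subseteq> {a + (b - a) * u..a + (b - a) * v}"
        using ts(2) \<phi> unfolding \<phi>_def[symmetric] by auto
    qed
  qed
  show "path_length \<gamma> (a + (b - a) * u) (a + (b - a) * v) \<le> path_length (subpath a b \<gamma>) u v"
  proof (rule path_length_leI)
    fix ts assume ts: "sorted ts" "set ts \<subseteq> {a + (b - a) * u..a + (b - a) * v}"
    have "map \<phi> (map \<psi> ts) = ts" by (simp add: \<phi>\<psi> map_idI)
    then have "polygon_length \<gamma> ts = polygon_length (subpath a b \<gamma>) (map \<psi> ts)"
      using poly by metis
    also have "\<dots> \<le> path_length (subpath a b \<gamma>) u v"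
    proof (rule polygon_length_le_path_length)
      show "sorted (map \<psi> ts)" by (rule sorted[OF ts(1) \<psi>])
      show "set (map \<psi> ts) \<subseteq> {u..v}"
      proof
        fix x assume "x \<in> set (map \<psi> ts)"
        then obtain y where y: "x = \<psi> y" "y \<in> set ts" by auto
        then have "\<phi> u \<le> y" "y \<le> \<phi> v" using ts(2) by (auto simp: \<phi>_def)
        then have "\<psi> (\<phi> u) \<le> x" "x \<le> \<psi> (\<phi> v)" by (simp_all only: y \<psi>)
        then show "x \<in> {u..v}" by (simp add: \<psi>\<phi>)
      qed
    qed
    finally show "polygon_length \<gamma> ts \<le> path_length (subpath a b \<gamma>) u v" .
  qed
qed

text \<open>The arc length parametrization of the subpath is that of \<open>\<gamma>\<close> shifted
  by \<open>la\<close>, the length of the piece before \<open>a\<close>. So the left side is the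
  same integral over a part of the parameter interval.\<close>

lemma line_integral_subpath_le:
  fixes \<gamma> :: "real \<Rightarrow> 'a::real_normed_vector"
  assumes \<gamma>: "path \<gamma>" and fin: "path_length \<gamma> 0 1 < top"
    and ab: "0 \<le> a" "a < b" "b \<le> 1" and \<rho>: "\<rho> \<in> borel_measurable borel"
  shows "line_integral \<rho> (subpath a b \<gamma>) \<le> line_integral \<rho> \<gamma>"
proof -
  have cont: "continuous_on {0..1} \<gamma>" using \<gamma> by (simp add: path_def)
  define \<gamma>' where "\<gamma>' = subpath a b \<gamma>"
  have add: "path_length \<gamma> 0 a + path_length \<gamma> a b + path_length \<gamma> b 1 = path_length \<gamma> 0 1"
    using ab path_length_add[of 0 a b \<gamma>] path_length_add[of 0 b 1 \<gamma>] by simp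
  then have "path_length \<gamma> 0 a < top" "path_length \<gamma> a b < top" "path_length \<gamma> b 1 < top"
    using fin by (auto simp: less_top[symmetric])
  then obtain la l lb where l: "path_length \<gamma> 0 a = ennreal la" "path_length \<gamma> a b = ennreal l"
      "path_length \<gamma> b 1 = ennreal lb" "0 \<le> la" "0 \<le> l" "0 \<le> lb"
    by (metis ennreal_cases less_irrefl)
  have tot: "path_length \<gamma> 0 1 = ennreal (la + l + lb)"
    using add l by simp
  have tot': "path_length \<gamma>' 0 1 = ennreal l"
    unfolding \<gamma>'_def path_length_subpath[OF ab(2)] using l by simp
  have cont': "continuous_on {0..1} \<gamma>'"
    using \<gamma> ab path_subpath[of \<gamma> a b] unfolding \<gamma>'_def by (simp add: path_def)
  have shift: "arc_length_param \<gamma>' s = arc_length_param \<gamma> (la + s)" if s: "s \<in> {0..l}" for s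
  proof -
    have "path_length \<gamma>' 0 1 < top" "ennreal s \<le> path_length \<gamma>' 0 1"
      using tot' s by (auto simp: ennreal_leI)
    from path_length_value[OF cont' this]
    obtain t where t: "t \<in> {0..1}" "path_length \<gamma>' 0 t = ennreal s" .
    have 1: "arc_length_param \<gamma>' s = \<gamma>' t"
      by (rule arc_length_param_eq) (use tot' t in auto)
    define u where "u = a + (b - a) * t"
    have "(b - a) * t \<le> b - a" "0 \<le> (b - a) * t"
      using ab t mult_left_mono[of t 1 "b - a"] by auto
    then have u: "u \<in> {0..1}" "a \<le> u"
      unfolding u_def atLeastAtMost_iff using ab by linarith+
    have "path_length \<gamma> a u = ennreal s"
      using t(2) unfolding \<gamma>'_def path_length_subpath[OF ab(2)] u_def by simp
    then have "path_length \<gamma> 0 u = ennreal (la + s)"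
      using path_length_add[of 0 a u \<gamma>] u ab l s by simp
    then have "arc_length_param \<gamma> (la + s) = \<gamma> u"
      by (intro arc_length_param_eq[OF fin u(1)])
    then show ?thesis using 1 by (simp add: \<gamma>'_def subpath_def u_def add.commute)
  qed
  let ?f = "\<lambda>s. \<rho> (arc_length_param \<gamma> s) * indicator {0..la + l + lb} s"
  have "continuous_on {0..la + l + lb} (arc_length_param \<gamma>)"
    using continuous_on_arc_length_param[OF cont fin] tot l by (simp del: ennreal_plus)
  then have "arc_length_param \<gamma> \<in> borel_measurable (restrict_space borel {0..la + l + lb})"
    by (rule borel_measurable_continuous_on_restrict)
  then have "(\<lambda>s. \<rho> (arc_length_param \<gamma> s)) \<in> borel_measurable (restrict_space borel {0..la + l + lb})"
    using \<rho> by (rule measurable_compose)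
  then have meas: "?f \<in> borel_measurable borel"
    by (subst (asm) borel_measurable_restrict_space_iff_ennreal) auto
  have "line_integral \<rho> \<gamma>' = (\<integral>\<^sup>+s. \<rho> (arc_length_param \<gamma>' s) * indicator {0..l} s \<partial>lborel)"
    using tot' l by (simp add: line_integral_def)
  also have "\<dots> \<le> (\<integral>\<^sup>+s. ?f (la + 1 * s) \<partial>lborel)"
    using l shift by (intro nn_integral_mono) (auto simp: indicator_def)
  also have "\<dots> = (\<integral>\<^sup>+s. ?f s \<partial>lborel)"
    using nn_integral_real_affine[OF meas, of 1 la] by simp
  also have "\<dots> = line_integral \<rho> \<gamma>"
    using tot l by (simp add: line_integral_def del: ennreal_plus)
  finally show ?thesis by (simp add: \<gamma>'_def)
qed

lemma locally_rectifiable_subpath: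
  fixes \<gamma> :: "real \<Rightarrow> 'a::real_normed_vector"
  assumes "locally_rectifiable \<gamma>" "0 \<le> a" "a < b" "b \<le> 1"
  shows "locally_rectifiable (subpath a b \<gamma>)"
  unfolding locally_rectifiable_def
proof (intro allI impI)
  fix u v :: real assume uv: "0 \<le> u" "u \<le> v" "v \<le> 1"
  have "(b - a) * v \<le> b - a" "0 \<le> (b - a) * u"
    using assms uv mult_left_mono[of v 1 "b - a"] by auto
  then have "0 \<le> a + (b - a) * u" "a + (b - a) * v \<le> 1"
    using assms by linarith+
  moreover have "a + (b - a) * u \<le> a + (b - a) * v"
    using assms uv by (simp add: mult_left_mono)
  ultimately show "path_length (subpath a b \<gamma>) u v < top"
    using assms(1) unfolding path_length_subpath[OF assms(3)] locally_rectifiable_def by blast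
qed

text \<open>The minorization principle for moduli: a density admissible for the subpaths is
  admissible for the longer paths, so the infimum for \<open>\<Gamma>\<close> is over a larger
  set.\<close>

lemma modulus_minorized:
  fixes \<Gamma> \<Delta> :: "(real \<Rightarrow> 'a::euclidean_space) set"
  assumes "\<And>\<gamma>. \<gamma> \<in> \<Gamma> \<Longrightarrow> path \<gamma> \<and> (\<exists>a b. 0 \<le> a \<and> a < b \<and> b \<le> 1 \<and> subpath a b \<gamma> \<in> \<Delta>)"
  shows "modulus p \<Gamma> \<le> modulus p \<Delta>"
proof -
  have "admissible \<Delta> \<subseteq> admissible \<Gamma>"
  proof
    fix \<rho> assume \<rho>: "\<rho> \<in> admissible \<Delta>"
    have "1 \<le> line_integral \<rho> \<gamma>" if \<gamma>: "\<gamma> \<in> \<Gamma>" "locally_rectifiable \<gamma>" for \<gamma>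
    proof -
      obtain a b where ab: "path \<gamma>" "0 \<le> a" "a < b" "b \<le> 1" "subpath a b \<gamma> \<in> \<Delta>"
        using assms[OF \<gamma>(1)] by blast
      have "1 \<le> line_integral \<rho> (subpath a b \<gamma>)"
        using \<rho> ab locally_rectifiable_subpath[OF \<gamma>(2) ab(2-4)] by (simp add: admissible_def)
      also have "\<dots> \<le> line_integral \<rho> \<gamma>"
        using \<rho> \<gamma>(2) ab by (intro line_integral_subpath_le) (auto simp: admissible_def locally_rectifiable_def)
      finally show ?thesis .
    qed
    then show "\<rho> \<in> admissible \<Gamma>" using \<rho> by (simp add: admissible_def)
  qed
  then show ?thesis unfolding modulus_def by (rule INF_superset_mono) simp
qed

text \<open>A joining path is cut at the first time \<open>b\<close> at which its image has distance
  at least \<open>r\<^sub>2\<close> from \<open>y\<close>, and then at the last time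
  \<open>a\<close> before \<open>b\<close> with distance at most \<open>r\<^sub>1\<close>. Choosing
  \<open>b\<close> before \<open>a\<close> keeps the image of the interior in the open
  annulus.\<close>

lemma modulus_joining_paths_le_poletsky_paths:
  fixes f :: "'a::euclidean_space \<Rightarrow> 'a"
  assumes cont: "continuous_on D f" and E: "E \<subseteq> D" "f ` E \<subseteq> cball y r\<^sub>1"
    and F: "F \<subseteq> D" "f ` F \<inter> ball y r\<^sub>2 = {}" and r: "r\<^sub>1 < r\<^sub>2"
  shows "modulus p (joining_paths E F D) \<le> modulus p (poletsky_paths D f y r\<^sub>1 r\<^sub>2)"
proof (rule modulus_minorized, intro conjI)
  fix \<gamma> assume "\<gamma> \<in> joining_paths E F D"
  then have \<gamma>: "path \<gamma>" "\<gamma> 0 \<in> E" "\<gamma> 1 \<in> F" "\<And>t. t \<in> {0<..<1} \<Longrightarrow> \<gamma> t \<in> D"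
    by (auto simp: joining_paths_def pathstart_def pathfinish_def)
  show "path \<gamma>" by fact
  have in_D: "\<gamma> t \<in> D" if "t \<in> {0..1}" for t
    using \<gamma> E F that by (cases "t = 0"; cases "t = 1") auto
  have cf: "continuous_on {0..1} (f \<circ> \<gamma>)"
    using \<gamma>(1) in_D by (intro continuous_on_compose continuous_on_subset[OF cont]) (auto simp: path_def)
  define h where "h t = dist (f (\<gamma> t)) y" for t
  have h: "continuous_on {0..1} h"
    unfolding h_def using cf by (intro continuous_intros) (simp add: o_def)
  have h01: "h 0 \<le> r\<^sub>1" "r\<^sub>2 \<le> h 1"
    using \<gamma> E F by (force simp: h_def dist_commute)+
  have "compact {t \<in> {0..1}. r\<^sub>2 \<le> h t}"
    using continuous_closed_preimage[OF h, of "{r\<^sub>2..}"]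
    by (auto simp: compact_eq_bounded_closed vimage_def Int_def intro: bounded_subset[of "{0..1}"])
  moreover have "1 \<in> {t \<in> {0..1}. r\<^sub>2 \<le> h t}" using h01 by simp
  ultimately obtain b where b: "b \<in> {0..1}" "r\<^sub>2 \<le> h b" "\<And>t. t \<in> {0..1} \<Longrightarrow> r\<^sub>2 \<le> h t \<Longrightarrow> b \<le> t"
    using compact_attains_inf[of "{t \<in> {0..1}. r\<^sub>2 \<le> h t}"] by blast
  have hb: "continuous_on {0..b} h"
    using h b(1) by (auto intro: continuous_on_subset)
  have "compact {t \<in> {0..b}. h t \<le> r\<^sub>1}"
    using continuous_closed_preimage[OF hb, of "{..r\<^sub>1}"]
    by (auto simp: compact_eq_bounded_closed vimage_def Int_def intro: bounded_subset[of "{0..b}"])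
  moreover have "0 \<in> {t \<in> {0..b}. h t \<le> r\<^sub>1}" using h01 b by simp
  ultimately obtain a where a: "a \<in> {0..b}" "h a \<le> r\<^sub>1" "\<And>t. t \<in> {0..b} \<Longrightarrow> h t \<le> r\<^sub>1 \<Longrightarrow> t \<le> a"
    using compact_attains_sup[of "{t \<in> {0..b}. h t \<le> r\<^sub>1}"] by blast
  have ab: "0 \<le> a" "a < b" "b \<le> 1"
    using a b r by (auto simp: less_le)
  have b_eq: "h b = r\<^sub>2"
  proof -
    obtain t where "0 \<le> t" "t \<le> b" "h t = r\<^sub>2"
      using IVT'[of h 0 r\<^sub>2 b] h01 b r hb by auto
    then show ?thesis using b(3)[of t] \<open>b \<in> {0..1}\<close> by simp
  qed
  have a_eq: "h a = r\<^sub>1"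
  proof -
    have "continuous_on {a..b} h" using hb ab by (auto intro: continuous_on_subset)
    then obtain t where "a \<le> t" "t \<le> b" "h t = r\<^sub>1"
      using IVT'[of h a r\<^sub>1 b] a b_eq ab r by auto
    then show ?thesis using a(3)[of t] ab by simp
  qed
  have mid: "r\<^sub>1 < h t \<and> h t < r\<^sub>2" if "a < t" "t < b" for t
    using a(3)[of t] b(3)[of t] that ab by (auto simp: not_le[symmetric])
  have param: "a + (b - a) * t \<in> {a<..<b}" if "t \<in> {0<..<1}" for t
  proof -
    have "(b - a) * t < b - a" "0 < (b - a) * t"
      using that ab mult_strict_left_mono[of t 1 "b - a"] by auto
    then show ?thesis unfolding greaterThanLessThan_iff by linarith
  qed
  have "subpath a b \<gamma> \<in> poletsky_paths D f y r\<^sub>1 r\<^sub>2"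
    unfolding poletsky_paths_def joining_paths_def mem_Collect_eq
  proof (intro conjI ballI)
    show "path (subpath a b \<gamma>)"
      using \<gamma>(1) ab by (intro path_subpath) auto
    show "path_image (subpath a b \<gamma>) \<subseteq> D"
      using in_D ab by (auto simp: path_image_subpath)
    have "f \<circ> subpath a b \<gamma> = subpath a b (f \<circ> \<gamma>)" by (auto simp: subpath_def)
    moreover have "path (f \<circ> \<gamma>)" using cf by (simp add: path_def)
    ultimately show "path (f \<circ> subpath a b \<gamma>)"
      using ab by (simp add: path_subpath)
    show "pathstart (f \<circ> subpath a b \<gamma>) \<in> sphere y r\<^sub>1" "pathfinish (f \<circ> subpath a b \<gamma>) \<in> sphere y r\<^sub>2"
      using a_eq b_eq by (auto simp: pathstart_def pathfinish_def subpath_def h_def dist_commute)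
    fix t :: real assume "t \<in> {0<..<1}"
    from mid[of "a + (b - a) * t"] param[OF this]
    show "(f \<circ> subpath a b \<gamma>) t \<in> annulus y r\<^sub>1 r\<^sub>2"
      by (auto simp: annulus_def subpath_def h_def add.commute)
  qed
  then show "\<exists>a b. 0 \<le> a \<and> a < b \<and> b \<le> 1 \<and> subpath a b \<gamma> \<in> poletsky_paths D f y r\<^sub>1 r\<^sub>2"
    using ab by blast
qed

section \<open>Discrete open closed maps\<close>

lemma closedin_sequential_limits:
  fixes S :: "'a::metric_space set"
  shows "closedin (top_of_set S) T \<longleftrightarrow>
    T \<subseteq> S \<and> (\<forall>s l. (\<forall>n::nat. s n \<in> T) \<and> s \<longlonglongrightarrow> l \<and> l \<in> S \<longrightarrow> l \<in> T)" (is "?L \<longleftrightarrow> ?R")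
proof
  assume ?L
  then obtain U where U: "closed U" "T = S \<inter> U" by (auto simp: closedin_closed)
  then have "l \<in> T" if "\<forall>n. s n \<in> T" "s \<longlonglongrightarrow> l" "l \<in> S" for s :: "nat \<Rightarrow> 'a" and l
    using that closed_sequentially[of U s l] by auto
  then show ?R using U by blast
next
  assume ?R
  then show ?L unfolding closedin_limpt islimpt_sequential by blast
qed

text \<open>The fibre is even finite. An infinite one contains distinct points \<open>z k\<close>,
  with no limit point in \<open>D\<close>. As the fibre is discrete, there are points
  \<open>x k\<close> off the fibre, ever closer to \<open>z k\<close>, whose values tend to
  \<open>y\<close>. They have no limit point in \<open>D\<close> either, so they form a closed set;
  its image would be closed in \<open>D'\<close> and yet miss the limit \<open>y\<close>.\<close>

lemma discrete_closed_map_imp_compact_fibre: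
  fixes f :: "'a::euclidean_space \<Rightarrow> 'b::metric_space"
  assumes D: "open D"
    and cont: "continuous_on D f"
    and disc: "\<And>y. discrete {x \<in> D. f x = y}"
    and closed: "closed_map (top_of_set D) (top_of_set D') f"
    and y: "y \<in> D'"
  shows "compact {x \<in> D. f x = y}"
proof (rule ccontr)
  define Z where "Z = {x \<in> D. f x = y}"
  assume "\<not> compact {x \<in> D. f x = y}"
  then have "infinite Z"
    unfolding Z_def using finite_imp_compact by blast
  then obtain z :: "nat \<Rightarrow> 'a" where z: "inj z" "range z \<subseteq> Z"
    by (meson infinite_countable_subset)
  have not_lim: "\<not> p islimpt Z" if "p \<in> D" for p
  proof
    assume p: "p islimpt Z"
    have "closedin (top_of_set D) Z"
      unfolding Z_def using continuous_closedin_preimage_constant[OF cont] by simp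
    then have "p \<in> Z"
      using p that by (auto simp: closedin_limpt)
    then have "p isolated_in Z"
      using disc[of y] unfolding Z_def discrete_def by blast
    then show False
      using p isolated_in_islimpt_iff[of p Z] by blast
  qed
  have "\<exists>x. x \<in> D \<and> dist x (z k) < 1 / Suc k \<and> f x \<noteq> y \<and> dist (f x) y < 1 / Suc k" for k
  proof -
    have zk: "z k \<in> D" "f (z k) = y" using z by (auto simp: Z_def)
    have "\<forall>\<^sub>F x in at (z k). x \<notin> Z"
      using not_lim[OF zk(1)] by (simp add: islimpt_iff_eventually)
    moreover have "\<forall>\<^sub>F x in at (z k). x \<in> D"
      by (rule eventually_at_in_open'[OF D zk(1)])
    moreover have "\<forall>\<^sub>F x in at (z k). dist x (z k) < 1 / Suc k"
      by (auto simp: eventually_at intro!: exI[of _ "1 / Suc k"])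
    moreover have "isCont f (z k)"
      using cont D zk(1) by (simp add: continuous_on_eq_continuous_at)
    then have "\<forall>\<^sub>F x in at (z k). dist (f x) y < 1 / Suc k"
      using zk by (auto simp: isCont_def intro!: tendstoD)
    ultimately have "\<forall>\<^sub>F x in at (z k). x \<in> D \<and> dist x (z k) < 1 / Suc k \<and> f x \<noteq> y \<and> dist (f x) y < 1 / Suc k"
      by eventually_elim (auto simp: Z_def)
    then show ?thesis
      using eventually_happens[of _ "at (z k)"] by (auto simp: trivial_limit_at)
  qed
  then obtain x where x: "\<And>k. x k \<in> D" "\<And>k. dist (x k) (z k) < 1 / Suc k"
     "\<And>k. f (x k) \<noteq> y" "\<And>k. dist (f (x k)) y < 1 / Suc k"
    by metis
  have "closedin (top_of_set D) (range x)"
    unfolding closedin_limpt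
  proof (intro conjI allI impI)
    show "range x \<subseteq> D" using x(1) by blast
    fix p assume p: "p islimpt range x \<and> p \<in> D"
    obtain d where d: "d > 0" "\<And>w. w \<in> ball p d - {p} \<Longrightarrow> w \<notin> Z"
      using not_lim[of p] p unfolding islimpt_def
      by (metis Diff_iff insertI1 mem_ball open_contains_ball subsetD)
    have fin: "finite {k. dist (z k) p < d}"
    proof -
      have "z ` {k. dist (z k) p < d} \<subseteq> {p}"
        using z d(2) by (force simp: dist_commute)
      then have "finite (z ` {k. dist (z k) p < d})" by (rule finite_subset) simp
      then show ?thesis
        using z(1) by (metis finite_imageD inj_on_subset subset_UNIV)
    qed
    \<comment> \<open>Beyond \<open>N\<close> the points \<open>x k\<close> and \<open>z k\<close>
      are less than \<open>d / 2\<close> apart, so \<open>x k\<close> can be this close to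
      \<open>p\<close> only if \<open>z k\<close> is within \<open>d\<close>.\<close>
    have "finite {k. dist (x k) p < d / 2}"
    proof -
      obtain N where N: "1 / Suc N < d / 2" using d(1) nat_approx_posE[of "d/2"] by auto
      have "{k. dist (x k) p < d / 2} \<subseteq> {..N} \<union> {k. dist (z k) p < d}"
      proof
        fix k assume k: "k \<in> {k. dist (x k) p < d / 2}"
        have "dist (z k) p < d" if "k > N"
        proof -
          have "1 / Suc k \<le> 1 / Suc N" using that by (simp add: frac_le)
          moreover have "dist (z k) p \<le> dist (x k) (z k) + dist (x k) p" by (rule dist_triangle3)
          ultimately show ?thesis using x(2)[of k] k N by auto
        qed
        then show "k \<in> {..N} \<union> {k. dist (z k) p < d}"
          by (cases "k \<le> N") auto
      qed
      then show ?thesis using fin finite_subset by auto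
    qed
    then have "finite (range x \<inter> ball p (d / 2))"
    proof -
      have "range x \<inter> ball p (d / 2) \<subseteq> x ` {k. dist (x k) p < d / 2}"
        by (auto simp: dist_commute)
      then show ?thesis
        using \<open>finite {k. dist (x k) p < d / 2}\<close> finite_subset by blast
    qed
    moreover have "infinite (range x \<inter> ball p (d / 2))"
      using p d(1) by (auto simp: islimpt_eq_infinite_ball)
    ultimately show "p \<in> range x" by blast
  qed
  then have cl: "closedin (top_of_set D') (f ` range x)"
    using closed by (simp add: closed_map_def)
  have "(\<lambda>k. f (x k)) \<longlonglongrightarrow> y"
  proof (rule tendstoI)
    fix e :: real assume "e > 0"
    then obtain N where N: "1 / Suc N < e" using nat_approx_posE by blast
    show "\<forall>\<^sub>F k in sequentially. dist (f (x k)) y < e"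
      unfolding eventually_sequentially
    proof (intro exI allI impI)
      fix k assume "N \<le> k"
      then have "1 / Suc k \<le> 1 / Suc N" by (simp add: frac_le)
      then show "dist (f (x k)) y < e" using x(4)[of k] N by linarith
    qed
  qed
  moreover have "\<forall>k. f (x k) \<in> f ` range x" by simp
  ultimately have "y \<in> f ` range x"
    using cl y unfolding closedin_sequential_limits by (meson conjI)
  then show False using x(3) by blast
qed

text \<open>A closed map with compact fibres is proper. Closedness and discreteness of
  \<open>f\<close> enter the boundary arguments only in this form.\<close>

lemma discrete_closed_map_imp_compact_preimage:
  fixes f :: "'a::euclidean_space \<Rightarrow> 'b::metric_space"
  assumes "open D" "continuous_on D f" "\<And>y. discrete {x \<in> D. f x = y}"
    and closed: "closed_map (top_of_set D) (top_of_set D') f"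
    and K: "compact K" "K \<subseteq> D'"
  shows "compact {x \<in> D. f x \<in> K}"
proof -
  have "proper_map (top_of_set D) (top_of_set D') f"
    using closed discrete_closed_map_imp_compact_fibre[OF assms(1-4)]
    by (simp add: proper_map_def compactin_subtopology)
  from compactin_proper_map_preimage[OF this, of K] K show ?thesis
    by (simp add: compactin_subtopology)
qed

text \<open>A substitute for path lifting: the component of the preimage of a connected open set is mapped
  onto that set, since its image is both open and (by properness) closed.\<close>

lemma component_of_preimage_onto:
  fixes f :: "'a::euclidean_space \<Rightarrow> 'b::euclidean_space"
  assumes D: "open D"
    and cont: "continuous_on D f"
    and img: "f ` D = D'"
    and opn: "open_map (top_of_set D) euclidean f"
    and proper: "\<And>K. compact K \<Longrightarrow> K \<subseteq> D' \<Longrightarrow> compact {x \<in> D. f x \<in> K}"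
    and W: "open W" "connected W" "W \<subseteq> D'"
    and x: "x \<in> D" "f x \<in> W"
    and w: "w \<in> W"
  obtains E z where "compact E" "connected E" "E \<subseteq> D" "x \<in> E" "z \<in> E" "f z = w" "f ` E \<subseteq> W"
proof -
  define P where "P = {x \<in> D. f x \<in> W}"
  define C where "C = connected_component_set P x"
  have P: "open P"
    using continuous_open_preimage[OF cont D W(1)] by (simp add: P_def Int_def vimage_def)
  have xC: "x \<in> C" using x by (simp add: C_def P_def)
  have C: "open C" "connected C" "C \<subseteq> P"
    using P by (auto simp: C_def open_connected_component connected_component_subset)
  have fC: "f ` C \<subseteq> W" using C by (auto simp: P_def)
  have "openin (top_of_set W) (f ` C)"
  proof (rule open_subset[OF fC])
    have "openin (top_of_set D) C"
      using C(1,3) D by (simp add: openin_open_eq P_def) blast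
    then show "open (f ` C)" using opn by (simp add: open_map_def)
  qed
  moreover have "closedin (top_of_set W) (f ` C)"
    unfolding closedin_sequential_limits
  proof (intro conjI allI impI)
    show "f ` C \<subseteq> W" by (rule fC)
    fix s l assume s: "(\<forall>n::nat. s n \<in> f ` C) \<and> s \<longlonglongrightarrow> l \<and> l \<in> W"
    then have l: "l \<in> W" by blast
    have "\<forall>n. \<exists>c. c \<in> C \<and> f c = s n" using s by (auto simp: image_iff eq_commute)
    then obtain c where c: "\<And>n. c n \<in> C" "\<And>n. f (c n) = s n" by metis
    have "l \<in> D'" using l W by blast
    have lim: "s \<longlonglongrightarrow> l" using s by blast
    \<comment> \<open>The values and their limit form a compact subset of \<open>D'\<close>, so by
      properness the points \<open>c n\<close> have a subsequence converging in
      \<open>D\<close>.\<close>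
    define K where "K = insert l (range s)"
    have K: "compact K" unfolding K_def using compact_sequence_with_limit[OF lim] .
    have "range s \<subseteq> W" using s fC by blast
    then have "K \<subseteq> D'" unfolding K_def using \<open>l \<in> D'\<close> W(3) by blast
    from proper[OF K this] have "compact {x \<in> D. f x \<in> K}" .
    moreover have "c n \<in> {x \<in> D. f x \<in> K}" for n
      using c(1)[of n] c(2)[of n] C(3) by (auto simp: K_def P_def)
    ultimately obtain p r where p: "p \<in> D" "strict_mono r" "(c \<circ> r) \<longlonglongrightarrow> p"
      unfolding compact_def by blast
    have "isCont f p" using cont D p(1) by (simp add: continuous_on_eq_continuous_at)
    then have "(\<lambda>n. f ((c \<circ> r) n)) \<longlonglongrightarrow> f p"
      using p(3) by (rule isCont_tendsto_compose)
    moreover have "(\<lambda>n. f ((c \<circ> r) n)) \<longlonglongrightarrow> l"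
      using LIMSEQ_subseq_LIMSEQ[OF lim p(2)] c(2) by (simp add: o_def)
    ultimately have fp: "f p = l" by (rule LIMSEQ_unique)
    then have "p \<in> P" using p(1) l by (simp add: P_def)
    have "closedin (top_of_set P) C"
      unfolding C_def by (rule closedin_connected_component)
    moreover have "\<forall>n. (c \<circ> r) n \<in> C" using c(1) by simp
    ultimately have "p \<in> C"
      using p(3) \<open>p \<in> P\<close> unfolding closedin_sequential_limits by blast
    then show "l \<in> f ` C" using fp by blast
  qed
  ultimately have "f ` C = W"
    using W(2) xC unfolding connected_clopen by blast
  then obtain z where z: "z \<in> C" "f z = w" using w by blast
  \<comment> \<open>\<open>C\<close> need not be compact; being open and connected, it is path
    connected, and the image of a path supplies the continuum.\<close>
  have "path_connected C" using C by (simp add: connected_open_path_connected)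
  then obtain g where g: "path g" "path_image g \<subseteq> C" "pathstart g = x" "pathfinish g = z"
    using xC z(1) unfolding path_connected_def by blast
  show thesis
  proof
    show "compact (path_image g)" "connected (path_image g)"
      using g by (simp_all add: compact_path_image connected_path_image)
    show "path_image g \<subseteq> D" using g C by (auto simp: P_def)
    show "x \<in> path_image g" "z \<in> path_image g" using g by auto
    show "f z = w" by (rule z)
    show "f ` path_image g \<subseteq> W" using g(2) fC by blast
  qed
qed

section \<open>Polar coordinates\<close>

lemma measurable_sgn_euclidean [measurable]:
  "(sgn :: 'a::euclidean_space \<Rightarrow> 'a) \<in> borel_measurable borel"
  unfolding sgn_div_norm[abs_def] by measurable

lemma nn_integral_scaleR_lborel:
  fixes g :: "'a::euclidean_space \<Rightarrow> ennreal"
  assumes [measurable]: "g \<in> borel_measurable borel" and "s > 0"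
  shows "(\<integral>\<^sup>+x. g x \<partial>lborel) = ennreal (s ^ DIM('a)) * (\<integral>\<^sup>+x. g (s *\<^sub>R x) \<partial>lborel)"
  using \<open>s > 0\<close> by (subst lborel_affine[of s 0])
    (simp_all add: nn_integral_density nn_integral_distr nn_integral_cmult)

lemma nn_integral_inverse_power:
  assumes a: "a > 0" and n: "n > 0"
  shows "(\<integral>\<^sup>+s. ennreal (1 / s ^ Suc n) * indicator {a..} s \<partial>lborel) = ennreal (1 / (n * a ^ n))"
proof -
  have "(\<integral>\<^sup>+s. ennreal (1 / s ^ Suc n) * indicator {a..} s \<partial>lborel) = ennreal (0 - (- 1 / (n * a ^ n)))"
  proof (rule nn_integral_FTC_atLeast)
    fix s assume "a \<le> s"
    then have s: "s > 0" using a by simp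
    obtain m where m: "n = Suc m" using n by (cases n) auto
    show "((\<lambda>s. - 1 / (n * s ^ n)) has_real_derivative 1 / s ^ Suc n) (at s)"
    proof -
      have "((\<lambda>s. - (1 / n) * inverse (s ^ n)) has_real_derivative
          - (1 / n) * - (inverse (s ^ n) * (n * s ^ (n - Suc 0)) * inverse (s ^ n))) (at s)"
        using s DERIV_inverse_fun[OF DERIV_pow[of n s UNIV]] by (intro DERIV_cmult) (simp add: ac_simps)
      moreover have "- (1 / n) * - (inverse (s ^ n) * (n * s ^ (n - Suc 0)) * inverse (s ^ n)) = 1 / s ^ Suc n"
        using s by (simp add: m divide_simps)
      moreover have "(\<lambda>s::real. - (1 / n) * inverse (s ^ n)) = (\<lambda>s. - 1 / (real n * s ^ n))"
        by (simp add: fun_eq_iff divide_inverse)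
      ultimately show ?thesis by simp
    qed
    show "0 \<le> 1 / s ^ Suc n" using s by simp
  next
    have "((\<lambda>s::real. - (1 / n) * inverse (s ^ n)) \<longlongrightarrow> - (1 / n) * 0) at_top"
      using n by (intro tendsto_mult tendsto_const tendsto_inverse_0_at_top filterlim_pow_at_top filterlim_ident)
    then show "((\<lambda>s::real. - 1 / (n * s ^ n)) \<longlongrightarrow> 0) at_top"
      by (simp add: divide_inverse)
  qed simp
  then show ?thesis by simp
qed

text \<open>Integration in polar coordinates, where the integral over the unit sphere is replaced by one over
  the unit ball of a function constant on rays. Only Fubini's theorem and two linear substitutions
  \<open>r = s * norm x\<close> and \<open>y = s *\<^sub>R x\<close> are needed.\<close>

lemma nn_integral_polar:
  fixes g :: "'a::euclidean_space \<Rightarrow> ennreal"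
  assumes [measurable]: "g \<in> borel_measurable borel"
  shows "(\<integral>\<^sup>+x. g x \<partial>lborel) = of_nat DIM('a) *
    (\<integral>\<^sup>+r. indicator {0<..} r * ennreal (r ^ (DIM('a) - 1)) *
       (\<integral>\<^sup>+x. indicator (cball 0 1) x * g (r *\<^sub>R sgn x) \<partial>lborel) \<partial>lborel)"
proof -
  let ?n = "DIM('a)"
  have cball_meas [measurable]: "cball (0::'a) 1 \<in> sets borel" by simp
  have n: "?n > 0" by simp
  have nonzero: "AE x in lborel. x \<noteq> (0::'a)"
    by (rule AE_lborel_singleton)
  have "(\<integral>\<^sup>+r. indicator {0<..} r * ennreal (r ^ (?n - 1)) *
       (\<integral>\<^sup>+x. indicator (cball 0 1) x * g (r *\<^sub>R sgn x) \<partial>lborel) \<partial>lborel)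
    = (\<integral>\<^sup>+r. \<integral>\<^sup>+x. indicator {0<..} r * ennreal (r ^ (?n - 1)) *
        (indicator (cball 0 1) x * g (r *\<^sub>R sgn x)) \<partial>lborel \<partial>lborel)"
  proof (rule nn_integral_cong, rule nn_integral_cmult[symmetric])
    fix r :: real
    show "(\<lambda>x. indicator (cball 0 1) x * g (r *\<^sub>R sgn x)) \<in> borel_measurable lborel"
      by measurable
  qed
  also have "\<dots> = (\<integral>\<^sup>+x. \<integral>\<^sup>+r. indicator {0<..} r * ennreal (r ^ (?n - 1)) *
        (indicator (cball 0 1) x * g (r *\<^sub>R sgn x)) \<partial>lborel \<partial>lborel)"
    by (rule lborel_pair.Fubini') measurable
  also have "\<dots> = (\<integral>\<^sup>+x. \<integral>\<^sup>+s. ennreal (norm x ^ ?n) * indicator {0<..} s * ennreal (s ^ (?n - 1)) *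
        (indicator (cball 0 1) x * g (s *\<^sub>R x)) \<partial>lborel \<partial>lborel)"
    using nonzero
  proof (intro nn_integral_cong_AE, eventually_elim)
    fix x :: 'a assume x: "x \<noteq> 0"
    have pow: "norm x * (norm x * s) ^ (?n - 1) = norm x ^ ?n * s ^ (?n - 1)" for s
      using n by (cases ?n) (auto simp: power_mult_distrib)
    have "(\<integral>\<^sup>+r. indicator {0<..} r * ennreal (r ^ (?n - 1)) *
        (indicator (cball 0 1) x * g (r *\<^sub>R sgn x)) \<partial>lborel) =
       ennreal (norm x) * (\<integral>\<^sup>+s. indicator {0<..} (0 + norm x * s) * ennreal ((0 + norm x * s) ^ (?n - 1)) *
        (indicator (cball 0 1) x * g ((0 + norm x * s) *\<^sub>R sgn x)) \<partial>lborel)"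
      using x by (subst nn_integral_real_affine[where c = "norm x" and t = 0]) auto
    also have "\<dots> = (\<integral>\<^sup>+s. ennreal (norm x) * (indicator {0<..} (0 + norm x * s) * ennreal ((0 + norm x * s) ^ (?n - 1)) *
        (indicator (cball 0 1) x * g ((0 + norm x * s) *\<^sub>R sgn x))) \<partial>lborel)"
      by (subst nn_integral_cmult) auto
    also have "\<dots> = (\<integral>\<^sup>+s. ennreal (norm x ^ ?n) * indicator {0<..} s * ennreal (s ^ (?n - 1)) *
        (indicator (cball 0 1) x * g (s *\<^sub>R x)) \<partial>lborel)"
    proof (rule nn_integral_cong)
      fix s :: real
      show "ennreal (norm x) * (indicator {0<..} (0 + norm x * s) * ennreal ((0 + norm x * s) ^ (?n - 1)) *
        (indicator (cball 0 1) x * g ((0 + norm x * s) *\<^sub>R sgn x)))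
        = ennreal (norm x ^ ?n) * indicator {0<..} s * ennreal (s ^ (?n - 1)) *
        (indicator (cball 0 1) x * g (s *\<^sub>R x))"
      proof (cases "s > 0")
        case True
        have "(norm x * s) *\<^sub>R sgn x = s *\<^sub>R x" using x by (simp add: sgn_div_norm)
        moreover have "ennreal (norm x) * ennreal ((norm x * s) ^ (?n - 1)) = ennreal (norm x ^ ?n) * ennreal (s ^ (?n - 1))"
          using True by (simp add: ennreal_mult[symmetric] pow[simplified])
        ultimately show ?thesis using True x
          by (simp add: mult.assoc[symmetric])
      next
        case False
        then have "\<not> 0 < norm x * s" using x by (simp add: zero_less_mult_iff)
        then show ?thesis using False by simp
      qed
    qed
    finally show "(\<integral>\<^sup>+r. indicator {0<..} r * ennreal (r ^ (?n - 1)) *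
        (indicator (cball 0 1) x * g (r *\<^sub>R sgn x)) \<partial>lborel) = (\<integral>\<^sup>+s. ennreal (norm x ^ ?n) * indicator {0<..} s * ennreal (s ^ (?n - 1)) *
        (indicator (cball 0 1) x * g (s *\<^sub>R x)) \<partial>lborel)" .
  qed
  also have "\<dots> = (\<integral>\<^sup>+s. \<integral>\<^sup>+x. ennreal (norm x ^ ?n) * indicator {0<..} s * ennreal (s ^ (?n - 1)) *
        (indicator (cball 0 1) x * g (s *\<^sub>R x)) \<partial>lborel \<partial>lborel)"
    by (rule lborel_pair.Fubini'[symmetric]) measurable
  \<comment> \<open>With \<open>y = s x\<close> the Jacobian and the powers combine to
    \<open>norm y ^ n / s ^ (n + 1)\<close>, and the condition \<open>norm x \<le> 1\<close> becomes
    \<open>norm y \<le> s\<close>.\<close>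
  also have "\<dots> = (\<integral>\<^sup>+s. \<integral>\<^sup>+y. ennreal (1 / s ^ Suc ?n) * indicator {norm y..} s * indicator {0<..} s *
        (ennreal (norm y ^ ?n) * g y) \<partial>lborel \<partial>lborel)"
  proof (rule nn_integral_cong)
    fix s :: real
    show "(\<integral>\<^sup>+x. ennreal (norm x ^ ?n) * indicator {0<..} s * ennreal (s ^ (?n - 1)) *
        (indicator (cball 0 1) x * g (s *\<^sub>R x)) \<partial>lborel)
      = (\<integral>\<^sup>+y. ennreal (1 / s ^ Suc ?n) * indicator {norm y..} s * indicator {0<..} s *
        (ennreal (norm y ^ ?n) * g y) \<partial>lborel)"
    proof (cases "s > 0")
      case True
      have pow: "s ^ ?n * (1 / s ^ Suc ?n) * (s ^ ?n) = s ^ (?n - 1)"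
        using True n by (cases ?n) (auto simp: field_simps)
      have meas: "(\<lambda>y. indicator {norm y..} s :: ennreal) \<in> borel_measurable (borel :: 'a measure)"
      proof -
        have "(\<lambda>y::'a. indicator {norm y..} s :: ennreal) = indicator (cball 0 s)"
          by (auto simp: indicator_def)
        then show ?thesis by (simp only:, intro borel_measurable_indicator borel_closed closed_cball)
      qed
      note [measurable] = meas
      have "(\<integral>\<^sup>+y. ennreal (1 / s ^ Suc ?n) * indicator {norm y..} s * indicator {0<..} s *
        (ennreal (norm y ^ ?n) * g y) \<partial>lborel)
        = ennreal (s ^ ?n) * (\<integral>\<^sup>+x. ennreal (1 / s ^ Suc ?n) * indicator {norm (s *\<^sub>R x)..} s * indicator {0<..} s *
        (ennreal (norm (s *\<^sub>R x) ^ ?n) * g (s *\<^sub>R x)) \<partial>(lborel :: 'a measure))"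
        by (rule nn_integral_scaleR_lborel[OF _ True]) measurable
      also have "\<dots> = (\<integral>\<^sup>+x. ennreal (s ^ ?n) * (ennreal (1 / s ^ Suc ?n) * indicator {norm (s *\<^sub>R x)..} s * indicator {0<..} s *
        (ennreal (norm (s *\<^sub>R x) ^ ?n) * g (s *\<^sub>R x))) \<partial>(lborel :: 'a measure))"
        by (rule nn_integral_cmult[symmetric]) (use measurable_compose[OF _ meas] in measurable)
      also have "\<dots> = (\<integral>\<^sup>+x. ennreal (norm x ^ ?n) * indicator {0<..} s * ennreal (s ^ (?n - 1)) *
        (indicator (cball 0 1) x * g (s *\<^sub>R x)) \<partial>lborel)"
      proof (rule nn_integral_cong)
        fix x :: 'a
        have ind: "indicator {norm (s *\<^sub>R x)..} s = (indicator (cball 0 1) x :: ennreal)"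
          using True by (auto simp: indicator_def)
        have "ennreal (s ^ ?n) * ennreal (1 / s ^ Suc ?n) * ennreal (norm (s *\<^sub>R x) ^ ?n)
          = ennreal (norm x ^ ?n) * ennreal (s ^ (?n - 1))"
          using True n by (cases ?n) (simp_all add: ennreal_mult[symmetric] power_mult_distrib divide_simps)
        then have "(ennreal (s ^ ?n) * ennreal (1 / s ^ Suc ?n) * ennreal (norm (s *\<^sub>R x) ^ ?n)) * (indicator (cball 0 1) x * g (s *\<^sub>R x))
          = (ennreal (norm x ^ ?n) * ennreal (s ^ (?n - 1))) * (indicator (cball 0 1) x * g (s *\<^sub>R x))"
          by (rule arg_cong)
        then show "ennreal (s ^ ?n) * (ennreal (1 / s ^ Suc ?n) * indicator {norm (s *\<^sub>R x)..} s * indicator {0<..} s *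
          (ennreal (norm (s *\<^sub>R x) ^ ?n) * g (s *\<^sub>R x)))
          = ennreal (norm x ^ ?n) * indicator {0<..} s * ennreal (s ^ (?n - 1)) *
          (indicator (cball 0 1) x * g (s *\<^sub>R x))"
          unfolding ind using True by (simp add: ac_simps)
      qed
      finally show ?thesis by (rule sym)
    qed simp
  qed
  also have "\<dots> = (\<integral>\<^sup>+y. \<integral>\<^sup>+s. ennreal (1 / s ^ Suc ?n) * indicator {norm y..} s * indicator {0<..} s *
        (ennreal (norm y ^ ?n) * g y) \<partial>lborel \<partial>lborel)"
  proof (rule lborel_pair.Fubini')
    have "(\<lambda>z. indicator {z. norm (fst z) \<le> snd z} z :: ennreal) \<in> borel_measurable ((lborel :: 'a measure) \<Otimes>\<^sub>M lborel)"
      by measurable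
    then have [measurable]: "(\<lambda>z. indicator {norm (fst z)..} (snd z) :: ennreal) \<in> borel_measurable ((lborel :: 'a measure) \<Otimes>\<^sub>M lborel)"
      by (simp add: indicator_def)
    show "(\<lambda>(y, s). ennreal (1 / s ^ Suc ?n) * indicator {norm y..} s * indicator {0<..} s *
        (ennreal (norm y ^ ?n) * g y)) \<in> borel_measurable ((lborel :: 'a measure) \<Otimes>\<^sub>M lborel)"
      unfolding split_def by measurable
  qed
  \<comment> \<open>Integrating \<open>1 / s ^ (n + 1)\<close> over \<open>s \<ge> norm y\<close>
    gives \<open>1 / (n * norm y ^ n)\<close>. The power of \<open>norm y\<close> cancels, and
    \<open>1 / n\<close> accounts for the dimension factor in the statement.\<close>
  also have "\<dots> = (\<integral>\<^sup>+y. ennreal (1 / ?n) * g y \<partial>lborel)"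
    using nonzero
  proof (intro nn_integral_cong_AE, eventually_elim)
    fix y :: 'a assume y: "y \<noteq> 0"
    have "(\<integral>\<^sup>+s. ennreal (1 / s ^ Suc ?n) * indicator {norm y..} s * indicator {0<..} s *
        (ennreal (norm y ^ ?n) * g y) \<partial>lborel)
      = (\<integral>\<^sup>+s. (ennreal (1 / s ^ Suc ?n) * indicator {norm y..} s) * (ennreal (norm y ^ ?n) * g y) \<partial>lborel)"
    proof (rule nn_integral_cong)
      fix s :: real
      have "s > 0" if "norm y \<le> s" using that y by (meson order_less_le_trans zero_less_norm_iff)
      then show "ennreal (1 / s ^ Suc ?n) * indicator {norm y..} s * indicator {0<..} s *
        (ennreal (norm y ^ ?n) * g y) = (ennreal (1 / s ^ Suc ?n) * indicator {norm y..} s) * (ennreal (norm y ^ ?n) * g y)"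
        by (auto simp: indicator_def)
    qed
    also have "\<dots> = (\<integral>\<^sup>+s. ennreal (1 / s ^ Suc ?n) * indicator {norm y..} s \<partial>lborel) * (ennreal (norm y ^ ?n) * g y)"
      by (rule nn_integral_multc) measurable
    also have "\<dots> = ennreal (1 / (?n * norm y ^ ?n)) * (ennreal (norm y ^ ?n) * g y)"
      using y by (subst nn_integral_inverse_power) auto
    also have "\<dots> = ennreal (1 / ?n) * g y"
    proof -
      have "ennreal (1 / (?n * norm y ^ ?n)) * ennreal (norm y ^ ?n) = ennreal (1 / ?n)"
        using y by (simp add: ennreal_mult[symmetric])
      then show ?thesis by (simp add: mult.assoc[symmetric])
    qed
    finally show "(\<integral>\<^sup>+s. ennreal (1 / s ^ Suc ?n) * indicator {norm y..} s * indicator {0<..} s *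
        (ennreal (norm y ^ ?n) * g y) \<partial>lborel) = ennreal (1 / ?n) * g y" .
  qed
  also have "\<dots> = ennreal (1 / ?n) * (\<integral>\<^sup>+y. g y \<partial>lborel)"
    by (rule nn_integral_cmult) measurable
  finally show ?thesis
    by (simp add: mult.assoc[symmetric] ennreal_of_nat_eq_real_of_nat ennreal_mult[symmetric])
qed

section \<open>Borel sets and Hausdorff measure\<close>

lemma hausdorff_outer_mono: "A \<subseteq> B \<Longrightarrow> hausdorff_outer k A \<le> hausdorff_outer k B"
  unfolding hausdorff_outer_def hausdorff_content_def
  by (intro SUP_mono' INF_superset_mono) (auto simp: hausdorff_covers_def)

lemma hausdorff_content_antimono: "\<delta> \<le> \<epsilon> \<Longrightarrow> hausdorff_content k \<epsilon> A \<le> hausdorff_content k \<delta> A"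
  unfolding hausdorff_content_def hausdorff_covers_def
  by (intro INF_superset_mono) (auto intro: order_trans)

lemma hausdorff_content_le_outer: "0 < \<delta> \<Longrightarrow> hausdorff_content k \<delta> A \<le> hausdorff_outer k A"
  unfolding hausdorff_outer_def by (rule SUP_upper) simp

lemma hausdorff_outer_subadditive:
  "hausdorff_outer k (\<Union>n. A n) \<le> (\<Sum>n. hausdorff_outer k (A n))"
  unfolding hausdorff_outer_def[of k "\<Union>n. A n"]
proof (rule SUP_least)
  fix \<delta> :: real assume \<delta>: "\<delta> \<in> {0<..}"
  have "hausdorff_content k \<delta> (\<Union>n. A n) \<le> (\<Sum>n. hausdorff_content k \<delta> (A n))"
    by (rule hausdorff_content_countably_subadditive)
  also have "\<dots> \<le> (\<Sum>n. hausdorff_outer k (A n))"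
    using \<delta> by (intro suminf_le hausdorff_content_le_outer) auto
  finally show "hausdorff_content k \<delta> (\<Union>n. A n) \<le> (\<Sum>n. hausdorff_outer k (A n))" .
qed

lemma hausdorff_outer_empty [simp]: "hausdorff_outer k ({} :: 'a::metric_space set) = 0"
  using outer_measure_space_hausdorff[of k, where 'a = 'a] by (simp add: outer_measure_space_def positive_def)

lemma hausdorff_outer_Un_le: "hausdorff_outer k (A \<union> B) \<le> hausdorff_outer k A + hausdorff_outer k B"
proof -
  let ?C = "\<lambda>n::nat. if n = 0 then A else if n = 1 then B else {}"
  have "A \<union> B = (\<Union>n. ?C n)"
    by (auto intro: exI[of _ 0] exI[of _ 1] split: if_splits)
  moreover have "(\<Sum>n. hausdorff_outer k (?C n)) = (\<Sum>n\<in>{0,1}. hausdorff_outer k (?C n))"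
    by (rule suminf_finite) auto
  ultimately show ?thesis
    using hausdorff_outer_subadditive[of k ?C] by simp
qed

text \<open>A lower bound is used instead of \<open>setdist\<close>, which is 0 for an empty set,
  whereas here an empty set is separated from every set.\<close>

definition separated_sets :: "'a::metric_space set \<Rightarrow> 'a set \<Rightarrow> bool" where
  "separated_sets A B \<longleftrightarrow> (\<exists>d>0. \<forall>a\<in>A. \<forall>b\<in>B. d \<le> dist a b)"

text \<open>At scales below the distance of \<open>A\<close> and \<open>B\<close> no covering set
  meets both, so a cover of the union splits into a cover of \<open>A\<close> and one of
  \<open>B\<close>. The omitted members are replaced by empty sets, whose gauge is 0.\<close>

lemma hausdorff_outer_separated:
  assumes "separated_sets A B"
  shows "hausdorff_outer k A + hausdorff_outer k B \<le> hausdorff_outer k (A \<union> B)"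
proof -
  obtain d where d: "d > 0" "\<And>a b. a \<in> A \<Longrightarrow> b \<in> B \<Longrightarrow> d \<le> dist a b"
    using assms by (auto simp: separated_sets_def)
  have content: "hausdorff_content k \<delta> A + hausdorff_content k \<delta> B \<le> hausdorff_content k \<delta> (A \<union> B)"
    if \<delta>: "0 < \<delta>" "\<delta> < d" for \<delta>
    unfolding hausdorff_content_def[of _ _ "A \<union> B"]
  proof (rule INF_greatest)
    fix U assume U: "U \<in> hausdorff_covers \<delta> (A \<union> B)"
    define V where "V i = (if U i \<inter> A = {} then {} else U i)" for i
    define W where "W i = (if U i \<inter> A = {} then U i else {})" for i
    have disj: "U i \<inter> B = {}" if "U i \<inter> A \<noteq> {}" for i
    proof (rule ccontr)
      assume "U i \<inter> B \<noteq> {}"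
      then obtain a b where ab: "a \<in> A" "b \<in> B" "a \<in> U i" "b \<in> U i" using \<open>U i \<inter> A \<noteq> {}\<close> by blast
      have "bounded (U i)" "diameter (U i) \<le> \<delta>" using U by (auto simp: hausdorff_covers_def)
      then have "dist a b \<le> \<delta>" using ab diameter_bounded_bound by fastforce
      then show False using d(2)[OF ab(1,2)] \<delta> by simp
    qed
    have AU: "A \<subseteq> (\<Union>i. U i)" and BU: "B \<subseteq> (\<Union>i. U i)"
      using U by (auto simp: hausdorff_covers_def)
    have "A \<subseteq> (\<Union>i. V i)"
    proof
      fix a assume "a \<in> A"
      then obtain i where "a \<in> U i" using AU by blast
      then have "a \<in> V i" using \<open>a \<in> A\<close> by (auto simp: V_def)
      then show "a \<in> (\<Union>i. V i)" by blast
    qed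
    then have V: "V \<in> hausdorff_covers \<delta> A"
      using U \<delta> by (auto simp: hausdorff_covers_def V_def)
    have "B \<subseteq> (\<Union>i. W i)"
    proof
      fix b assume "b \<in> B"
      then obtain i where "b \<in> U i" using BU by blast
      then have "b \<in> W i" using \<open>b \<in> B\<close> disj[of i] by (auto simp: W_def)
      then show "b \<in> (\<Union>i. W i)" by blast
    qed
    then have W: "W \<in> hausdorff_covers \<delta> B"
      using U \<delta> by (auto simp: hausdorff_covers_def W_def)
    have "hausdorff_content k \<delta> A + hausdorff_content k \<delta> B
      \<le> (\<Sum>i. hausdorff_gauge k (V i)) + (\<Sum>i. hausdorff_gauge k (W i))"
      unfolding hausdorff_content_def by (intro add_mono INF_lower V W)
    also have "\<dots> = (\<Sum>i. hausdorff_gauge k (V i) + hausdorff_gauge k (W i))"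
      by (rule suminf_add) auto
    also have "\<dots> = (\<Sum>i. hausdorff_gauge k (U i))"
      by (intro suminf_cong) (auto simp: V_def W_def hausdorff_gauge_def)
    finally show "hausdorff_content k \<delta> A + hausdorff_content k \<delta> B \<le> (\<Sum>i. hausdorff_gauge k (U i))" .
  qed
  \<comment> \<open>The two outer measures are separate suprema, so their scales must be
    independent; both contents can only grow on passing to a common smaller scale.\<close>
  have bound: "hausdorff_content k \<delta> A + hausdorff_content k \<epsilon> B \<le> hausdorff_outer k (A \<union> B)"
    if "\<delta> > 0" "\<epsilon> > 0" for \<delta> \<epsilon>
  proof -
    define \<zeta> where "\<zeta> = min (min \<delta> \<epsilon>) (d / 2)"
    have \<zeta>: "0 < \<zeta>" "\<zeta> < d" "\<zeta> \<le> \<delta>" "\<zeta> \<le> \<epsilon>" using that d by (auto simp: \<zeta>_def)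
    have "hausdorff_content k \<delta> A + hausdorff_content k \<epsilon> B \<le> hausdorff_content k \<zeta> A + hausdorff_content k \<zeta> B"
      using \<zeta> by (intro add_mono hausdorff_content_antimono)
    also have "\<dots> \<le> hausdorff_content k \<zeta> (A \<union> B)" by (rule content[OF \<zeta>(1,2)])
    also have "\<dots> \<le> hausdorff_outer k (A \<union> B)" by (rule hausdorff_content_le_outer[OF \<zeta>(1)])
    finally show ?thesis .
  qed
  have ne: "{0::real<..} \<noteq> {}" by (metis greaterThan_iff empty_iff zero_less_one)
  have "hausdorff_content k \<delta> A + hausdorff_outer k B \<le> hausdorff_outer k (A \<union> B)" if "\<delta> > 0" for \<delta>
    unfolding hausdorff_outer_def[of k B] using bound[OF that]
    by (subst ennreal_SUP_add_right[OF ne]) (auto intro!: SUP_least)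
  then show ?thesis
    unfolding hausdorff_outer_def[of k A]
    by (subst ennreal_SUP_add_left[OF ne, symmetric]) (auto intro!: SUP_least)
qed

lemma hausdorff_outer_sum_separated:
  assumes "\<And>j::nat. separated_sets (\<Union>i<j. A i) (A j)"
  shows "(\<Sum>i<j. hausdorff_outer k (A i)) \<le> hausdorff_outer k (\<Union>i<j. A i)"
proof (induction j)
  case (Suc j)
  have "(\<Sum>i<Suc j. hausdorff_outer k (A i)) \<le> hausdorff_outer k (\<Union>i<j. A i) + hausdorff_outer k (A j)"
    using Suc by (simp add: add_right_mono)
  also have "\<dots> \<le> hausdorff_outer k ((\<Union>i<j. A i) \<union> A j)"
    by (rule hausdorff_outer_separated[OF assms])
  also have "(\<Union>i<j. A i) \<union> A j = (\<Union>i<Suc j. A i)"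
    by (auto simp: less_Suc_eq)
  finally show ?case .
qed simp

lemma separated_sets_infdist:
  assumes "\<And>a. a \<in> A \<Longrightarrow> s \<le> infdist a F" "\<And>b. b \<in> B \<Longrightarrow> infdist b F \<le> t" "t < s"
  shows "separated_sets A B"
  unfolding separated_sets_def
proof (intro exI conjI ballI)
  show "0 < s - t" using assms by simp
  fix a b assume "a \<in> A" "b \<in> B"
  then show "s - t \<le> dist a b"
    using assms(1)[of a] assms(2)[of b] infdist_triangle[of a F b] by linarith
qed

text \<open>The Caratheodory criterion: the part of \<open>X\<close> close to the closed set \<open>F\<close> is cut into
  shells, and the shells with indices of the same parity are separated from each other.\<close>

lemma closed_in_sets_hausdorff_measure:
  fixes F :: "'a::metric_space set"
  assumes F: "closed F"
  shows "F \<in> sets (hausdorff_measure k)"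
proof (cases "F = {}")
  case False
  have "hausdorff_outer k (F \<inter> X) + hausdorff_outer k (X - F) \<le> hausdorff_outer k X" for X
  proof (rule ennreal_le_epsilon)
    fix e :: real assume e: "e > 0" and fin: "hausdorff_outer k X < top"
    \<comment> \<open>Consecutive shells leave no gap, so those of index at least \<open>j\<close>
      together with \<open>X' j\<close> exhaust \<open>X - F\<close>. Between shells of the same
      parity the distance to \<open>F\<close> jumps over a whole shell.\<close>
    define R where "R j = {x \<in> X. 1 / (j + 2) < infdist x F \<and> infdist x F \<le> 1 / (real j + 1)}" for j :: nat
    define X' where "X' j = {x \<in> X. 1 / (real j + 1) < infdist x F}" for j :: nat
    have sum_le: "(\<Sum>i<j. hausdorff_outer k (R (2 * i + p))) \<le> hausdorff_outer k X" for p j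
    proof -
      have "(\<Sum>i<j. hausdorff_outer k (R (2 * i + p))) \<le> hausdorff_outer k (\<Union>i<j. R (2 * i + p))"
      proof (rule hausdorff_outer_sum_separated)
        fix j
        show "separated_sets (\<Union>i<j. R (2 * i + p)) (R (2 * j + p))"
        proof (rule separated_sets_infdist)
          fix a assume "a \<in> (\<Union>i<j. R (2 * i + p))"
          then obtain i where i: "i < j" "a \<in> R (2 * i + p)" by blast
          then have "1 / (real (2 * j + p)) \<le> 1 / (real (2 * i + p) + 2)"
            by (intro divide_left_mono) auto
          also have "\<dots> \<le> infdist a F" using i(2) by (simp add: R_def ac_simps)
          \<comment> \<open>For \<open>j = 0\<close> the union is empty, but
            \<open>1 / (2 * j + p)\<close> may be \<open>1 / 0 = 0\<close>. Any number above
            \<open>1 / (p + 1)\<close> serves then, here 3.\<close>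
          finally show "(if j = 0 then 3 else 1 / (real (2 * j + p))) \<le> infdist a F" using i by simp
        next
          fix b assume "b \<in> R (2 * j + p)"
          then show "infdist b F \<le> 1 / (real (2 * j + p) + 1)" by (simp add: R_def)
        next
          have "1 / (real (2 * j + p) + 1) < 1 / real (2 * j + p)" if "j \<noteq> 0"
            using that by (intro divide_strict_left_mono) auto
          then show "1 / (real (2 * j + p) + 1) < (if j = 0 then 3 else 1 / (real (2 * j + p)))"
            by (auto simp: divide_simps)
        qed
      qed
      also have "\<dots> \<le> hausdorff_outer k X"
        by (rule hausdorff_outer_mono) (auto simp: R_def)
      finally show ?thesis .
    qed
    have sum_all: "(\<Sum>i<2 * j. hausdorff_outer k (R i)) \<le> hausdorff_outer k X + hausdorff_outer k X" for j
    proof -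
      have "(\<Sum>i<2 * j. hausdorff_outer k (R i))
        = (\<Sum>i<j. hausdorff_outer k (R (2 * i + 0))) + (\<Sum>i<j. hausdorff_outer k (R (2 * i + 1)))"
        by (induction j) (simp_all add: ac_simps)
      then show ?thesis using sum_le[of 0 j] sum_le[of 1 j] by (simp add: add_mono)
    qed
    have "(\<Sum>i<j. hausdorff_outer k (R i)) \<le> hausdorff_outer k X + hausdorff_outer k X" for j
    proof -
      have "(\<Sum>i<j. hausdorff_outer k (R i)) \<le> (\<Sum>i<2 * j. hausdorff_outer k (R i))"
        by (rule sum_mono2) auto
      also note sum_all
      finally show ?thesis .
    qed
    then have "(\<Sum>i. hausdorff_outer k (R i)) \<le> hausdorff_outer k X + hausdorff_outer k X"
      by (intro suminf_le_const) auto
    also have "\<dots> < top" using fin by simp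
    finally have fin_sum: "(\<Sum>i. hausdorff_outer k (R i)) < top" .
    \<comment> \<open>The series over the shells converges, so the shells close to \<open>F\<close>
      contribute at most \<open>e\<close>.\<close>
    have tail: "\<exists>j. (\<Sum>i. hausdorff_outer k (R (i + j))) \<le> ennreal e"
    proof -
      define b where "b i = enn2real (hausdorff_outer k (R i))" for i
      have b: "hausdorff_outer k (R i) = ennreal (b i)" "0 \<le> b i" for i
        using ennreal_suminf_lessD[OF fin_sum, of i] by (auto simp: b_def less_top)
      have "summable b"
        using fin_sum b by (intro summable_suminf_not_top) (auto simp: less_top)
      then obtain j where "norm (\<Sum>i. b (i + j)) < e"
        using suminf_exist_split[OF e] by blast
      moreover have "(\<Sum>i. hausdorff_outer k (R (i + j))) = ennreal (\<Sum>i. b (i + j))"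
        using \<open>summable b\<close> b by (simp add: suminf_ennreal2 summable_iff_shift)
      ultimately show ?thesis by (auto intro!: exI[of _ j] ennreal_leI)
    qed
    then obtain j where j: "(\<Sum>i. hausdorff_outer k (R (i + j))) \<le> ennreal e" by blast
    have cover: "X - F \<subseteq> X' j \<union> (\<Union>i. R (i + j))"
    proof
      fix x assume x: "x \<in> X - F"
      then have pos: "infdist x F > 0"
        using F False by (metis DiffD2 in_closed_iff_infdist_zero infdist_nonneg less_le)
      show "x \<in> X' j \<union> (\<Union>i. R (i + j))"
      proof (cases "1 / (real j + 1) < infdist x F")
        case True
        then show ?thesis using x by (simp add: X'_def)
      next
        case False
        define m where "m = (LEAST m. 1 / (real m + 2) < infdist x F)"
        obtain N where "1 / real (Suc N) < infdist x F" using nat_approx_posE[OF pos] .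
        moreover have "1 / (real N + 2) \<le> 1 / real (Suc N)" by (simp add: frac_le)
        ultimately have "1 / (real N + 2) < infdist x F" by linarith
        then have m: "1 / (real m + 2) < infdist x F" unfolding m_def by (rule LeastI)
        have "j \<le> m"
        proof (rule ccontr)
          assume "\<not> j \<le> m"
          then have "1 / (real j + 1) \<le> 1 / (real m + 2)" by (intro divide_left_mono) auto
          then show False using False m by simp
        qed
        have "infdist x F \<le> 1 / (real m + 1)"
        proof (cases "m = j")
          case True
          then show ?thesis using False by simp
        next
          case False
          then obtain m' where m': "m = Suc m'" using \<open>j \<le> m\<close> by (cases m) auto
          then have "\<not> 1 / (real m' + 2) < infdist x F"
            using not_less_Least[of m' "\<lambda>m. 1 / (real m + 2) < infdist x F"] by (simp add: m_def)
          then show ?thesis by (simp add: m' ac_simps)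
        qed
        then have "x \<in> R (m - j + j)" using m x \<open>j \<le> m\<close> by (simp add: R_def add.commute)
        then show ?thesis by blast
      qed
    qed
    have "separated_sets (X' j) (F \<inter> X)"
    proof (rule separated_sets_infdist)
      show "1 / (real j + 1) \<le> infdist a F" if "a \<in> X' j" for a using that by (simp add: X'_def)
      show "infdist b F \<le> 0" if "b \<in> F \<inter> X" for b using that by simp
    qed simp
    then have sep: "hausdorff_outer k (X' j) + hausdorff_outer k (F \<inter> X) \<le> hausdorff_outer k (X' j \<union> F \<inter> X)"
      by (rule hausdorff_outer_separated)
    have "hausdorff_outer k (X - F) \<le> hausdorff_outer k (X' j) + (\<Sum>i. hausdorff_outer k (R (i + j)))"
      using hausdorff_outer_mono[OF cover, of k] hausdorff_outer_Un_le[of k "X' j" "\<Union>i. R (i + j)"]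
        hausdorff_outer_subadditive[of k "\<lambda>i. R (i + j)"]
      by (meson add_left_mono order_trans)
    then have "hausdorff_outer k (F \<inter> X) + hausdorff_outer k (X - F)
      \<le> (hausdorff_outer k (X' j) + hausdorff_outer k (F \<inter> X)) + ennreal e"
    proof -
      assume *: "hausdorff_outer k (X - F) \<le> hausdorff_outer k (X' j) + (\<Sum>i. hausdorff_outer k (R (i + j)))"
      have "hausdorff_outer k (F \<inter> X) + hausdorff_outer k (X - F)
        \<le> hausdorff_outer k (F \<inter> X) + (hausdorff_outer k (X' j) + ennreal e)"
        using * j by (meson add_left_mono order_trans)
      also have "\<dots> = (hausdorff_outer k (X' j) + hausdorff_outer k (F \<inter> X)) + ennreal e"
        by (simp only: ac_simps)
      finally show ?thesis .
    qed
    also have "\<dots> \<le> hausdorff_outer k X + ennreal e"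
    proof (rule add_right_mono)
      have "X' j \<union> F \<inter> X \<subseteq> X" by (auto simp: X'_def)
      then show "hausdorff_outer k (X' j) + hausdorff_outer k (F \<inter> X) \<le> hausdorff_outer k X"
        using sep hausdorff_outer_mono order_trans by blast
    qed
    finally show "hausdorff_outer k (F \<inter> X) + hausdorff_outer k (X - F) \<le> hausdorff_outer k X + ennreal e" .
  qed
  moreover have "hausdorff_outer k X \<le> hausdorff_outer k (F \<inter> X) + hausdorff_outer k (X - F)" for X
  proof -
    have "F \<inter> X \<union> (X - F) = X" by blast
    then show ?thesis using hausdorff_outer_Un_le[of k "F \<inter> X" "X - F"] by simp
  qed
  moreover have "(UNIV - F) \<inter> X = X - F" for X by auto
  ultimately show ?thesis
    by (auto simp: sets_hausdorff_measure lambda_system_def intro: antisym)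
qed simp

lemma sets_borel_subset_hausdorff_measure:
  "sets borel \<subseteq> sets (hausdorff_measure k :: 'a::metric_space measure)"
proof -
  have "space (hausdorff_measure k :: 'a measure) = UNIV"
    by (simp add: hausdorff_measure_def space_measure_of_conv)
  then have "sigma_sets UNIV (Collect closed) \<subseteq> sets (hausdorff_measure k :: 'a measure)"
    using sets.sigma_sets_subset[of "Collect closed" "hausdorff_measure k :: 'a measure"]
      closed_in_sets_hausdorff_measure by auto
  then show ?thesis by (simp add: borel_eq_closed)
qed

section \<open>Hausdorff measure on spheres\<close>

text \<open>The cone lies within \<open>\<epsilon>\<close> of the segment from 0 to
  \<open>w\<close>, and each point of that segment is within \<open>\<epsilon>\<close> of one of the
  centres; hence the radius \<open>2 * \<epsilon>\<close>.\<close>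

lemma cone_subset_balls:
  fixes w :: "'a::euclidean_space"
  assumes \<epsilon>: "0 < \<epsilon>" and w: "norm w = 1"
    and U: "\<And>x. x \<in> C \<Longrightarrow> x \<noteq> 0 \<and> norm x \<le> 1 \<and> dist (sgn x) w \<le> \<epsilon>"
  shows "C \<subseteq> (\<Union>k\<le>nat \<lfloor>1 / \<epsilon>\<rfloor>. cball ((real k * \<epsilon>) *\<^sub>R w) (2 * \<epsilon>))"
proof
  fix x assume x: "x \<in> C"
  define k where "k = nat \<lfloor>norm x / \<epsilon>\<rfloor>"
  have "norm x / \<epsilon> \<le> 1 / \<epsilon>" using \<epsilon> U[OF x] by (simp add: divide_right_mono)
  then have k: "k \<le> nat \<lfloor>1 / \<epsilon>\<rfloor>" unfolding k_def by (intro nat_mono floor_mono)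
  have "real k \<le> norm x / \<epsilon>" "norm x / \<epsilon> \<le> real k + 1"
    using \<epsilon> unfolding k_def by (simp_all add: of_nat_floor)
  then have "real k * \<epsilon> \<le> norm x" "norm x \<le> real k * \<epsilon> + \<epsilon>"
    using \<epsilon> by (simp_all add: field_simps)
  then have 1: "norm ((norm x - real k * \<epsilon>) *\<^sub>R w) \<le> \<epsilon>"
    using w by simp
  have "norm x *\<^sub>R sgn x = x" using U[OF x] by (simp add: sgn_div_norm)
  then have "norm (x - norm x *\<^sub>R w) = norm x * norm (sgn x - w)"
    by (metis norm_scaleR abs_norm_cancel scaleR_diff_right)
  also have "\<dots> \<le> 1 * \<epsilon>"
    using U[OF x] \<epsilon> by (intro mult_mono) (auto simp: dist_norm)
  finally have 2: "norm (x - norm x *\<^sub>R w) \<le> \<epsilon>" by simp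
  have eq: "x - (real k * \<epsilon>) *\<^sub>R w = (x - norm x *\<^sub>R w) + (norm x - real k * \<epsilon>) *\<^sub>R w"
    by (simp add: scaleR_diff_left)
  have "norm (x - (real k * \<epsilon>) *\<^sub>R w) \<le> 2 * \<epsilon>"
    unfolding eq using 1 2 norm_triangle_ineq[of "x - norm x *\<^sub>R w" "(norm x - real k * \<epsilon>) *\<^sub>R w"]
    by linarith
  then show "x \<in> (\<Union>k\<le>nat \<lfloor>1 / \<epsilon>\<rfloor>. cball ((real k * \<epsilon>) *\<^sub>R w) (2 * \<epsilon>))"
    using k by (auto simp: dist_norm norm_minus_commute)
qed

text \<open>In the unit ball, the cone over a set of diameter \<open>d \<le> r\<close> in a sphere of radius \<open>r\<close> is covered by
  \<open>2 * r / d\<close> balls of radius \<open>2 * d / r\<close>; the constant compares their volume with the Hausdorff gauge.\<close>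

definition cone_constant :: "'a::euclidean_space itself \<Rightarrow> real \<Rightarrow> real" where
  "cone_constant _ r = unit_ball_vol (real (DIM('a) - 1)) * (r / 2) ^ (DIM('a) - 1) /
     (2 * 2 ^ DIM('a) * unit_ball_vol (real DIM('a)))"

lemma cone_constant_pos: "r > 0 \<Longrightarrow> cone_constant TYPE('a::euclidean_space) r > 0"
  by (simp add: cone_constant_def)

text \<open>With \<open>\<epsilon> = diameter U / r\<close>, about \<open>1 / \<epsilon>\<close>
  balls of volume proportional to \<open>\<epsilon> ^ n\<close> give the order \<open>n - 1\<close>
  of the gauge. The bound on the diameter means \<open>\<epsilon> \<le> 1\<close> and absorbs the
  additional ball at the origin: \<open>1 / \<epsilon> + 1 \<le> 2 / \<epsilon>\<close>.\<close>

lemma cone_cover: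
  fixes y :: "'a::euclidean_space"
  assumes r: "r > 0" and n: "DIM('a) \<ge> 2" and U: "bounded U" "diameter U \<le> r"
  shows "\<exists>V\<in>sets borel. {x \<in> cball 0 1. x \<noteq> 0 \<and> y + r *\<^sub>R sgn x \<in> U} \<subseteq> V \<and>
    ennreal (cone_constant TYPE('a) r) * emeasure lborel V \<le> hausdorff_gauge (DIM('a) - 1) U"
proof -
  let ?n = "DIM('a)"
  define C where "C = {x \<in> cball 0 1. x \<noteq> 0 \<and> y + r *\<^sub>R sgn x \<in> U}"
  show ?thesis
  proof (cases "C = {}")
    case True
    then show ?thesis unfolding C_def by (intro bexI[of _ "{}"]) auto
  next
    case False
    then obtain z where z: "z \<in> C" by blast
    define w where "w = sgn z"
    have w: "norm w = 1" "y + r *\<^sub>R w \<in> U" using z by (auto simp: w_def C_def norm_sgn)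
    have C: "x \<noteq> 0 \<and> norm x \<le> 1 \<and> dist (sgn x) w \<le> diameter U / r" if x: "x \<in> C" for x
    proof -
      have "dist (y + r *\<^sub>R sgn x) (y + r *\<^sub>R w) \<le> diameter U"
        using x w U by (intro diameter_bounded_bound) (auto simp: C_def)
      moreover have "dist (y + r *\<^sub>R sgn x) (y + r *\<^sub>R w) = r * dist (sgn x) w"
        using r by (simp add: dist_norm scaleR_diff_right[symmetric])
      ultimately show ?thesis using x r by (auto simp: C_def field_simps)
    qed
    have Une: "U \<noteq> {}" using w by blast
    show ?thesis
    proof (cases "diameter U = 0")
      \<comment> \<open>The gauge of \<open>U\<close> is 0, so the cone has to be null. It lies on a
        line, which is a null set in dimension at least 2.\<close>
      case True
      have "C \<subseteq> span {w}"
      proof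
        fix x assume "x \<in> C"
        then have "sgn x = w" using C[of x] True by simp
        then have "x = norm x *\<^sub>R w" using C[OF \<open>x \<in> C\<close>] by (auto simp: sgn_div_norm)
        then show "x \<in> span {w}" by (metis span_base span_scale singletonI)
      qed
      moreover have "dim (span {w}) < ?n"
        using dim_le_card'[of "{w}"] n by (simp add: dim_span)
      then have "negligible (span {w})" by (rule negligible_lowdim)
      then have "emeasure lborel (span {w}) = 0"
        by (simp add: negligible_iff_null_sets null_sets_def closed_span borel_closed)
      ultimately show ?thesis
        unfolding C_def[symmetric] by (intro bexI[of _ "span {w}"]) (auto simp: closed_span)
    next
      case False
      define \<epsilon> where "\<epsilon> = diameter U / r"
      have "diameter U > 0" using False diameter_ge_0[OF U(1)] by simp
      then have \<epsilon>: "0 < \<epsilon>" "\<epsilon> \<le> 1" using r U by (auto simp: \<epsilon>_def)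
      define V where "V = (\<Union>k\<le>nat \<lfloor>1 / \<epsilon>\<rfloor>. cball ((real k * \<epsilon>) *\<^sub>R w) (2 * \<epsilon>))"
      have "C \<subseteq> V"
        unfolding V_def by (rule cone_subset_balls[OF \<epsilon>(1) w(1)]) (use C in \<open>simp add: \<epsilon>_def\<close>)
      moreover have V: "V \<in> sets borel" unfolding V_def by (intro borel_closed closed_UN) auto
      moreover have "ennreal (cone_constant TYPE('a) r) * emeasure lborel V \<le> hausdorff_gauge (?n - 1) U"
      proof -
        have "emeasure lborel V \<le> (\<Sum>k\<le>nat \<lfloor>1 / \<epsilon>\<rfloor>. emeasure lborel (cball ((real k * \<epsilon>) *\<^sub>R w) (2 * \<epsilon>)))"
          unfolding V_def by (rule emeasure_subadditive_finite) auto
        also have "\<dots> = ennreal ((real (nat \<lfloor>1 / \<epsilon>\<rfloor>) + 1) * (unit_ball_vol ?n * (2 * \<epsilon>) ^ ?n))"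
          using \<epsilon> by (simp add: emeasure_cball ennreal_of_nat_eq_real_of_nat ennreal_mult ennreal_plus[symmetric]
              ac_simps del: ennreal_plus)
        also have "\<dots> \<le> ennreal (2 / \<epsilon> * (unit_ball_vol ?n * (2 * \<epsilon>) ^ ?n))"
        proof (intro ennreal_leI mult_right_mono)
          have "real (nat \<lfloor>1 / \<epsilon>\<rfloor>) \<le> 1 / \<epsilon>" using \<epsilon> by (simp add: of_nat_floor)
          moreover have "1 \<le> 1 / \<epsilon>" using \<epsilon> by simp
          ultimately show "real (nat \<lfloor>1 / \<epsilon>\<rfloor>) + 1 \<le> 2 / \<epsilon>" by simp
        qed (use \<epsilon> in auto)
        finally have "ennreal (cone_constant TYPE('a) r) * emeasure lborel V
            \<le> ennreal (cone_constant TYPE('a) r) * ennreal (2 / \<epsilon> * (unit_ball_vol ?n * (2 * \<epsilon>) ^ ?n))"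
          by (rule mult_left_mono) simp
        also have "\<dots> = ennreal (unit_ball_vol (?n - 1) * (diameter U / 2) ^ (?n - 1))"
        proof -
          obtain m where m: "?n = Suc m" using n by (cases ?n) auto
          have "diameter U = \<epsilon> * r" using r by (simp add: \<epsilon>_def)
          moreover have "unit_ball_vol (1 + real m) \<noteq> 0"
            using unit_ball_vol_pos[of "1 + real m"] by linarith
          ultimately have "cone_constant TYPE('a) r * (2 / \<epsilon> * (unit_ball_vol ?n * (2 * \<epsilon>) ^ ?n))
            = unit_ball_vol (?n - 1) * (diameter U / 2) ^ (?n - 1)"
            using \<epsilon> r by (simp add: cone_constant_def m power_mult_distrib power_divide)
          then show ?thesis
            using \<epsilon> cone_constant_pos[OF r, where 'a = 'a] by (simp add: ennreal_mult[symmetric])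
        qed
        finally show ?thesis using Une by (simp add: hausdorff_gauge_def)
      qed
      ultimately show ?thesis unfolding C_def[symmetric] by blast
    qed
  qed
qed

text \<open>The cone bound is summed over a cover. It holds for all diameters up to
  \<open>r\<close>, so the content at the single scale \<open>r\<close> suffices, and this is below
  the outer measure.\<close>

lemma cone_measure_le_hausdorff_outer:
  fixes y :: "'a::euclidean_space"
  assumes r: "r > 0" and n: "DIM('a) \<ge> 2"
  shows "ennreal (cone_constant TYPE('a) r) * emeasure lborel {x \<in> cball 0 1. x \<noteq> 0 \<and> y + r *\<^sub>R sgn x \<in> B}
    \<le> hausdorff_outer (DIM('a) - 1) B"
proof -
  let ?C = "\<lambda>B. {x \<in> cball 0 1. x \<noteq> 0 \<and> y + r *\<^sub>R sgn x \<in> B}"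
  let ?c = "ennreal (cone_constant TYPE('a) r)"
  have "?c * emeasure lborel (?C B) \<le> hausdorff_content (DIM('a) - 1) r B"
    unfolding hausdorff_content_def
  proof (rule INF_greatest)
    fix U assume U: "U \<in> hausdorff_covers r B"
    have "\<forall>i. \<exists>V\<in>sets borel. ?C (U i) \<subseteq> V \<and> ?c * emeasure lborel V \<le> hausdorff_gauge (DIM('a) - 1) (U i)"
      using U by (intro allI cone_cover[OF r n]) (auto simp: hausdorff_covers_def)
    then have "\<forall>i. \<exists>V. V \<in> sets borel \<and> ?C (U i) \<subseteq> V \<and> ?c * emeasure lborel V \<le> hausdorff_gauge (DIM('a) - 1) (U i)"
      by (simp only: Bex_def simp_thms)
    from choice[OF this] obtain V where V': "\<forall>i. V i \<in> sets borel \<and> ?C (U i) \<subseteq> V i \<and>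
      ?c * emeasure lborel (V i) \<le> hausdorff_gauge (DIM('a) - 1) (U i)" ..
    then have V: "\<And>i. V i \<in> sets borel" "\<And>i. ?C (U i) \<subseteq> V i"
      "\<And>i. ?c * emeasure lborel (V i) \<le> hausdorff_gauge (DIM('a) - 1) (U i)"
      by blast+
    have "?C B \<subseteq> (\<Union>i. ?C (U i))" using U by (auto simp: hausdorff_covers_def)
    then have "?C B \<subseteq> (\<Union>i. V i)" using V(2) by blast
    then have "emeasure lborel (?C B) \<le> emeasure lborel (\<Union>i. V i)"
      using V(1) by (intro emeasure_mono) auto
    also have "\<dots> \<le> (\<Sum>i. emeasure lborel (V i))"
      using V(1) by (intro emeasure_subadditive_countably) auto
    finally have "?c * emeasure lborel (?C B) \<le> ?c * (\<Sum>i. emeasure lborel (V i))"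
      by (rule mult_left_mono) simp
    also have "\<dots> = (\<Sum>i. ?c * emeasure lborel (V i))" by (rule ennreal_suminf_cmult[symmetric])
    also have "\<dots> \<le> (\<Sum>i. hausdorff_gauge (DIM('a) - 1) (U i))"
      by (intro suminf_le V(3)) auto
    finally show "?c * emeasure lborel (?C B) \<le> (\<Sum>i. hausdorff_gauge (DIM('a) - 1) (U i))" .
  qed
  also have "\<dots> \<le> hausdorff_outer (DIM('a) - 1) B" by (rule hausdorff_content_le_outer[OF r])
  finally show ?thesis .
qed

lemma space_hausdorff_measure [simp]: "space (hausdorff_measure k) = UNIV"
  by (simp add: hausdorff_measure_def space_measure_of_conv)

text \<open>Lebesgue measure on the punctured unit ball, projected radially to the sphere and scaled
  by the constant, is below Hausdorff measure on every Borel set; the integrals are ordered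
  accordingly.\<close>

lemma nn_integral_cone_le_hausdorff:
  fixes y :: "'a::euclidean_space" and g :: "'a \<Rightarrow> ennreal"
  assumes r: "r > 0" and n: "DIM('a) \<ge> 2" and g [measurable]: "g \<in> borel_measurable borel"
  shows "ennreal (cone_constant TYPE('a) r) * (\<integral>\<^sup>+x. indicator (cball 0 1) x * g (y + r *\<^sub>R sgn x) \<partial>lborel)
    \<le> (\<integral>\<^sup>+z \<in> sphere y r. g z \<partial>hausdorff_measure (DIM('a) - 1))"
proof -
  let ?c = "ennreal (cone_constant TYPE('a) r)"
  let ?H = "hausdorff_measure (DIM('a) - 1) :: 'a measure"
  let ?p = "\<lambda>x::'a. y + r *\<^sub>R sgn x"
  \<comment> \<open>The origin is removed because \<open>sgn 0 = 0\<close> would send it to the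
    centre \<open>y\<close>, off the sphere.\<close>
  define D where "D = cball (0::'a) 1 - {0}"
  have D [measurable]: "D \<in> sets borel"
    unfolding D_def by (intro sets.Diff borel_closed) auto
  have S [measurable]: "sphere y r \<in> sets borel" by (intro borel_closed) auto
  define M where "M = distr (density lborel (indicator D)) borel ?p"
  have id_meas: "id \<in> measurable ?H borel"
    using sets_borel_subset_hausdorff_measure[of "DIM('a) - 1", where 'a = 'a]
    by (auto simp: measurable_def)
  \<comment> \<open>The image under \<open>id\<close> restricts Hausdorff measure to the Borel sets,
    so that both measures live on the same sigma-algebra.\<close>
  define N where "N = distr ?H borel id"
  let ?f = "\<lambda>z. g z * indicator (sphere y r) z"
  have le: "scale_measure ?c M \<le> N"
  proof (subst le_measure)
    show "\<forall>A\<in>sets (scale_measure ?c M). emeasure (scale_measure ?c M) A \<le> emeasure N A"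
    proof
      fix A assume "A \<in> sets (scale_measure ?c M)"
      then have A [measurable]: "A \<in> sets borel" by (simp add: M_def)
      then have AH: "A \<in> sets ?H" using sets_borel_subset_hausdorff_measure by blast
      have "emeasure M A = emeasure (density lborel (indicator D)) (?p -` A)"
        unfolding M_def by (subst emeasure_distr) auto
      also have "\<dots> = (\<integral>\<^sup>+x. indicator D x * indicator (?p -` A) x \<partial>lborel)"
        by (rule emeasure_density) (auto intro!: measurable_sets_borel[OF _ A])
      also have "\<dots> = (\<integral>\<^sup>+x. indicator (D \<inter> ?p -` A) x \<partial>lborel)"
        by (simp add: indicator_inter_arith)
      also have "\<dots> = emeasure lborel (D \<inter> ?p -` A)"
        by (intro nn_integral_indicator) (auto intro!: measurable_sets_borel[OF _ A])
      also have "D \<inter> ?p -` A = {x \<in> cball 0 1. x \<noteq> 0 \<and> y + r *\<^sub>R sgn x \<in> A}"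
        by (auto simp: D_def)
      finally have "?c * emeasure M A \<le> hausdorff_outer (DIM('a) - 1) A"
        using cone_measure_le_hausdorff_outer[OF r n] by simp
      also have "\<dots> = emeasure ?H A" using emeasure_hausdorff_measure[OF AH] by simp
      also have "\<dots> = emeasure N A" unfolding N_def by (subst emeasure_distr[OF id_meas A]) simp
      finally show "emeasure (scale_measure ?c M) A \<le> emeasure N A" by simp
    qed
  qed (simp add: M_def N_def)
  have "(\<integral>\<^sup>+z. ?f z \<partial>M) = (\<integral>\<^sup>+x. indicator D x * ?f (?p x) \<partial>lborel)"
    unfolding M_def by (subst nn_integral_distr, measurable, subst nn_integral_density, measurable)
  also have "\<dots> = (\<integral>\<^sup>+x. indicator (cball 0 1) x * g (?p x) \<partial>lborel)"
    using AE_lborel_singleton[of "0::'a"]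
  proof (intro nn_integral_cong_AE, eventually_elim)
    fix x :: 'a assume "x \<noteq> 0"
    then have "?p x \<in> sphere y r" using r by (simp add: dist_norm norm_sgn)
    then show "indicator D x * ?f (?p x) = indicator (cball 0 1) x * g (?p x)"
      using \<open>x \<noteq> 0\<close> by (simp add: D_def indicator_def)
  qed
  finally have "?c * (\<integral>\<^sup>+x. indicator (cball 0 1) x * g (?p x) \<partial>lborel) = (\<integral>\<^sup>+z. ?f z \<partial>scale_measure ?c M)"
    by (simp add: nn_integral_scale_measure M_def)
  also have "\<dots> \<le> (\<integral>\<^sup>+z. ?f z \<partial>N)"
    by (rule nn_integral_mono_measure[OF _ le]) (simp add: M_def N_def)
  also have "\<dots> = (\<integral>\<^sup>+z \<in> sphere y r. g z \<partial>?H)"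
    unfolding N_def by (subst nn_integral_distr[OF id_meas]) simp_all
  finally show ?thesis .
qed

section \<open>Finite area of the unit sphere\<close>

text \<open>The volume of a shell is bounded linearly in its width. The base 4 makes the induction
  close: \<open>2 * 4 ^ n + 2 * 4 ^ n = 4 ^ Suc n\<close>.\<close>

lemma power_one_plus_le:
  fixes h :: real
  assumes "0 \<le> h" "h \<le> 1"
  shows "(1 + h) ^ n \<le> (1 - h) ^ n + h * 4 ^ n"
proof (induction n)
  case (Suc n)
  have "(1 + h) ^ Suc n \<le> (1 + h) * ((1 - h) ^ n + h * 4 ^ n)"
    using Suc assms by (simp add: mult_left_mono)
  also have "\<dots> = (1 - h) ^ Suc n + h * (2 * (1 - h) ^ n + (1 + h) * 4 ^ n)"
    by (simp add: algebra_simps)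
  also have "\<dots> \<le> (1 - h) ^ Suc n + h * (2 * 4 ^ n + 2 * 4 ^ n)"
  proof (intro add_left_mono mult_left_mono add_mono mult_right_mono)
    have "(1 - h) ^ n \<le> 1" using assms by (simp add: power_le_one)
    also have "1 \<le> (4::real) ^ n" by simp
    finally show "(1 - h) ^ n \<le> 4 ^ n" .
  qed (use assms in auto)
  finally show ?case by simp
qed (use assms in simp)

text \<open>The balls of radius \<open>\<delta> / 2\<close> around a \<open>\<delta>\<close>-separated subset of the unit sphere are disjoint and lie
  in a shell of width \<open>\<delta>\<close>.\<close>

lemma card_separated_subset_sphere:
  fixes T :: "'a::euclidean_space set"
  assumes \<delta>: "0 < \<delta>" "\<delta> \<le> 1" and T: "finite T" "T \<subseteq> sphere 0 1"
    and sep: "\<And>s t. s \<in> T \<Longrightarrow> t \<in> T \<Longrightarrow> s \<noteq> t \<Longrightarrow> \<delta> \<le> dist s t"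
  shows "real (card T) * (\<delta> / 2) ^ (DIM('a) - 1) \<le> 4 ^ DIM('a)"
proof -
  let ?n = "DIM('a)"
  let ?\<Omega> = "unit_ball_vol (real ?n)"
  define h where "h = \<delta> / 2"
  have h: "0 < h" "h \<le> 1" using \<delta> by (auto simp: h_def)
  have disj: "disjoint_family_on (\<lambda>t. ball t h) T"
    unfolding disjoint_family_on_def
  proof (intro ballI impI)
    fix s t assume "s \<in> T" "t \<in> T" "s \<noteq> t"
    from sep[OF this] show "ball s h \<inter> ball t h = {}"
      by (intro disjoint_ballI) (simp add: h_def)
  qed
  have shell: "x \<in> ball 0 (1 + h)" "x \<notin> ball 0 (1 - h)" if "t \<in> T" "x \<in> ball t h" for t x
  proof -
    have "norm t = 1" "dist t x < h" using that T by auto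
    then show "x \<in> ball 0 (1 + h)" "x \<notin> ball 0 (1 - h)"
      using norm_triangle_ineq2[of x t] norm_triangle_ineq2[of t x]
      by (auto simp: dist_norm norm_minus_commute)
  qed
  \<comment> \<open>The inner ball is added to the small balls rather than subtracted from the large
    one, which avoids truncated subtraction.\<close>
  have "(\<Sum>t\<in>T. emeasure lborel (ball t h)) + emeasure lborel (ball (0::'a) (1 - h))
    = emeasure lborel (\<Union>t\<in>T. ball t h) + emeasure lborel (ball (0::'a) (1 - h))"
    by (subst sum_emeasure) (use disj T in auto)
  also have "\<dots> = emeasure lborel ((\<Union>t\<in>T. ball t h) \<union> ball (0::'a) (1 - h))"
    by (rule plus_emeasure) (use shell in \<open>auto intro!: borel_open open_UN\<close>)
  also have "\<dots> \<le> emeasure lborel (ball (0::'a) (1 + h))"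
    by (rule emeasure_mono) (use shell h in auto)
  finally have "ennreal (real (card T) * (?\<Omega> * h ^ ?n) + ?\<Omega> * (1 - h) ^ ?n) \<le> ennreal (?\<Omega> * (1 + h) ^ ?n)"
    using h by (simp add: emeasure_ball ennreal_of_nat_eq_real_of_nat ennreal_mult)
  then have "real (card T) * (?\<Omega> * h ^ ?n) + ?\<Omega> * (1 - h) ^ ?n \<le> ?\<Omega> * (1 + h) ^ ?n"
    using h by (subst (asm) ennreal_le_iff) auto
  then have "?\<Omega> * (real (card T) * h ^ ?n + (1 - h) ^ ?n) \<le> ?\<Omega> * (1 + h) ^ ?n"
    by (simp add: algebra_simps)
  moreover have "?\<Omega> > 0" by simp
  ultimately have "real (card T) * h ^ ?n + (1 - h) ^ ?n \<le> (1 + h) ^ ?n"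
    using mult_le_cancel_left_pos by blast
  also have "\<dots> \<le> (1 - h) ^ ?n + h * 4 ^ ?n" using h by (intro power_one_plus_le) auto
  finally have "real (card T) * h ^ ?n \<le> h * 4 ^ ?n" by simp
  moreover have "h ^ ?n = h * h ^ (?n - 1)" by (metis DIM_positive power_eq_if neq0_conv)
  ultimately have "h * (real (card T) * h ^ (?n - 1)) \<le> h * 4 ^ ?n" by (simp add: ac_simps)
  then show ?thesis using h mult_le_cancel_left_pos unfolding h_def by blast
qed

text \<open>\<open>sphere_mean\<close> divides by this area, and \<open>top / top\<close> is 0 in
  \<open>ennreal\<close>: finiteness ensures that an infinite integral gives an infinite mean. A
  largest \<open>\<delta>\<close>-separated subset is a net whose cardinality is at most a multiple
  of \<open>1 / \<delta> ^ (n - 1)\<close>, so balls around its points cover the sphere with bounded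
  total gauge.\<close>

lemma hausdorff_outer_sphere_finite:
  "hausdorff_outer (DIM('a) - 1) (sphere (0::'a::euclidean_space) 1) < top"
proof -
  let ?n = "DIM('a)"
  define K where "K = unit_ball_vol (real (?n - 1)) * (2 ^ (?n - 1) * 4 ^ ?n)"
  have content: "hausdorff_content (?n - 1) (2 * \<delta>) (sphere (0::'a) 1) \<le> ennreal K"
    if \<delta>: "0 < \<delta>" "\<delta> \<le> 1" for \<delta>
  proof -
    define P where "P T \<longleftrightarrow> finite T \<and> T \<subseteq> sphere (0::'a) 1 \<and>
      (\<forall>s\<in>T. \<forall>t\<in>T. s \<noteq> t \<longrightarrow> \<delta> \<le> dist s t)" for T
    have bound: "real (card T) * (\<delta> / 2) ^ (?n - 1) \<le> 4 ^ ?n" if "P T" for T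
      by (rule card_separated_subset_sphere) (use that \<delta> in \<open>auto simp: P_def\<close>)
    then have "real (card T) \<le> 4 ^ ?n / (\<delta> / 2) ^ (?n - 1)" if "P T" for T
      using \<delta> that by (simp add: pos_le_divide_eq)
    then have "\<forall>T. P T \<longrightarrow> card T \<le> nat \<lfloor>4 ^ ?n / (\<delta> / 2) ^ (?n - 1)\<rfloor>"
      by (auto simp: le_nat_floor)
    moreover have "P {}" by (simp add: P_def)
    \<comment> \<open>Bounded cardinality provides a separated set with the most points; no point
      can be added to it, which makes it a net.\<close>
    ultimately obtain T where T: "P T" "\<And>T'. P T' \<Longrightarrow> card T' \<le> card T"
      using ex_has_greatest_nat[of P "{}" card "Suc (nat \<lfloor>4 ^ ?n / (\<delta> / 2) ^ (?n - 1)\<rfloor>)"] by (metis less_Suc_eq_le)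
    have near: "\<exists>t\<in>T. dist t x < \<delta>" if x: "x \<in> sphere 0 1" for x
    proof (rule ccontr)
      assume far: "\<not> (\<exists>t\<in>T. dist t x < \<delta>)"
      then have "x \<notin> T" using \<delta> by force
      moreover have "P (insert x T)"
        using T(1) x far by (auto simp: P_def not_less dist_commute)
      moreover have "finite T" using T(1) by (simp add: P_def)
      ultimately show False using T(2)[of "insert x T"] by simp
    qed
    obtain h where h: "bij_betw h {0..<card T} T"
      using ex_bij_betw_nat_finite[of T] T(1) by (auto simp: P_def)
    define U where "U i = (if i < card T then cball (h i) \<delta> else {})" for i
    have diam: "diameter (cball z \<delta>) \<le> 2 * \<delta>" for z :: 'a
      using \<delta> by (simp add: diameter_cball)
    have "U \<in> hausdorff_covers (2 * \<delta>) (sphere (0::'a) 1)"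
      unfolding hausdorff_covers_def
    proof (intro CollectI conjI allI subsetI)
      show "bounded (U i)" "diameter (U i) \<le> 2 * \<delta>" for i
        using diam \<delta> by (auto simp: U_def)
      fix x :: 'a assume "x \<in> sphere 0 1"
      then obtain t where t: "t \<in> T" "dist t x < \<delta>" using near by blast
      then have "t \<in> h ` {0..<card T}" using h by (simp add: bij_betw_def)
      then obtain i where "i < card T" "h i = t" by auto
      then have "x \<in> U i" using t by (simp add: U_def)
      then show "x \<in> (\<Union>i. U i)" by blast
    qed
    then have "hausdorff_content (?n - 1) (2 * \<delta>) (sphere (0::'a) 1) \<le> (\<Sum>i. hausdorff_gauge (?n - 1) (U i))"
      unfolding hausdorff_content_def by (rule INF_lower)
    also have "\<dots> = (\<Sum>i<card T. hausdorff_gauge (?n - 1) (U i))"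
      by (rule suminf_finite) (auto simp: U_def hausdorff_gauge_def)
    also have "\<dots> \<le> (\<Sum>i<card T. ennreal (unit_ball_vol (real (?n - 1)) * \<delta> ^ (?n - 1)))"
    proof (rule sum_mono)
      fix i assume "i \<in> {..<card T}"
      then have U: "U i = cball (h i) \<delta>" by (simp add: U_def)
      have "diameter (U i) / 2 \<le> \<delta>" unfolding U using diam[of "h i"] by simp
      moreover have "0 \<le> diameter (U i)" by (simp add: U diameter_ge_0)
      ultimately show "hausdorff_gauge (?n - 1) (U i) \<le> ennreal (unit_ball_vol (real (?n - 1)) * \<delta> ^ (?n - 1))"
        unfolding hausdorff_gauge_def by (auto intro!: ennreal_leI mult_left_mono power_mono)
    qed
    also have "\<dots> = ennreal (real (card T) * (unit_ball_vol (real (?n - 1)) * \<delta> ^ (?n - 1)))"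
      using \<delta> by (simp add: ennreal_of_nat_eq_real_of_nat ennreal_mult)
    also have "\<dots> \<le> ennreal K"
    proof (rule ennreal_leI)
      have "real (card T) * \<delta> ^ (?n - 1) \<le> 2 ^ (?n - 1) * 4 ^ ?n"
        using bound[OF T(1)] by (simp add: power_divide field_simps)
      then have "unit_ball_vol (real (?n - 1)) * (real (card T) * \<delta> ^ (?n - 1)) \<le> K"
        unfolding K_def by (intro mult_left_mono) auto
      then show "real (card T) * (unit_ball_vol (real (?n - 1)) * \<delta> ^ (?n - 1)) \<le> K"
        by (simp add: ac_simps)
    qed
    finally show ?thesis .
  qed
  have "hausdorff_outer (?n - 1) (sphere (0::'a) 1) \<le> ennreal K"
    unfolding hausdorff_outer_def
  proof (rule SUP_least)
    fix \<delta> :: real assume "\<delta> \<in> {0<..}"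
    then have d: "0 < min 1 (\<delta> / 2)" "min 1 (\<delta> / 2) \<le> 1" "2 * min 1 (\<delta> / 2) \<le> \<delta>" by auto
    show "hausdorff_content (?n - 1) \<delta> (sphere (0::'a) 1) \<le> ennreal K"
      using hausdorff_content_antimono[OF d(3)] content[OF d(1,2)] by (rule order_trans)
  qed
  then show ?thesis using ennreal_less_top le_less_trans by blast
qed

section \<open>Finite weighted integrals over annuli\<close>

text \<open>Equality almost everywhere says nothing about a given sphere, which is a null set.
  Setting a Borel version of \<open>Q\<close> to 0 on a Borel null set keeps it below
  \<open>Q\<close> at every point.\<close>

lemma lebesgue_borel_minorant:
  fixes Q :: "'a::euclidean_space \<Rightarrow> ennreal"
  assumes "Q \<in> borel_measurable lebesgue"
  obtains Q' where "Q' \<in> borel_measurable borel" "\<And>x. Q' x \<le> Q x" "AE x in lborel. Q' x = Q x"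
proof -
  obtain g where g: "g \<in> borel_measurable lborel" "AE x in lborel. Q x = g x"
    using completion_ex_borel_measurable[OF assms] by blast
  from AE_E[OF g(2)] obtain N where N: "{x \<in> space lborel. Q x \<noteq> g x} \<subseteq> N" "emeasure lborel N = 0" "N \<in> sets lborel"
    by blast
  define Q' where "Q' x = g x * indicator (- N) x" for x
  show thesis
  proof
    show "Q' \<in> borel_measurable borel"
      unfolding Q'_def using g(1) N(3) by measurable
    have off_N: "Q x = g x" if "x \<notin> N" for x using N(1) that by auto
    then show "Q' x \<le> Q x" for x
      by (cases "x \<in> N") (simp_all add: Q'_def)
    have "AE x in lborel. x \<notin> N"
      using N by (intro AE_not_in) (simp add: null_sets_def)
    then show "AE x in lborel. Q' x = Q x"
      by eventually_elim (simp add: Q'_def off_N)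
  qed
qed

text \<open>What the inverse Poletsky inequality needs in order to give a finite modulus, stated
  without \<open>f\<close>: each condition can then be treated as a property of \<open>Q\<close>
  alone.\<close>

definition finite_weighted_integral :: "('a::euclidean_space \<Rightarrow> ennreal) \<Rightarrow> 'a set \<Rightarrow> 'a \<Rightarrow> real \<Rightarrow> real \<Rightarrow> bool" where
  "finite_weighted_integral Q X y r\<^sub>1 r\<^sub>2 \<longleftrightarrow>
     (\<exists>\<eta> \<in> borel_measurable (lebesgue_on {r\<^sub>1<..<r\<^sub>2}).
        1 \<le> (\<integral>\<^sup>+ r \<in> {r\<^sub>1<..<r\<^sub>2}. \<eta> r \<partial>lebesgue) \<and>
        (\<integral>\<^sup>+ z \<in> annulus y r\<^sub>1 r\<^sub>2 \<inter> X. Q z * ennreal_powr (\<eta> (dist z y)) DIM('a) \<partial>lebesgue) < top)"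

lemma open_annulus: "open (annulus y r\<^sub>1 r\<^sub>2)"
  unfolding annulus_def by (intro open_Collect_conj open_Collect_less continuous_intros)

text \<open>The constant weight of integral 1 does it; its power is a finite factor.\<close>

lemma finite_weighted_integral_if_integrable:
  fixes Q :: "'a::euclidean_space \<Rightarrow> ennreal"
  assumes Q: "Q \<in> borel_measurable lebesgue" and X: "open X" and r: "r\<^sub>1 < r\<^sub>2"
    and fin: "(\<integral>\<^sup>+ z \<in> annulus y r\<^sub>1 r\<^sub>2 \<inter> X. Q z \<partial>lebesgue) < top"
  shows "finite_weighted_integral Q X y r\<^sub>1 r\<^sub>2"
  unfolding finite_weighted_integral_def
proof (intro bexI conjI)
  define c where "c = ennreal (1 / (r\<^sub>2 - r\<^sub>1))"
  let ?\<eta> = "\<lambda>r::real. c"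
  show "?\<eta> \<in> borel_measurable (lebesgue_on {r\<^sub>1<..<r\<^sub>2})" by simp
  have "(\<integral>\<^sup>+ r \<in> {r\<^sub>1<..<r\<^sub>2}. ?\<eta> r \<partial>lebesgue) = c * ennreal (r\<^sub>2 - r\<^sub>1)"
    using r by (subst nn_integral_cmult_indicator) auto
  also have "\<dots> = 1" using r by (simp add: c_def ennreal_mult[symmetric])
  finally show "1 \<le> (\<integral>\<^sup>+ r \<in> {r\<^sub>1<..<r\<^sub>2}. ?\<eta> r \<partial>lebesgue)" by simp
  have S: "annulus y r\<^sub>1 r\<^sub>2 \<inter> X \<in> sets lebesgue"
    using open_annulus[of y r\<^sub>1 r\<^sub>2] X by (intro sets_completionI_sets) auto
  note [measurable] = Q S
  have "(\<integral>\<^sup>+ z \<in> annulus y r\<^sub>1 r\<^sub>2 \<inter> X. Q z * ennreal_powr (?\<eta> (dist z y)) DIM('a) \<partial>lebesgue)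
    = (\<integral>\<^sup>+ z. (Q z * indicator (annulus y r\<^sub>1 r\<^sub>2 \<inter> X) z) * ennreal_powr c DIM('a) \<partial>lebesgue)"
    by (simp add: ac_simps)
  also have "\<dots> = (\<integral>\<^sup>+ z \<in> annulus y r\<^sub>1 r\<^sub>2 \<inter> X. Q z \<partial>lebesgue) * ennreal_powr c DIM('a)"
    by (rule nn_integral_multc) measurable
  also have "\<dots> < top"
    using fin by (simp add: ennreal_mult_less_top ennreal_powr_def c_def)
  finally show "(\<integral>\<^sup>+ z \<in> annulus y r\<^sub>1 r\<^sub>2 \<inter> X. Q z * ennreal_powr (?\<eta> (dist z y)) DIM('a) \<partial>lebesgue) < top" .
qed

text \<open>Unless the spherical integrals are infinite for almost all radii, the cone integrals
  \<open>\<phi>\<close> are at most some \<open>N\<close> on a set of radii of positive measure. The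
  weight is the indicator of that set, normalized to integral 1, and polar coordinates bound the
  weighted integral. The hypothesis, a negated almost-everywhere statement, asks for no
  measurability of the Hausdorff integrals in \<open>t\<close>.\<close>

lemma finite_weighted_integral_if_spheres:
  fixes Q :: "'a::euclidean_space \<Rightarrow> ennreal"
  assumes n: "DIM('a) \<ge> 2" and Q: "Q \<in> borel_measurable lebesgue" and ab: "0 < a" "a < b"
    and nAE: "\<not> (AE t in lebesgue. t \<in> {a<..<b} \<longrightarrow>
      (\<integral>\<^sup>+z \<in> sphere y t. Q z \<partial>hausdorff_measure (DIM('a) - 1)) = top)"
  shows "finite_weighted_integral Q X y a b"
proof -
  let ?n = "DIM('a)"
  obtain Q' where Q' [measurable]: "Q' \<in> borel_measurable borel" and Q'_le: "\<And>x. Q' x \<le> Q x"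
    and Q'_eq: "AE x in lborel. Q' x = Q x"
    using lebesgue_borel_minorant[OF Q] by blast
  \<comment> \<open>Up to a positive factor depending on \<open>t\<close>, this is a lower bound for
    the integral of \<open>Q\<close> over the sphere of radius \<open>t\<close>, and it is Borel in
    \<open>t\<close>.\<close>
  define \<phi> where "\<phi> t = (\<integral>\<^sup>+x. indicator (cball 0 1) x * Q' (y + t *\<^sub>R sgn x) \<partial>lborel)" for t
  have \<phi> [measurable]: "\<phi> \<in> borel_measurable borel"
    unfolding \<phi>_def
  proof (rule lborel.borel_measurable_nn_integral)
    have [measurable]: "cball (0::'a) 1 \<in> sets borel" by simp
    show "(\<lambda>(t, x). indicator (cball 0 1) x * Q' (y + t *\<^sub>R sgn x)) \<in> borel_measurable (borel \<Otimes>\<^sub>M (lborel :: 'a measure))"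
      by measurable
  qed
  define G where "G N = {t \<in> {a<..<b}. \<phi> t \<le> of_nat N}" for N :: nat
  have G [measurable]: "G N \<in> sets borel" for N
    unfolding G_def by measurable
  obtain N where N: "emeasure lborel (G N) > 0"
  proof (rule ccontr)
    assume "\<not> thesis"
    then have "emeasure lborel (G N) = 0" for N using that by (auto simp: zero_less_iff_neq_zero)
    then have "AE t in lborel. \<forall>N. t \<notin> G N"
      unfolding AE_all_countable by (intro allI AE_not_in) (simp add: null_sets_def)
    then have "AE t in lebesgue. \<forall>N. t \<notin> G N" by (rule AE_completion)
    then have "AE t in lebesgue. t \<in> {a<..<b} \<longrightarrow>
      (\<integral>\<^sup>+z \<in> sphere y t. Q z \<partial>hausdorff_measure (DIM('a) - 1)) = top"
    proof (eventually_elim, intro impI)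
      fix t assume t: "\<forall>N. t \<notin> G N" "t \<in> {a<..<b}"
      have t0: "0 < t" using t ab by simp
      have "\<phi> t = top"
      proof (rule ccontr)
        assume "\<phi> t \<noteq> top"
        then obtain N where "\<phi> t \<le> of_nat N" using ennreal_Ex_less_of_nat by (metis less_imp_le top.not_eq_extremum)
        then show False using t by (auto simp: G_def)
      qed
      \<comment> \<open>Infinity passes from the cone integral to the sphere by the one-sided
        comparison, and then from \<open>Q'\<close> to \<open>Q\<close> because
        \<open>Q' \<le> Q\<close> holds on the whole sphere.\<close>
      then have "top \<le> (\<integral>\<^sup>+z \<in> sphere y t. Q' z \<partial>hausdorff_measure (DIM('a) - 1))"
        using nn_integral_cone_le_hausdorff[OF t0 n Q', of y] cone_constant_pos[OF t0, where 'a = 'a]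
        by (simp add: \<phi>_def ennreal_mult_top)
      also have "\<dots> \<le> (\<integral>\<^sup>+z \<in> sphere y t. Q z \<partial>hausdorff_measure (DIM('a) - 1))"
        by (intro nn_integral_mono mult_right_mono Q'_le) simp
      finally show "(\<integral>\<^sup>+z \<in> sphere y t. Q z \<partial>hausdorff_measure (DIM('a) - 1)) = top"
        by (simp add: top_unique)
    qed
    then show False using nAE by blast
  qed
  have "emeasure lborel (G N) \<le> emeasure lborel {a<..<b}"
    by (rule emeasure_mono) (auto simp: G_def)
  also have "\<dots> < top" using ab by simp
  finally obtain m where m: "emeasure lborel (G N) = ennreal m" "m > 0"
    using N by (metis ennreal_cases ennreal_less_zero_iff less_irrefl top.not_eq_extremum infinity_ennreal_def)
  define \<eta> where "\<eta> t = indicator (G N) t * ennreal (1 / m)" for t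
  define C where "C = (1 / m) powr ?n"
  have powr_\<eta>: "ennreal_powr (\<eta> t) ?n = indicator (G N) t * ennreal C" for t
    using m by (auto simp: ennreal_powr_def \<eta>_def C_def indicator_def)
  show ?thesis
    unfolding finite_weighted_integral_def
  proof (intro bexI conjI)
    have [measurable]: "\<eta> \<in> borel_measurable borel" unfolding \<eta>_def by measurable
    then show "\<eta> \<in> borel_measurable (lebesgue_on {a<..<b})"
      by (intro measurable_restrict_space1 measurable_completion) simp
    have "(\<integral>\<^sup>+ r \<in> {a<..<b}. \<eta> r \<partial>lebesgue) = (\<integral>\<^sup>+ r. ennreal (1 / m) * indicator (G N) r \<partial>lborel)"
      unfolding nn_integral_completion by (intro nn_integral_cong) (auto simp: \<eta>_def indicator_def G_def)
    also have "\<dots> = 1"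
      using m by (subst nn_integral_cmult_indicator) (auto simp: ennreal_mult[symmetric])
    finally show "1 \<le> (\<integral>\<^sup>+ r \<in> {a<..<b}. \<eta> r \<partial>lebesgue)" by simp
    have "(\<integral>\<^sup>+ z \<in> annulus y a b \<inter> X. Q z * ennreal_powr (\<eta> (dist z y)) ?n \<partial>lebesgue)
      \<le> (\<integral>\<^sup>+ z. Q z * (indicator (G N) (dist z y) * ennreal C) \<partial>lborel)"
      unfolding nn_integral_completion powr_\<eta> by (intro nn_integral_mono) (auto simp: indicator_def)
    also have "\<dots> = (\<integral>\<^sup>+ z. Q' z * (indicator (G N) (dist z y) * ennreal C) \<partial>lborel)"
      using Q'_eq by (intro nn_integral_cong_AE) (auto elim!: eventually_mono)
    also have "\<dots> = (\<integral>\<^sup>+ x. Q' (y + x) * (indicator (G N) (norm x) * ennreal C) \<partial>lborel)"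
      by (subst lborel_affine[of 1 y], simp)
        (simp add: nn_integral_density nn_integral_distr dist_norm)
    also have "\<dots> = of_nat ?n * (\<integral>\<^sup>+r. indicator {0<..} r * ennreal (r ^ (?n - 1)) *
       (\<integral>\<^sup>+x. indicator (cball 0 1) x * (Q' (y + r *\<^sub>R sgn x) * (indicator (G N) (norm (r *\<^sub>R sgn x)) * ennreal C)) \<partial>(lborel :: 'a measure)) \<partial>lborel)"
      by (rule nn_integral_polar) measurable
    \<comment> \<open>On \<open>G N\<close> the radius is below \<open>b\<close> and the cone
      integral at most \<open>N\<close>; off \<open>G N\<close> the weight vanishes.\<close>
    also have "\<dots> \<le> of_nat ?n * (\<integral>\<^sup>+r. (ennreal (b ^ (?n - 1)) * of_nat N * ennreal C) * indicator (G N) r \<partial>lborel)"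
    proof (intro mult_left_mono nn_integral_mono)
      fix r :: real
      show "indicator {0<..} r * ennreal (r ^ (?n - 1)) *
       (\<integral>\<^sup>+x. indicator (cball 0 1) x * (Q' (y + r *\<^sub>R sgn x) * (indicator (G N) (norm (r *\<^sub>R sgn x)) * ennreal C)) \<partial>(lborel :: 'a measure))
       \<le> (ennreal (b ^ (?n - 1)) * of_nat N * ennreal C) * indicator (G N) r"
      proof (cases "r > 0")
        case True
        have "(\<integral>\<^sup>+x. indicator (cball 0 1) x * (Q' (y + r *\<^sub>R sgn x) * (indicator (G N) (norm (r *\<^sub>R sgn x)) * ennreal C)) \<partial>(lborel :: 'a measure))
          = (\<integral>\<^sup>+x. (indicator (cball 0 1) x * Q' (y + r *\<^sub>R sgn x)) * (indicator (G N) r * ennreal C) \<partial>lborel)"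
          using AE_lborel_singleton[of "0::'a"]
          by (intro nn_integral_cong_AE, eventually_elim) (use True in \<open>simp add: norm_sgn ac_simps\<close>)
        also have "\<dots> = \<phi> r * (indicator (G N) r * ennreal C)"
          unfolding \<phi>_def
        proof (rule nn_integral_multc)
          have [measurable]: "cball (0::'a) 1 \<in> sets borel" by simp
          show "(\<lambda>x. indicator (cball 0 1) x * Q' (y + r *\<^sub>R sgn x)) \<in> borel_measurable lborel"
            by measurable
        qed
        finally have eq: "(\<integral>\<^sup>+x. indicator (cball 0 1) x * (Q' (y + r *\<^sub>R sgn x) * (indicator (G N) (norm (r *\<^sub>R sgn x)) * ennreal C)) \<partial>(lborel :: 'a measure))
          = \<phi> r * (indicator (G N) r * ennreal C)" .
        show ?thesis
        proof (cases "r \<in> G N")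
          case inG: True
          then have "\<phi> r \<le> of_nat N" "r < b" by (auto simp: G_def)
          then have "ennreal (r ^ (?n - 1)) * (\<phi> r * ennreal C) \<le> ennreal (b ^ (?n - 1)) * (of_nat N * ennreal C)"
            using True by (intro mult_mono ennreal_leI power_mono) auto
          then show ?thesis using True inG unfolding eq by (simp add: mult.assoc)
        next
          case False
          then show ?thesis unfolding eq by simp
        qed
      qed simp
    qed auto
    also have "\<dots> < top"
      using m by (subst nn_integral_cmult_indicator)
        (auto simp: ennreal_mult_less_top of_nat_less_top)
    finally show "(\<integral>\<^sup>+ z \<in> annulus y a b \<inter> X. Q z * ennreal_powr (\<eta> (dist z y)) ?n \<partial>lebesgue) < top" .
  qed
qed

section \<open>From the conditions on the majorant to a finite modulus\<close>

text \<open>If the mean over a ball is infinite, the oscillation integrand is \<open>top\<close>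
  everywhere, as \<open>top - q = top\<close> even for \<open>q = top\<close>. So a finite
  oscillation at one small radius makes \<open>Q\<close> integrable on that ball.\<close>

lemma finite_mean_oscillation_at_imp_integrable:
  fixes Q :: "'a::euclidean_space \<Rightarrow> ennreal"
  assumes Q: "Q \<in> borel_measurable lebesgue" and fmo: "finite_mean_oscillation_at Q y" and e: "e > 0"
  obtains \<epsilon> where "0 < \<epsilon>" "\<epsilon> < e" "(\<integral>\<^sup>+ x \<in> ball y \<epsilon>. Q x \<partial>lebesgue) < top"
proof -
  define osc where "osc \<epsilon> = ball_mean (\<lambda>x. (Q x - ball_mean Q y \<epsilon>) + (ball_mean Q y \<epsilon> - Q x)) y \<epsilon>" for \<epsilon>
  have "Limsup (at_right 0) osc < top"
    using fmo by (simp add: finite_mean_oscillation_at_def osc_def[abs_def])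
  then have "\<forall>\<^sub>F \<epsilon> in at_right 0. osc \<epsilon> < top" by (rule Limsup_lessD)
  moreover have "\<forall>\<^sub>F \<epsilon> in at_right 0. \<epsilon> \<in> {0<..<e}"
    by (rule eventually_at_right_real[OF e])
  ultimately have "\<forall>\<^sub>F \<epsilon> in at_right 0. osc \<epsilon> < top \<and> 0 < \<epsilon> \<and> \<epsilon> < e"
    by eventually_elim simp
  then obtain \<epsilon> where \<epsilon>: "osc \<epsilon> < top" "0 < \<epsilon>" "\<epsilon> < e"
    using eventually_happens[of _ "at_right (0::real)"] by auto
  have [simp]: "unit_ball_vol (real DIM('a)) \<noteq> 0"
    using unit_ball_vol_pos[of "real DIM('a)"] by linarith
  have vol: "0 < unit_ball_vol (real DIM('a)) * \<epsilon> ^ DIM('a)" using \<epsilon> by simp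
  have "ball_mean Q y \<epsilon> < top"
  proof (rule ccontr)
    assume "\<not> ball_mean Q y \<epsilon> < top"
    then have "ball_mean Q y \<epsilon> = top" by (simp add: less_top[symmetric])
    then have "osc \<epsilon> = (\<integral>\<^sup>+ x \<in> ball y \<epsilon>. top \<partial>lebesgue) / ennreal (unit_ball_vol (real DIM('a)) * \<epsilon> ^ DIM('a))"
      by (simp add: osc_def ball_mean_def)
    also have "(\<integral>\<^sup>+ x \<in> ball y \<epsilon>. (top::ennreal) \<partial>lebesgue) = top * emeasure lebesgue (ball y \<epsilon>)"
      by (rule nn_integral_cmult_indicator) simp
    also have "\<dots> = top"
      using vol \<epsilon> by (simp add: emeasure_ball ennreal_top_mult)
    finally show False using \<epsilon>(1) vol by (simp add: ennreal_top_divide)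
  qed
  then have "(\<integral>\<^sup>+ x \<in> ball y \<epsilon>. Q x \<partial>lebesgue) < top"
    using vol by (auto simp: ball_mean_def less_top[symmetric] ennreal_top_divide)
  then show thesis using that \<epsilon> by blast
qed

text \<open>An infinite spherical integral makes the mean \<open>top\<close> and the integrand
  \<open>1 / top = 0\<close>; if this happened for almost every radius, the integral would
  vanish.\<close>

lemma positive_integral_imp_not_AE_infinite:
  fixes Q :: "'a::euclidean_space \<Rightarrow> ennreal"
  assumes n: "DIM('a) \<ge> 2" and ab: "0 < a" "a < b"
    and pos: "0 < (\<integral>\<^sup>+ t \<in> {a..b}. 1 / (ennreal t * ennreal_powr (sphere_mean Q y t) (1 / (real DIM('a) - 1))) \<partial>lebesgue)"
  shows "\<not> (AE t in lebesgue. t \<in> {a<..<b} \<longrightarrow>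
      (\<integral>\<^sup>+z \<in> sphere y t. Q z \<partial>hausdorff_measure (DIM('a) - 1)) = top)"
proof
  assume "AE t in lebesgue. t \<in> {a<..<b} \<longrightarrow>
      (\<integral>\<^sup>+z \<in> sphere y t. Q z \<partial>hausdorff_measure (DIM('a) - 1)) = top"
  moreover have "AE t in lebesgue. t \<noteq> a" "AE t in lebesgue. t \<noteq> b"
    by (rule AE_completion, rule AE_lborel_singleton)+
  ultimately have "AE t in lebesgue. 1 / (ennreal t * ennreal_powr (sphere_mean Q y t) (1 / (real DIM('a) - 1))) * indicator {a..b} t = 0"
  proof eventually_elim
    fix t assume t: "t \<in> {a<..<b} \<longrightarrow> (\<integral>\<^sup>+z \<in> sphere y t. Q z \<partial>hausdorff_measure (DIM('a) - 1)) = top"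
      "t \<noteq> a" "t \<noteq> b"
    show "1 / (ennreal t * ennreal_powr (sphere_mean Q y t) (1 / (real DIM('a) - 1))) * indicator {a..b} t = 0"
    proof (cases "t \<in> {a..b}")
      case True
      then have tt: "t \<in> {a<..<b}" using t by auto
      then have t0: "t > 0" using ab by auto
      have "sphere (0::'a) 1 \<in> sets (hausdorff_measure (DIM('a) - 1))"
        by (rule closed_in_sets_hausdorff_measure) simp
      then have "emeasure (hausdorff_measure (DIM('a) - 1)) (sphere (0::'a) 1) < top"
        using hausdorff_outer_sphere_finite[where 'a = 'a] by (simp add: emeasure_hausdorff_measure)
      then have "sphere_mean Q y t = top"
        using t tt unfolding sphere_mean_def
        by (simp add: ennreal_top_divide ennreal_mult_less_top less_top[symmetric] ennreal_mult_eq_top_iff)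
      then show ?thesis using t0 by (simp add: ennreal_powr_def ennreal_mult_top)
    qed simp
  qed
  then have "(\<integral>\<^sup>+ t \<in> {a..b}. 1 / (ennreal t * ennreal_powr (sphere_mean Q y t) (1 / (real DIM('a) - 1))) \<partial>lebesgue) = (\<integral>\<^sup>+ (t::real). 0 \<partial>lebesgue)"
    by (rule nn_integral_cong_AE)
  then show False using pos by simp
qed

lemma sphere_integrable_imp_not_AE_infinite:
  fixes Q :: "'a::euclidean_space \<Rightarrow> ennreal"
  assumes E: "E \<in> sets lebesgue" "E \<subseteq> {a..b}" "0 < emeasure lebesgue E"
    and int: "\<And>r. r \<in> E \<Longrightarrow> sphere_integrable Q y r"
  shows "\<not> (AE t in lebesgue. t \<in> {a<..<b} \<longrightarrow>
      (\<integral>\<^sup>+z \<in> sphere y t. Q z \<partial>hausdorff_measure (DIM('a) - 1)) = top)"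
proof
  assume "AE t in lebesgue. t \<in> {a<..<b} \<longrightarrow>
      (\<integral>\<^sup>+z \<in> sphere y t. Q z \<partial>hausdorff_measure (DIM('a) - 1)) = top"
  moreover have "AE t in lebesgue. t \<noteq> a" "AE t in lebesgue. t \<noteq> b"
    by (rule AE_completion, rule AE_lborel_singleton)+
  ultimately have "AE t in lebesgue. t \<notin> E"
    by eventually_elim (use E(2) int in \<open>force simp: sphere_integrable_def\<close>)
  then have "E \<in> null_sets lebesgue"
    using E(1) by (simp add: AE_iff_null_sets)
  then show False using E(3) by (simp add: null_sets_def)
qed

text \<open>The first and the last condition yield integrability over an annulus, the other two work
  through spheres. The bound \<open>e\<close> will keep the second cluster value outside the closed
  ball of radius \<open>r\<^sub>2\<close>.\<close>

lemma poletsky_modulus_finite: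
  fixes Q :: "'a::euclidean_space \<Rightarrow> ennreal" and f :: "'a \<Rightarrow> 'a"
  assumes n: "DIM('a) \<ge> 2" and D': "open D'" "D' \<noteq> {}" "y \<notin> D'" "f ` D = D'"
    and Q: "Q \<in> borel_measurable lebesgue"
    and pol: "inverse_poletsky_at DIM('a) D f Q y"
    and cond: "finite_mean_oscillation_at Q y \<or> positive_mean_integral_at Q y \<or>
       integrable_on_spheres_at D' Q y \<or> (\<integral>\<^sup>+ y \<in> D'. Q y \<partial>lebesgue) < top"
    and e: "e > 0"
  obtains r\<^sub>1 r\<^sub>2 where "0 < r\<^sub>1" "r\<^sub>1 < r\<^sub>2" "r\<^sub>2 < e" "modulus DIM('a) (poletsky_paths D f y r\<^sub>1 r\<^sub>2) < top"
proof -
  obtain z where z: "z \<in> D'" using D' by blast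
  define d where "d = min e (dist z y)"
  have d: "d > 0" "d \<le> e" using e z D' by (auto simp: d_def)
  have radius: "ereal r < outer_radius D' y" if "r < d" for r
  proof -
    have "ereal r < ereal (dist z y)" using that by (simp add: d_def)
    also have "\<dots> \<le> outer_radius D' y" unfolding outer_radius_def using z by (rule SUP_upper)
    finally show ?thesis .
  qed
  have "\<exists>r\<^sub>1 r\<^sub>2. 0 < r\<^sub>1 \<and> r\<^sub>1 < r\<^sub>2 \<and> r\<^sub>2 < d \<and> finite_weighted_integral Q D' y r\<^sub>1 r\<^sub>2"
    using cond
  proof (elim disjE)
    assume "finite_mean_oscillation_at Q y"
    then obtain \<epsilon> where \<epsilon>: "0 < \<epsilon>" "\<epsilon> < d" "(\<integral>\<^sup>+ x \<in> ball y \<epsilon>. Q x \<partial>lebesgue) < top"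
      using finite_mean_oscillation_at_imp_integrable[OF Q _ d(1)] by blast
    have "(\<integral>\<^sup>+ z \<in> annulus y (\<epsilon> / 2) \<epsilon> \<inter> D'. Q z \<partial>lebesgue) \<le> (\<integral>\<^sup>+ x \<in> ball y \<epsilon>. Q x \<partial>lebesgue)"
      by (intro nn_integral_mono) (auto simp: indicator_def annulus_def dist_commute)
    then have "finite_weighted_integral Q D' y (\<epsilon> / 2) \<epsilon>"
      using \<epsilon> D' by (intro finite_weighted_integral_if_integrable[OF Q]) auto
    then show ?thesis using \<epsilon> by (intro exI[of _ "\<epsilon> / 2"] exI[of _ \<epsilon>]) auto
  next
    assume "positive_mean_integral_at Q y"
    then obtain \<delta> where \<delta>: "\<delta> > 0" "\<And>b. 0 < b \<Longrightarrow> b < \<delta> \<Longrightarrow> \<exists>a. 0 < a \<and> a < b \<and>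
        0 < (\<integral>\<^sup>+ t \<in> {a..b}. 1 / (ennreal t * ennreal_powr (sphere_mean Q y t) (1 / (real DIM('a) - 1))) \<partial>lebesgue)"
      unfolding positive_mean_integral_at_def by blast
    define b where "b = min \<delta> d / 2"
    have b: "0 < b" "b < \<delta>" "b < d" using \<delta> d by (auto simp: b_def)
    from \<delta>(2)[OF b(1,2)] obtain a where a: "0 < a" "a < b"
      "0 < (\<integral>\<^sup>+ t \<in> {a..b}. 1 / (ennreal t * ennreal_powr (sphere_mean Q y t) (1 / (real DIM('a) - 1))) \<partial>lebesgue)"
      by blast
    have "finite_weighted_integral Q D' y a b"
      by (rule finite_weighted_integral_if_spheres[OF n Q a(1,2)
            positive_integral_imp_not_AE_infinite[OF n a]])
    then show ?thesis using a b by blast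
  next
    assume int: "integrable_on_spheres_at D' Q y"
    define a where "a = d / 3" 
    define b where "b = d / 2"
    have ab: "0 < a" "a < b" "b < d" using d by (auto simp: a_def b_def)
    have "\<exists>E \<in> sets lebesgue. E \<subseteq> {a..b} \<and> 0 < emeasure lebesgue E \<and> (\<forall>r\<in>E. sphere_integrable Q y r)"
      using int[unfolded integrable_on_spheres_at_def, rule_format, of a b] ab radius[OF ab(3)] by simp
    then obtain E where E: "E \<in> sets lebesgue" "E \<subseteq> {a..b}" "0 < emeasure lebesgue E"
      "\<And>r. r \<in> E \<Longrightarrow> sphere_integrable Q y r"
      by blast
    have "finite_weighted_integral Q D' y a b"
      by (rule finite_weighted_integral_if_spheres[OF n Q ab(1,2)
            sphere_integrable_imp_not_AE_infinite[OF E]])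
    then show ?thesis using ab by blast
  next
    assume fin: "(\<integral>\<^sup>+ y \<in> D'. Q y \<partial>lebesgue) < top"
    have "(\<integral>\<^sup>+ z \<in> annulus y (d / 3) (d / 2) \<inter> D'. Q z \<partial>lebesgue) \<le> (\<integral>\<^sup>+ y \<in> D'. Q y \<partial>lebesgue)"
      by (intro nn_integral_mono) (auto simp: indicator_def)
    then have "finite_weighted_integral Q D' y (d / 3) (d / 2)"
      using fin d D' by (intro finite_weighted_integral_if_integrable[OF Q]) auto
    then show ?thesis using d by (intro exI[of _ "d / 3"] exI[of _ "d / 2"]) auto
  qed
  then obtain r\<^sub>1 r\<^sub>2 where r: "0 < r\<^sub>1" "r\<^sub>1 < r\<^sub>2" "r\<^sub>2 < d" "finite_weighted_integral Q D' y r\<^sub>1 r\<^sub>2"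
    by blast
  then obtain \<eta> where \<eta>: "\<eta> \<in> borel_measurable (lebesgue_on {r\<^sub>1<..<r\<^sub>2})"
    "1 \<le> (\<integral>\<^sup>+ r \<in> {r\<^sub>1<..<r\<^sub>2}. \<eta> r \<partial>lebesgue)"
    "(\<integral>\<^sup>+ z \<in> annulus y r\<^sub>1 r\<^sub>2 \<inter> D'. Q z * ennreal_powr (\<eta> (dist z y)) DIM('a) \<partial>lebesgue) < top"
    unfolding finite_weighted_integral_def by blast
  have "modulus DIM('a) (poletsky_paths D f y r\<^sub>1 r\<^sub>2)
    \<le> (\<integral>\<^sup>+ z \<in> annulus y r\<^sub>1 r\<^sub>2 \<inter> D'. Q z * ennreal_powr (\<eta> (dist z y)) DIM('a) \<partial>lebesgue)"
    using pol \<eta>(1,2) r radius[OF r(3)] unfolding inverse_poletsky_at_def D'(4) by blast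
  also note \<eta>(3)
  finally show thesis using that r d by simp
qed

section \<open>Boundary behaviour\<close>

text \<open>Components of small boundary neighbourhoods are finitely many, so the fibres over one chosen
  point in each of them form a compact set, which the boundary point \<open>x\<^sub>0\<close> stays away from.\<close>

lemma continuum_leaving_neighbourhood:
  fixes f :: "'a::euclidean_space \<Rightarrow> 'a"
  assumes D: "open D" and cont: "continuous_on D f" and img: "f ` D = D'"
    and opn: "open_map (top_of_set D) euclidean f"
    and proper: "\<And>K. compact K \<Longrightarrow> K \<subseteq> D' \<Longrightarrow> compact {x \<in> D. f x \<in> K}"
    and D': "open D'" "finitely_connected_at_boundary D'"
    and y: "y \<in> ext_boundary D'" and W: "open W" "y \<in> W"
    and x0: "x\<^sub>0 \<notin> Fin ` D"
  obtains V U where "open V" "y \<in> V" "open U" "x\<^sub>0 \<in> U"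
    "\<And>x. x \<in> D \<Longrightarrow> Fin (f x) \<in> V \<Longrightarrow>
       \<exists>E z. compact E \<and> connected E \<and> E \<subseteq> D \<and> x \<in> E \<and> z \<in> E \<and> Fin z \<notin> U \<and> Fin ` f ` E \<subseteq> W"
proof -
  obtain V where V: "open V" "y \<in> V" "V \<subseteq> W" and fin: "finite (components (V \<inter> Fin ` D'))"
    using D'(2) y W unfolding finitely_connected_at_boundary_def by blast
  define w where "w c = (SOME v. Fin v \<in> c)" for c :: "'a ext set"
  have w: "Fin (w c) \<in> c" if c: "c \<in> components (V \<inter> Fin ` D')" for c
  proof -
    have "c \<noteq> {}" "c \<subseteq> V \<inter> Fin ` D'"
      using c in_components_nonempty in_components_subset by blast+
    then have "\<exists>v. Fin v \<in> c" by blast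
    then show ?thesis unfolding w_def by (rule someI_ex)
  qed
  define K where "K = (\<Union>c\<in>components (V \<inter> Fin ` D'). {x \<in> D. f x \<in> {w c}})"
  have wD': "w c \<in> D'" if "c \<in> components (V \<inter> Fin ` D')" for c
    using w[OF that] in_components_subset[OF that] by auto
  have "compact K"
    unfolding K_def using fin wD' by (intro compact_UN proper) auto
  then have "closed (Fin ` K)"
    by (intro compact_imp_closed compact_continuous_image continuous_on_Fin)
  moreover have "K \<subseteq> D" by (auto simp: K_def)
  ultimately have U: "open (- Fin ` K)" "x\<^sub>0 \<in> - Fin ` K" using x0 by auto
  show thesis
  proof (rule that[OF V(1,2) U])
    fix x assume x: "x \<in> D" "Fin (f x) \<in> V"
    define N where "N = {v \<in> D'. Fin v \<in> V}"
    have N: "open N"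
      using continuous_open_preimage[OF continuous_on_Fin D'(1) V(1)]
      by (simp add: N_def Int_def vimage_def)
    have N_eq: "Fin ` N = V \<inter> Fin ` D'" by (auto simp: N_def)
    define G where "G = connected_component_set N (f x)"
    have fxN: "f x \<in> N" using x img by (auto simp: N_def)
    have G: "open G" "connected G" "G \<subseteq> N" "f x \<in> G"
      using N fxN by (auto simp: G_def open_connected_component connected_component_subset)
    define c where "c = connected_component_set (V \<inter> Fin ` D') (Fin (f x))"
    have fxV: "Fin (f x) \<in> V \<inter> Fin ` D'" using fxN N_eq by blast
    then have c: "c \<in> components (V \<inter> Fin ` D')" by (auto simp: c_def components_def)
    \<comment> \<open>Finite connectedness concerns components in the extended space, while
      preimages are taken of components in the finite space; \<open>unfin\<close> carries the former
      into the latter.\<close>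
    have "unfin ` c \<subseteq> G"
      unfolding G_def
    proof (rule connected_component_maximal)
      have sub: "c \<subseteq> V \<inter> Fin ` D'" unfolding c_def by (rule connected_component_subset)
      show "f x \<in> unfin ` c"
        using fxV unfolding c_def by (metis connected_component_refl_eq image_eqI mem_Collect_eq unfin_Fin)
      show "connected (unfin ` c)"
        using sub by (intro connected_continuous_image continuous_on_subset[OF continuous_on_unfin])
          (auto simp: c_def)
      show "unfin ` c \<subseteq> N"
      proof
        fix v assume "v \<in> unfin ` c"
        then obtain p where p: "p \<in> c" "v = unfin p" by blast
        then obtain u where "u \<in> D'" "p = Fin u" using sub by blast
        then show "v \<in> N" using p sub by (auto simp: N_def)
      qed
    qed
    then have "w c \<in> G" using w[OF c] by (metis image_eqI subsetD unfin_Fin)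
    moreover have "G \<subseteq> D'" using G(3) by (auto simp: N_def)
    ultimately obtain E z where E: "compact E" "connected E" "E \<subseteq> D" "x \<in> E" "z \<in> E" "f z = w c" "f ` E \<subseteq> G"
      using component_of_preimage_onto[OF D cont img opn proper G(1,2) _ x(1) G(4), of "w c"] by blast
    have "z \<in> K" unfolding K_def using c E by auto
    moreover have "Fin ` f ` E \<subseteq> W" using E(7) G(3) V(3) by (auto simp: N_def)
    ultimately show "\<exists>E z. compact E \<and> connected E \<and> E \<subseteq> D \<and> x \<in> E \<and> z \<in> E \<and> Fin z \<notin> - Fin ` K \<and> Fin ` f ` E \<subseteq> W"
      using E by blast
  qed
qed

text \<open>The set \<open>A\<close> is a parameter because convergence will be proved by looking at
  those points of \<open>D\<close> whose values avoid a neighbourhood of the expected limit.\<close>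

definition cluster_value :: "('a::real_inner \<Rightarrow> 'a) \<Rightarrow> 'a set \<Rightarrow> 'a ext \<Rightarrow> 'a ext \<Rightarrow> bool" where
  "cluster_value f A x\<^sub>0 y \<longleftrightarrow>
     (\<forall>U V. open U \<longrightarrow> x\<^sub>0 \<in> U \<longrightarrow> open V \<longrightarrow> y \<in> V \<longrightarrow> (\<exists>x\<in>A. Fin x \<in> U \<and> Fin (f x) \<in> V))"

lemma cluster_value_mono: "cluster_value f A x\<^sub>0 y \<Longrightarrow> A \<subseteq> B \<Longrightarrow> cluster_value f B x\<^sub>0 y"
  unfolding cluster_value_def by blast

lemma cluster_value_exists:
  fixes f :: "'a::euclidean_space \<Rightarrow> 'a"
  assumes "x\<^sub>0 \<in> closure (Fin ` A)"
  obtains y where "cluster_value f A x\<^sub>0 y"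
proof -
  obtain p where p: "\<And>k::nat. p k \<in> Fin ` A" "p \<longlonglongrightarrow> x\<^sub>0"
    using assms by (auto simp: closure_sequential)
  then have "\<forall>k. \<exists>a. a \<in> A \<and> p k = Fin a" by blast
  then obtain a where a: "\<And>k. a k \<in> A" "\<And>k. p k = Fin (a k)" by metis
  obtain y r where y: "strict_mono r" "((\<lambda>k. Fin (f (a k))) \<circ> r) \<longlonglongrightarrow> y"
    using compact_ext_UNIV[where 'a = 'a] unfolding compact_def by blast
  have "cluster_value f A x\<^sub>0 y"
    unfolding cluster_value_def
  proof (intro allI impI)
    fix U V assume U: "open U" "x\<^sub>0 \<in> U" and V: "open V" "y \<in> V"
    have "(p \<circ> r) \<longlonglongrightarrow> x\<^sub>0" using p(2) y(1) by (rule LIMSEQ_subseq_LIMSEQ)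
    then have "\<forall>\<^sub>F k in sequentially. (p \<circ> r) k \<in> U" using U by (rule topological_tendstoD)
    moreover have "\<forall>\<^sub>F k in sequentially. ((\<lambda>k. Fin (f (a k))) \<circ> r) k \<in> V"
      using y(2) V by (rule topological_tendstoD)
    ultimately have "\<forall>\<^sub>F k in sequentially. (p \<circ> r) k \<in> U \<and> ((\<lambda>k. Fin (f (a k))) \<circ> r) k \<in> V"
      by (rule eventually_conj)
    then obtain k where "(p \<circ> r) k \<in> U" "((\<lambda>k. Fin (f (a k))) \<circ> r) k \<in> V"
      using eventually_happens'[OF sequentially_bot] by blast
    then show "\<exists>x\<in>A. Fin x \<in> U \<and> Fin (f x) \<in> V"
      using a by (intro bexI[of _ "a (r k)"]) auto
  qed
  then show thesis by (rule that)
qed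

lemma ext_boundary_open:
  assumes "open D"
  shows "ext_boundary D = closure (Fin ` D) - Fin ` D"
  using open_Fin_image[OF assms] by (simp add: ext_boundary_def frontier_def interior_open)

text \<open>A point of \<open>D'\<close> has a compact neighbourhood in \<open>D'\<close>. By
  properness its preimage is compact in \<open>D\<close> and therefore stays away from
  \<open>x\<^sub>0\<close>.\<close>

lemma cluster_value_in_boundary:
  fixes f :: "'a::euclidean_space \<Rightarrow> 'a"
  assumes D: "open D" and D': "open D'" and img: "f ` D = D'"
    and proper: "\<And>K. compact K \<Longrightarrow> K \<subseteq> D' \<Longrightarrow> compact {x \<in> D. f x \<in> K}"
    and x0: "x\<^sub>0 \<notin> Fin ` D" and y: "cluster_value f D x\<^sub>0 y"
  shows "y \<in> ext_boundary D'"
  unfolding ext_boundary_open[OF D']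
proof
  show "y \<in> closure (Fin ` D')"
  proof (rule ccontr)
    assume "y \<notin> closure (Fin ` D')"
    then obtain x where "x \<in> D" "Fin (f x) \<notin> closure (Fin ` D')"
      using y[unfolded cluster_value_def, rule_format, of UNIV "- closure (Fin ` D')"] by auto
    moreover have "Fin (f x) \<in> Fin ` D'" using \<open>x \<in> D\<close> img by auto
    then have "Fin (f x) \<in> closure (Fin ` D')" by (rule subsetD[OF closure_subset])
    ultimately show False by blast
  qed
  show "y \<notin> Fin ` D'"
  proof
    assume "y \<in> Fin ` D'"
    then obtain b where b: "y = Fin b" "b \<in> D'" by blast
    obtain d where d: "d > 0" "cball b d \<subseteq> D'" using D' b(2) open_contains_cball by blast
    define K where "K = {x \<in> D. f x \<in> cball b d}"
    have "compact K" unfolding K_def using d by (intro proper) auto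
    then have "closed (Fin ` K)"
      by (intro compact_imp_closed compact_continuous_image continuous_on_Fin)
    moreover have "x\<^sub>0 \<notin> Fin ` K" using x0 by (auto simp: K_def)
    ultimately obtain x where "x \<in> D" "Fin x \<notin> Fin ` K" "Fin (f x) \<in> Fin ` ball b d"
      using y[unfolded cluster_value_def, rule_format, of "- Fin ` K" "Fin ` ball b d"] d b
        open_Fin_image[of "ball b d"] by auto
    then show False by (auto simp: K_def)
  qed
qed

lemma cluster_value_unique_finite:
  fixes D D' :: "'a::euclidean_space set" and f :: "'a \<Rightarrow> 'a"
  assumes n: "DIM('a) \<ge> 2"
    and D: "open D" "weakly_flat_boundary D"
    and D': "open D'" "finitely_connected_at_boundary D'"
    and cont: "continuous_on D f" and img: "f ` D = D'"
    and opn: "open_map (top_of_set D) euclidean f"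
    and proper: "\<And>K. compact K \<Longrightarrow> K \<subseteq> D' \<Longrightarrow> compact {x \<in> D. f x \<in> K}"
    and modulus: "\<And>e. e > 0 \<Longrightarrow> \<exists>r\<^sub>1 r\<^sub>2. 0 < r\<^sub>1 \<and> r\<^sub>1 < r\<^sub>2 \<and> r\<^sub>2 < e \<and>
       modulus DIM('a) (poletsky_paths D f b r\<^sub>1 r\<^sub>2) < top"
    and x0: "x\<^sub>0 \<in> ext_boundary D"
    and b: "Fin b \<in> ext_boundary D'" "cluster_value f D x\<^sub>0 (Fin b)"
    and y: "y \<in> ext_boundary D'" "cluster_value f D x\<^sub>0 y"
  shows "y = Fin b"
proof (rule ccontr)
  assume "y \<noteq> Fin b"
  have x0D: "x\<^sub>0 \<notin> Fin ` D" using x0 ext_boundary_open[OF D(1)] by blast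
  \<comment> \<open>For a finite \<open>y\<close> its distance from \<open>b\<close> is the bound;
    for \<open>Infty\<close> any positive number serves.\<close>
  obtain e where e: "e > 0" "\<And>r. r < e \<Longrightarrow> y \<notin> Fin ` cball b r"
  proof (cases y)
    case (Fin z)
    show thesis
      by (rule that[of "dist b z"]) (use Fin \<open>y \<noteq> Fin b\<close> in auto)
  next
    case Infty
    show thesis
      by (rule that[of 1]) (use Infty in auto)
  qed
  obtain r\<^sub>1 r\<^sub>2 where r: "0 < r\<^sub>1" "r\<^sub>1 < r\<^sub>2" "r\<^sub>2 < e"
    and fin: "modulus DIM('a) (poletsky_paths D f b r\<^sub>1 r\<^sub>2) < top"
    using modulus[OF e(1)] by blast
  define W\<^sub>1 where "W\<^sub>1 = Fin ` ball b r\<^sub>1"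
  define W\<^sub>2 where "W\<^sub>2 = - Fin ` cball b r\<^sub>2"
  have W\<^sub>1: "open W\<^sub>1" "Fin b \<in> W\<^sub>1" using r by (auto simp: W\<^sub>1_def open_Fin_image)
  have "closed (Fin ` cball b r\<^sub>2)"
    by (intro compact_imp_closed compact_continuous_image continuous_on_Fin) simp
  then have W\<^sub>2: "open W\<^sub>2" "y \<in> W\<^sub>2" using e(2)[OF r(3)] by (auto simp: W\<^sub>2_def)
  obtain V\<^sub>1 U\<^sub>1 where V\<^sub>1: "open V\<^sub>1" "Fin b \<in> V\<^sub>1" "open U\<^sub>1" "x\<^sub>0 \<in> U\<^sub>1"
    and E: "\<And>x. x \<in> D \<Longrightarrow> Fin (f x) \<in> V\<^sub>1 \<Longrightarrow> \<exists>E z. compact E \<and> connected E \<and> E \<subseteq> D \<and> x \<in> E \<and> z \<in> E \<and>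
       Fin z \<notin> U\<^sub>1 \<and> Fin ` f ` E \<subseteq> W\<^sub>1"
    using continuum_leaving_neighbourhood[OF D(1) cont img opn proper D' b(1) W\<^sub>1 x0D] by blast
  obtain V\<^sub>2 U\<^sub>2 where V\<^sub>2: "open V\<^sub>2" "y \<in> V\<^sub>2" "open U\<^sub>2" "x\<^sub>0 \<in> U\<^sub>2"
    and F: "\<And>x. x \<in> D \<Longrightarrow> Fin (f x) \<in> V\<^sub>2 \<Longrightarrow> \<exists>E z. compact E \<and> connected E \<and> E \<subseteq> D \<and> x \<in> E \<and> z \<in> E \<and>
       Fin z \<notin> U\<^sub>2 \<and> Fin ` f ` E \<subseteq> W\<^sub>2"
    using continuum_leaving_neighbourhood[OF D(1) cont img opn proper D' y(1) W\<^sub>2 x0D] by blast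
  \<comment> \<open>Weak flatness takes one neighbourhood for both continua, so both must leave the
    intersection. It is fixed before the points \<open>x\<close> and \<open>x'\<close> near
    \<open>x\<^sub>0\<close> are chosen.\<close>
  define U where "U = U\<^sub>1 \<inter> U\<^sub>2"
  have U: "open U" "x\<^sub>0 \<in> U" using V\<^sub>1 V\<^sub>2 by (auto simp: U_def)
  obtain m where m: "modulus DIM('a) (poletsky_paths D f b r\<^sub>1 r\<^sub>2) = ennreal m" "0 \<le> m"
    using fin by (metis ennreal_cases less_irrefl)
  \<comment> \<open>The modulus \<open>m\<close> may be 0, whereas weak flatness is stated for
    positive constants.\<close>
  then have "m + 1 > 0" by simp
  then obtain V where V: "open V" "x\<^sub>0 \<in> V" "V \<subseteq> U"
    and flat: "\<And>E F. compact E \<and> connected E \<and> E \<subseteq> D \<and> compact F \<and> connected F \<and> F \<subseteq> D \<and>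
              Fin ` E \<inter> frontier U \<noteq> {} \<and> Fin ` E \<inter> frontier V \<noteq> {} \<and>
              Fin ` F \<inter> frontier U \<noteq> {} \<and> Fin ` F \<inter> frontier V \<noteq> {} \<Longrightarrow>
              ennreal (m + 1) < modulus (real DIM('a)) (joining_paths E F D)"
    using D(2)[unfolded weakly_flat_boundary_def, rule_format, OF x0, of "m + 1" U] U by blast
  \<comment> \<open>A connected set with a point in \<open>V \<subseteq> U\<close> and a point
    outside \<open>U\<close> meets the frontiers of both.\<close>
  have frontier: "Fin ` E \<inter> frontier U \<noteq> {} \<and> Fin ` E \<inter> frontier V \<noteq> {}"
    if "connected E" "x \<in> E" "z \<in> E" "Fin x \<in> V" "Fin z \<notin> U" for E x z
  proof -
    have "connected (Fin ` E)" using that by (intro connected_continuous_image continuous_on_Fin)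
    moreover have "Fin ` E \<inter> V \<noteq> {}" "Fin ` E \<inter> U \<noteq> {}" "Fin ` E - V \<noteq> {}" "Fin ` E - U \<noteq> {}"
      using that V(3) by blast+
    ultimately show ?thesis using connected_Int_frontier by blast
  qed
  obtain x where x: "x \<in> D" "Fin x \<in> V" "Fin (f x) \<in> V\<^sub>1"
    using b(2) V V\<^sub>1 unfolding cluster_value_def by blast
  obtain x' where x': "x' \<in> D" "Fin x' \<in> V" "Fin (f x') \<in> V\<^sub>2"
    using y(2) V V\<^sub>2 unfolding cluster_value_def by blast
  obtain E z where E: "compact E" "connected E" "E \<subseteq> D" "x \<in> E" "z \<in> E" "Fin z \<notin> U" "Fin ` f ` E \<subseteq> W\<^sub>1"
    using E[OF x(1,3)] by (auto simp: U_def)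
  obtain F z' where F: "compact F" "connected F" "F \<subseteq> D" "x' \<in> F" "z' \<in> F" "Fin z' \<notin> U" "Fin ` f ` F \<subseteq> W\<^sub>2"
    using F[OF x'(1,3)] by (auto simp: U_def)
  have "ennreal (m + 1) < modulus (real DIM('a)) (joining_paths E F D)"
    using frontier[OF E(2,4,5) x(2) E(6)] frontier[OF F(2,4,5) x'(2) F(6)] E F
    by (intro flat) simp
  also have "\<dots> \<le> modulus (real DIM('a)) (poletsky_paths D f b r\<^sub>1 r\<^sub>2)"
  proof (rule modulus_joining_paths_le_poletsky_paths[OF cont E(3) _ F(3) _ r(2)])
    show "f ` E \<subseteq> cball b r\<^sub>1" using E(7) by (force simp: W\<^sub>1_def)
    show "f ` F \<inter> ball b r\<^sub>2 = {}" using F(7) by (force simp: W\<^sub>2_def)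
  qed
  also have "\<dots> = ennreal m" by (rule m(1))
  finally show False using m(2) by (simp add: ennreal_less_iff)
qed

text \<open>The limits at the added points fit together continuously because the target, a metric
  space, is regular.\<close>

lemma continuous_extension_to_closure:
  fixes g :: "'a::metric_space \<Rightarrow> 'b::metric_space"
  assumes cont: "continuous_on S g"
    and lim: "\<And>x. x \<in> closure S - S \<Longrightarrow> \<exists>l. (g \<longlongrightarrow> l) (at x within S)"
  obtains G where "continuous_on (closure S) G" "\<And>x. x \<in> S \<Longrightarrow> G x = g x"
proof -
  have at_eq: "atin_within euclidean x S = at x within S" for x
    by (rule filter_eqI) (simp add: eventually_atin_within eventually_at_topological, blast)
  obtain G where "continuous_map (top_of_set (closure S)) euclidean G" "\<And>x. x \<in> S \<Longrightarrow> G x = g x"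
  proof (rule continuous_map_extension_pointwise_alt[of euclidean S "closure S" euclidean g])
    show "\<exists>l. limitin euclidean g l (atin_within euclidean x S)" if "x \<in> closure S - S" for x
      using lim[OF that] by (simp add: at_eq)
  qed (use cont closure_subset[of S] in \<open>auto simp: regular_space_euclidean\<close>)
  then show thesis using that by simp
qed

theorem theorem1p1:
  fixes D D' :: "(real ^ 'n) set"
    and f :: "real ^ 'n \<Rightarrow> real ^ 'n"
    and Q :: "real ^ 'n \<Rightarrow> ennreal"
  assumes dim: "CARD('n) \<ge> 2"
    and D: "is_domain D" "weakly_flat_boundary D"
    and D': "is_domain D'" "finitely_connected_at_boundary D'"
    and Q: "Q \<in> borel_measurable lebesgue"
    and f_mapping: "continuous_on D f" "f ` D = D'"
    and f_open: "open_map (top_of_set D) euclidean f"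
    and f_discrete: "\<forall>y. discrete {x \<in> D. f x = y}"
    and f_closed: "closed_map (top_of_set D) (top_of_set D') f"
    and f_poletsky: "\<forall>y\<^sub>0 \<in> ext_boundary D'. inverse_poletsky (real CARD('n)) D f Q y\<^sub>0"
    and conditions:
      "(\<forall>y\<^sub>0 \<in> ext_boundary D'. finite_mean_oscillation Q y\<^sub>0) \<or>
       (\<forall>y\<^sub>0 \<in> ext_boundary D'. positive_mean_integral Q y\<^sub>0) \<or>
       (\<forall>y\<^sub>0 \<in> ext_boundary D'. integrable_on_spheres D' Q y\<^sub>0) \<or>
       (\<integral>\<^sup>+ y \<in> D'. Q y \<partial>lebesgue) < top"
  shows "\<exists>F :: (real ^ 'n) ext \<Rightarrow> (real ^ 'n) ext.
           continuous_on (ext_closure D) F \<and>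
           (\<forall>x\<in>D. F (Fin x) = Fin (f x)) \<and>
           F ` ext_closure D = ext_closure D'"
proof -
  have n: "DIM(real ^ 'n) \<ge> 2" using dim by simp
  have oD: "open D" and oD': "open D'" "D' \<noteq> {}" using D D' by (auto simp: is_domain_def)
  have proper: "compact {x \<in> D. f x \<in> K}" if "compact K" "K \<subseteq> D'" for K
    using discrete_closed_map_imp_compact_preimage[OF oD f_mapping(1) _ f_closed that] f_discrete by blast
  have modulus: "\<exists>r\<^sub>1 r\<^sub>2. 0 < r\<^sub>1 \<and> r\<^sub>1 < r\<^sub>2 \<and> r\<^sub>2 < e \<and>
       modulus DIM(real ^ 'n) (poletsky_paths D f b r\<^sub>1 r\<^sub>2) < top"
    if b: "Fin b \<in> ext_boundary D'" and e: "e > 0" for b e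
  proof -
    have "inverse_poletsky (real CARD('n)) D f Q (Fin b)" using f_poletsky b by blast
    then have pol: "inverse_poletsky_at (real DIM(real ^ 'n)) D f Q b" by simp
    have "finite_mean_oscillation Q (Fin b) \<or> positive_mean_integral Q (Fin b) \<or>
       integrable_on_spheres D' Q (Fin b) \<or> (\<integral>\<^sup>+ y \<in> D'. Q y \<partial>lebesgue) < top"
      using conditions b by blast
    then have cond: "finite_mean_oscillation_at Q b \<or> positive_mean_integral_at Q b \<or>
       integrable_on_spheres_at D' Q b \<or> (\<integral>\<^sup>+ y \<in> D'. Q y \<partial>lebesgue) < top"
      by simp
    have "b \<notin> D'" using b ext_boundary_open[OF oD'(1)] by blast
    from poletsky_modulus_finite[OF n oD' this f_mapping(2) Q pol cond e]
    show ?thesis by metis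
  qed
  define g where "g p = Fin (f (unfin p))" for p
  have cont_g: "continuous_on (Fin ` D) g"
    unfolding g_def
    by (intro continuous_on_compose2[OF continuous_on_Fin[of UNIV]] continuous_on_compose2[OF f_mapping(1)]
        continuous_on_subset[OF continuous_on_unfin]) auto
  have lim: "\<exists>l. (g \<longlongrightarrow> l) (at x\<^sub>0 within Fin ` D)" if "x\<^sub>0 \<in> closure (Fin ` D) - Fin ` D" for x\<^sub>0
  proof -
    have x0: "x\<^sub>0 \<in> ext_boundary D" "x\<^sub>0 \<notin> Fin ` D" using that ext_boundary_open[OF oD] by auto
    have boundary: "y \<in> ext_boundary D'" if "cluster_value f D x\<^sub>0 y" for y
      by (rule cluster_value_in_boundary[OF oD oD'(1) f_mapping(2) proper x0(2) that])
    have unique: "y = Fin b" if "cluster_value f D x\<^sub>0 (Fin b)" "cluster_value f D x\<^sub>0 y" for b y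
      by (rule cluster_value_unique_finite[OF n oD D(2) oD'(1) D'(2) f_mapping f_open proper
            modulus[OF boundary[OF that(1)]] x0(1) boundary[OF that(1)] that(1) boundary[OF that(2)] that(2)])
    obtain y where y: "cluster_value f D x\<^sub>0 y"
      using cluster_value_exists[of x\<^sub>0 D f] \<open>x\<^sub>0 \<in> closure (Fin ` D) - Fin ` D\<close> by blast
    have "(g \<longlongrightarrow> y) (at x\<^sub>0 within Fin ` D)"
    proof (rule topological_tendstoI)
      fix V assume V: "open V" "y \<in> V"
      \<comment> \<open>If \<open>x\<^sub>0\<close> were adherent to these points, compactness would
        give a cluster value along them; by uniqueness it would be \<open>y\<close>, although all
        their values avoid \<open>V\<close>.\<close>
      define A where "A = {x \<in> D. Fin (f x) \<notin> V}"
      have "x\<^sub>0 \<notin> closure (Fin ` A)"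
      proof
        assume "x\<^sub>0 \<in> closure (Fin ` A)"
        then obtain y' where y': "cluster_value f A x\<^sub>0 y'" using cluster_value_exists by blast
        then have "cluster_value f D x\<^sub>0 y'" by (rule cluster_value_mono) (auto simp: A_def)
        \<comment> \<open>If one of the two is finite, it takes the role of \<open>b\<close> in
          \<open>unique\<close>; otherwise both are \<open>Infty\<close>.\<close>
        then have "y' = y" using unique y by (cases y; cases y') metis+
        then obtain x where "x \<in> A" "Fin (f x) \<in> V"
          using y' V unfolding cluster_value_def by (metis UNIV_I open_UNIV)
        then show False by (simp add: A_def)
      qed
      then show "\<forall>\<^sub>F p in at x\<^sub>0 within Fin ` D. g p \<in> V"
        unfolding eventually_at_topological
      proof (intro exI[of _ "- closure (Fin ` A)"] conjI ballI impI)
        fix p assume p: "p \<in> - closure (Fin ` A)" "p \<in> Fin ` D"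
        then obtain x where x: "x \<in> D" "p = Fin x" by blast
        have "Fin x \<notin> Fin ` A" using p x closure_subset[of "Fin ` A"] by blast
        then show "g p \<in> V" using x by (auto simp: g_def A_def)
      qed (use \<open>x\<^sub>0 \<notin> closure (Fin ` A)\<close> in auto)
    qed
    then show ?thesis by blast
  qed
  obtain F where F: "continuous_on (closure (Fin ` D)) F" "\<And>p. p \<in> Fin ` D \<Longrightarrow> F p = g p"
    using continuous_extension_to_closure[OF cont_g lim] by blast
  have F_Fin: "F (Fin x) = Fin (f x)" if "x \<in> D" for x
    using F(2)[of "Fin x"] that by (simp add: g_def)
  then have img: "F ` Fin ` D = Fin ` D'"
    using f_mapping(2) by (force simp: image_image)
  have "F ` closure (Fin ` D) \<subseteq> closure (Fin ` D')"
    using img closure_subset[of "Fin ` D'"] by (intro image_closure_subset[OF F(1)]) auto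
  \<comment> \<open>Surjectivity comes from compactness: the image of the compact closure is closed
    and contains \<open>D'\<close>, hence also its closure.\<close>
  moreover have "closure (Fin ` D') \<subseteq> F ` closure (Fin ` D)"
  proof (rule closure_minimal)
    show "Fin ` D' \<subseteq> F ` closure (Fin ` D)"
      using img closure_subset[of "Fin ` D"] by blast
    have "compact (closure (Fin ` D))"
      using compact_Int_closed[OF compact_ext_UNIV closed_closure] by simp
    then show "closed (F ` closure (Fin ` D))"
      by (intro compact_imp_closed compact_continuous_image F(1))
  qed
  ultimately show ?thesis
    using F(1) F_Fin unfolding ext_closure_def by blast
qed

end
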